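(* Let $\ell\in\{1,2,3\}$ and let $M^1,M^2$ be structures in the same relational vocabulary $\tau$. Then $\mathrm{Th}(M^1\oplus M^2)$ is strongly dependent$_\ell$ if and only if both $\mathrm{Th}(M^1)$ and $\mathrm{Th}(M^2)$ are strongly dependent$_\ell$.
   Context: For structures $M,N$ in a relational vocabulary $\tau$ with disjoint universes, $M\oplus N$ is the structure in vocabulary $\tau\cup\{L,R\}$ ($L,R$ new unary predicates) with universe $|M|\cup|N|$, $S^{M\oplus N}=S^M\cup S^N$ for each $S\in\tau$, $L^{M\oplus N}=|M|$, $R^{M\oplus N}=|N|$. For a complete theory $T$, work in its monster model $\mathfrak{C}$; tuples are finite, types are over subsets of $\mathfrak{C}$, $\mathrm{Dom}(p)$ is the set of parameters of $p$. Dividing, for a type $p(\bar x)$, a set $A$ and $n<\omega$: ($\ell=1$) $p$ ict$^1$-$n$-divides over $A$ if there are a linear order $I$, a sequence $\langle\bar a_t:t\in I\rangle$ indiscernible over $A$ and $s_0<t_0\le s_1<t_1\le\dots\le s_{n-1}<t_{n-1}$ in $I$ such that for every $\bar c$ realizing $p$ and $i<n$: $\mathrm{tp}(\bar c^\frown\bar a_{s_i}/A)\neq\mathrm{tp}(\bar c^\frown\bar a_{t_i}/A)$. ($\ell=2$) Same, but with $\mathrm{tp}(\bar c^\frown\bar a_{s_i}/A\cup\{\bar a_{s_j}:j<i\})\neq\mathrm{tp}(\bar c^\frown\bar a_{t_i}/A\cup\{\bar a_{s_j}:j<i\})$. ($\ell=3$) For a linear order $I$ let $\mathtt{M}_n(I)$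 be the structure with universe the disjoint union of $I$ and the set of strictly increasing sequences of length $<n$ from $I$, with relations $<$, unary $S_k$ ($S_k(\bar t)$ iff $\lg\bar t=k$) and binary $R_k$ ($R_k(\bar t,t)$ iff $t$ is the $k$-th entry of $\bar t$). $\langle\bar a_t:t\in\mathtt{M}_n(I)\rangle$ is indiscernible over $A$ if tuples of indices with the same quantifier-free type in $\mathtt{M}_n(I)$ give tuples with the same type over $A$. $p$ ict$^3$-$n$-divides over $A$ if there are such an indiscernible family over $A$ and $s_0<t_0\le\dots\le s_{n-1}<t_{n-1}$ in $I$ such that for every $\bar c$ realizing $p$ and $i<n$: $\mathrm{tp}(\bar c^\frown\bar a_{s_i}/A\cup\bar a_{\langle s_0,\dots,s_{i-1}\rangle})\neq\mathrm{tp}(\bar c^\frown\bar a_{t_i}/A\cup\bar a_{\langle s_0,\dots,s_{i-1}\rangle})$. Forking: $p$ ict$^\ell$-$n$-forks over $A$ if $p\vdash\bigvee_{i<k}\varphi_i(\bar x,\bar c_i)$ for finitely many formulas each of which ict$^\ell$-$n$-divides over $A$. $T$ is strongly dependent$_\ell$ (i.e. $\kappa_{\mathrm{ict},\ell}(T)=\aleph_0$) iff there is no type $p(\bar x)$ such that for every $n<\omega$ and every finite $A\subseteq\mathrm{Dom}(p)$, $p$ ict$^\ell$-$n$-forks over $A$. *)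

theory Defs
  imports Main
begin

unbundle cardinal_syntax

record 's vocab =
  syms :: "'s set"
  ar :: "'s \<Rightarrow> nat"

record ('s, 'a) struc =
  univ :: "'a set"
  rel :: "'s \<Rightarrow> 'a list set"

definition is_structure :: "'s vocab \<Rightarrow> ('s, 'a) struc \<Rightarrow> bool" where
  "is_structure \<tau> M \<longleftrightarrow> univ M \<noteq> {} \<and>
     (\<forall>S\<in>syms \<tau>. \<forall>xs\<in>rel M S. xs \<in> lists (univ M) \<and> length xs = ar \<tau> S)"

text \<open>Variables are de Bruijn indices: in the environment \<open>e\<close> the variable \<open>i\<close> has the value
  \<open>e ! i\<close>, and a quantifier pushes its value in front of the environment.  The formulas
  \<open>\<phi>\<close> with \<open>fm_in \<tau> n \<phi>\<close> are those whose free variables are among the first \<open>n\<close>.\<close>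

datatype 's fm =
    Eq nat nat
  | Rel 's "nat list"
  | Neg "'s fm"
  | Conj "'s fm" "'s fm"
  | Ex "'s fm"

primrec fm_in :: "'s vocab \<Rightarrow> nat \<Rightarrow> 's fm \<Rightarrow> bool" where
  "fm_in \<tau> n (Eq i j) \<longleftrightarrow> i < n \<and> j < n"
| "fm_in \<tau> n (Rel S is) \<longleftrightarrow> S \<in> syms \<tau> \<and> length is = ar \<tau> S \<and> (\<forall>i\<in>set is. i < n)"
| "fm_in \<tau> n (Neg \<phi>) \<longleftrightarrow> fm_in \<tau> n \<phi>"
| "fm_in \<tau> n (Conj \<phi> \<psi>) \<longleftrightarrow> fm_in \<tau> n \<phi> \<and> fm_in \<tau> n \<psi>"
| "fm_in \<tau> n (Ex \<phi>) \<longleftrightarrow> fm_in \<tau> (Suc n) \<phi>"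

primrec sat :: "('s, 'a) struc \<Rightarrow> 'a list \<Rightarrow> 's fm \<Rightarrow> bool" where
  "sat M e (Eq i j) \<longleftrightarrow> e ! i = e ! j"
| "sat M e (Rel S is) \<longleftrightarrow> map (\<lambda>i. e ! i) is \<in> rel M S"
| "sat M e (Neg \<phi>) \<longleftrightarrow> \<not> sat M e \<phi>"
| "sat M e (Conj \<phi> \<psi>) \<longleftrightarrow> sat M e \<phi> \<and> sat M e \<psi>"
| "sat M e (Ex \<phi>) \<longleftrightarrow> (\<exists>a\<in>univ M. sat M (a # e) \<phi>)"

primrec qfree :: "'s fm \<Rightarrow> bool" where
  "qfree (Eq i j) \<longleftrightarrow> True"
| "qfree (Rel S is) \<longleftrightarrow> True"
| "qfree (Neg \<phi>) \<longleftrightarrow> qfree \<phi>"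
| "qfree (Conj \<phi> \<psi>) \<longleftrightarrow> qfree \<phi> \<and> qfree \<psi>"
| "qfree (Ex \<phi>) \<longleftrightarrow> False"

definition Th :: "'s vocab \<Rightarrow> ('s, 'a) struc \<Rightarrow> 's fm set" where
  "Th \<tau> M = {\<phi>. fm_in \<tau> 0 \<phi> \<and> sat M [] \<phi>}"

datatype 's sum_sym = Old 's | LSym | RSym

definition sum_vocab :: "'s vocab \<Rightarrow> 's sum_sym vocab" where
  "sum_vocab \<tau> = \<lparr> syms = Old ` syms \<tau> \<union> {LSym, RSym},
     ar = (\<lambda>S. case S of Old S' \<Rightarrow> ar \<tau> S' | LSym \<Rightarrow> 1 | RSym \<Rightarrow> 1) \<rparr>"

text \<open>The universes are made disjoint by the injections into the sum type.\<close>

definition sum_struc ::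
    "('s, 'a) struc \<Rightarrow> ('s, 'b) struc \<Rightarrow> ('s sum_sym, 'a + 'b) struc" (infixl "\<oplus>\<^sub>s" 65) where
  "M \<oplus>\<^sub>s N = \<lparr> univ = Inl ` univ M \<union> Inr ` univ N,
     rel = (\<lambda>S. case S of
         Old S' \<Rightarrow> map Inl ` rel M S' \<union> map Inr ` rel N S'
       | LSym \<Rightarrow> {[Inl a] | a. a \<in> univ M}
       | RSym \<Rightarrow> {[Inr b] | b. b \<in> univ N}) \<rparr>"

text \<open>The pair \<open>(\<phi>, d)\<close> stands for the formula \<open>\<phi>(x, d)\<close> with parameters \<open>d\<close>: a tuple \<open>c\<close>
  satisfies it iff \<open>sat C (c @ d) \<phi>\<close>.\<close>

type_synonym ('s, 'a) pfm = "'s fm \<times> 'a list"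

definition pfm_in :: "'s vocab \<Rightarrow> 'a set \<Rightarrow> nat \<Rightarrow> ('s, 'a) pfm \<Rightarrow> bool" where
  "pfm_in \<tau> B m = (\<lambda>(\<phi>, d). set d \<subseteq> B \<and> fm_in \<tau> (m + length d) \<phi>)"

definition psat :: "('s, 'a) struc \<Rightarrow> 'a list \<Rightarrow> ('s, 'a) pfm \<Rightarrow> bool" where
  "psat C c = (\<lambda>(\<phi>, d). sat C (c @ d) \<phi>)"

definition tuples :: "('s, 'a) struc \<Rightarrow> nat \<Rightarrow> 'a list set" where
  "tuples C m = {c. c \<in> lists (univ C) \<and> length c = m}"

definition realizations :: "('s, 'a) struc \<Rightarrow> nat \<Rightarrow> ('s, 'a) pfm set \<Rightarrow> 'a list set" where
  "realizations C m p = {c \<in> tuples C m. \<forall>f\<in>p. psat C c f}"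

text \<open>Types in \<open>m\<close> variables are partial types, i.e. finitely satisfiable sets of formulas.\<close>

definition is_type :: "'s vocab \<Rightarrow> ('s, 'a) struc \<Rightarrow> nat \<Rightarrow> ('s, 'a) pfm set \<Rightarrow> bool" where
  "is_type \<tau> C m p \<longleftrightarrow> (\<forall>f\<in>p. pfm_in \<tau> (univ C) m f) \<and>
     (\<forall>q. finite q \<and> q \<subseteq> p \<longrightarrow> realizations C m q \<noteq> {})"

definition Dom :: "('s, 'a) pfm set \<Rightarrow> 'a set" where
  "Dom p = (\<Union>f\<in>p. set (snd f))"

definition tp :: "'s vocab \<Rightarrow> ('s, 'a) struc \<Rightarrow> 'a list \<Rightarrow> 'a set \<Rightarrow> ('s, 'a) pfm set" where
  "tp \<tau> C c A = {f. pfm_in \<tau> A (length c) f \<and> psat C c f}"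

definition qftp :: "'s vocab \<Rightarrow> ('s, 'a) struc \<Rightarrow> 'a list \<Rightarrow> 's fm set" where
  "qftp \<tau> M c = {\<phi>. qfree \<phi> \<and> fm_in \<tau> (length c) \<phi> \<and> sat M c \<phi>}"

definition saturated :: "'s vocab \<Rightarrow> 'k rel \<Rightarrow> ('s, 'a) struc \<Rightarrow> bool" where
  "saturated \<tau> \<kappa> C \<longleftrightarrow>
     (\<forall>m p. is_type \<tau> C m p \<and> |Dom p| <o \<kappa> \<longrightarrow> realizations C m p \<noteq> {})"

definition elementary_map ::
    "'s vocab \<Rightarrow> ('s, 'a) struc \<Rightarrow> 'a set \<Rightarrow> ('a \<Rightarrow> 'a) \<Rightarrow> bool" where
  "elementary_map \<tau> C X g \<longleftrightarrow> g ` X \<subseteq> univ C \<and>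
     (\<forall>c \<phi>. c \<in> lists X \<and> fm_in \<tau> (length c) \<phi> \<longrightarrow> (sat C (map g c) \<phi> \<longleftrightarrow> sat C c \<phi>))"

definition automorphism :: "'s vocab \<Rightarrow> ('s, 'a) struc \<Rightarrow> ('a \<Rightarrow> 'a) \<Rightarrow> bool" where
  "automorphism \<tau> C h \<longleftrightarrow> bij_betw h (univ C) (univ C) \<and>
     (\<forall>S\<in>syms \<tau>. \<forall>c\<in>tuples C (ar \<tau> S). map h c \<in> rel C S \<longleftrightarrow> c \<in> rel C S)"

definition strongly_homogeneous :: "'s vocab \<Rightarrow> 'k rel \<Rightarrow> ('s, 'a) struc \<Rightarrow> bool" where
  "strongly_homogeneous \<tau> \<kappa> C \<longleftrightarrow>
     (\<forall>X g. X \<subseteq> univ C \<and> |X| <o \<kappa> \<and> elementary_map \<tau> C X g \<longrightarrow>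
        (\<exists>h. automorphism \<tau> C h \<and> (\<forall>x\<in>X. h x = g x)))"

text \<open>A monster model of \<open>T\<close> is a \<open>\<kappa>\<close>-saturated, strongly \<open>\<kappa>\<close>-homogeneous model for an
  uncountable cardinal \<open>\<kappa>\<close> exceeding the size of the vocabulary; a set is small if its
  cardinality is below \<open>\<kappa>\<close>.\<close>

definition monster_model ::
    "'s vocab \<Rightarrow> 's fm set \<Rightarrow> 'k rel \<Rightarrow> ('s, 'a) struc \<Rightarrow> bool" where
  "monster_model \<tau> T \<kappa> C \<longleftrightarrow>
     is_structure \<tau> C \<and> (\<forall>\<phi>\<in>T. sat C [] \<phi>) \<and>
     Card_order \<kappa> \<and> natLeq <o \<kappa> \<and> |syms \<tau>| <o \<kappa> \<and>
     saturated \<tau> \<kappa> C \<and> strongly_homogeneous \<tau> \<kappa> C"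

definition lt :: "'i rel \<Rightarrow> 'i \<Rightarrow> 'i \<Rightarrow> bool" where
  "lt r s t \<longleftrightarrow> (s, t) \<in> r \<and> s \<noteq> t"

definition incr :: "'i set \<Rightarrow> 'i rel \<Rightarrow> 'i list set" where
  "incr I r = {ts \<in> lists I. sorted_wrt (lt r) ts}"

definition indisc_seq :: "'s vocab \<Rightarrow> ('s, 'a) struc \<Rightarrow> 'a set \<Rightarrow> 'i set \<Rightarrow> 'i rel \<Rightarrow>
    ('i \<Rightarrow> 'a list) \<Rightarrow> bool" where
  "indisc_seq \<tau> C A I r a \<longleftrightarrow> (\<forall>t\<in>I. a t \<in> lists (univ C)) \<and>
     (\<forall>us\<in>incr I r. \<forall>vs\<in>incr I r. length us = length vs \<longrightarrow>
        tp \<tau> C (concat (map a us)) A = tp \<tau> C (concat (map a vs)) A)"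

text \<open>The index structure \<open>M\<^sub>n(I)\<close>: the left summand is \<open>I\<close>, the right one consists of the
  increasing sequences of length below \<open>n\<close>; entries are counted from \<open>0\<close>.\<close>

datatype idx_sym = LessS | LenS nat | EntryS nat

definition idx_vocab :: "idx_sym vocab" where
  "idx_vocab = \<lparr> syms = UNIV, ar = (\<lambda>S. case S of LessS \<Rightarrow> 2 | LenS k \<Rightarrow> 1 | EntryS k \<Rightarrow> 2) \<rparr>"

definition idx_struc :: "nat \<Rightarrow> 'i set \<Rightarrow> 'i rel \<Rightarrow> (idx_sym, 'i + 'i list) struc" where
  "idx_struc n I r =
     (let Q = {ts \<in> incr I r. length ts < n} in
      \<lparr> univ = Inl ` I \<union> Inr ` Q,
        rel = (\<lambda>S. case S of
            LessS \<Rightarrow> {[Inl s, Inl t] | s t. s \<in> I \<and> t \<in> I \<and> lt r s t}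
          | LenS k \<Rightarrow> {[Inr ts] | ts. ts \<in> Q \<and> length ts = k}
          | EntryS k \<Rightarrow> {[Inr ts, Inl (ts ! k)] | ts. ts \<in> Q \<and> k < length ts}) \<rparr>)"

definition indisc_family :: "'s vocab \<Rightarrow> ('s, 'a) struc \<Rightarrow> 'a set \<Rightarrow> nat \<Rightarrow> 'i set \<Rightarrow> 'i rel \<Rightarrow>
    ('i + 'i list \<Rightarrow> 'a list) \<Rightarrow> bool" where
  "indisc_family \<tau> C A n I r a \<longleftrightarrow>
     (let M = idx_struc n I r in
      (\<forall>u\<in>univ M. a u \<in> lists (univ C)) \<and>
      (\<forall>us\<in>lists (univ M). \<forall>vs\<in>lists (univ M).
         length us = length vs \<and> qftp idx_vocab M us = qftp idx_vocab M vs \<longrightarrow>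
         tp \<tau> C (concat (map a us)) A = tp \<tau> C (concat (map a vs)) A))"

text \<open>Indiscernible sequences are indexed by infinite linear orders, as is the convention: finite
  ones need not extend to infinite ones, and with them dividing would not correspond to
  \<open>\<kappa>\<^sub>i\<^sub>c\<^sub>t\<close>.  Index orders are small, so up to isomorphism they may be taken
  inside the type \<open>'k\<close> underlying the cardinal \<open>\<kappa>\<close>.\<close>

definition index_order :: "'k rel \<Rightarrow> 'k set \<Rightarrow> 'k rel \<Rightarrow> bool" where
  "index_order \<kappa> I r \<longleftrightarrow> linear_order_on I r \<and> infinite I \<and> |I| <o \<kappa>"

definition interleaved ::
    "'i set \<Rightarrow> 'i rel \<Rightarrow> nat \<Rightarrow> (nat \<Rightarrow> 'i) \<Rightarrow> (nat \<Rightarrow> 'i) \<Rightarrow> bool" where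
  "interleaved I r n s t \<longleftrightarrow>
     (\<forall>i<n. s i \<in> I \<and> t i \<in> I \<and> lt r (s i) (t i)) \<and>
     (\<forall>i. Suc i < n \<longrightarrow> (t i, s (Suc i)) \<in> r)"

definition ict1_divides :: "'s vocab \<Rightarrow> 'k rel \<Rightarrow> ('s, 'a) struc \<Rightarrow> nat \<Rightarrow> nat \<Rightarrow>
    ('s, 'a) pfm set \<Rightarrow> 'a set \<Rightarrow> bool" where
  "ict1_divides \<tau> \<kappa> C n m p A \<longleftrightarrow>
     (\<exists>I r a s t. index_order \<kappa> I r \<and> indisc_seq \<tau> C A I r a \<and> interleaved I r n s t \<and>
        (\<forall>c\<in>realizations C m p. \<forall>i<n.
           tp \<tau> C (c @ a (s i)) A \<noteq> tp \<tau> C (c @ a (t i)) A))"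

definition ict2_divides :: "'s vocab \<Rightarrow> 'k rel \<Rightarrow> ('s, 'a) struc \<Rightarrow> nat \<Rightarrow> nat \<Rightarrow>
    ('s, 'a) pfm set \<Rightarrow> 'a set \<Rightarrow> bool" where
  "ict2_divides \<tau> \<kappa> C n m p A \<longleftrightarrow>
     (\<exists>I r a s t. index_order \<kappa> I r \<and> indisc_seq \<tau> C A I r a \<and> interleaved I r n s t \<and>
        (\<forall>c\<in>realizations C m p. \<forall>i<n.
           tp \<tau> C (c @ a (s i)) (A \<union> (\<Union>j<i. set (a (s j)))) \<noteq>
           tp \<tau> C (c @ a (t i)) (A \<union> (\<Union>j<i. set (a (s j))))))"

definition ict3_divides :: "'s vocab \<Rightarrow> 'k rel \<Rightarrow> ('s, 'a) struc \<Rightarrow> nat \<Rightarrow> nat \<Rightarrow>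
    ('s, 'a) pfm set \<Rightarrow> 'a set \<Rightarrow> bool" where
  "ict3_divides \<tau> \<kappa> C n m p A \<longleftrightarrow>
     (\<exists>I r a s t. index_order \<kappa> I r \<and> indisc_family \<tau> C A n I r a \<and> interleaved I r n s t \<and>
        (\<forall>c\<in>realizations C m p. \<forall>i<n.
           tp \<tau> C (c @ a (Inl (s i))) (A \<union> set (a (Inr (map s [0..<i])))) \<noteq>
           tp \<tau> C (c @ a (Inl (t i))) (A \<union> set (a (Inr (map s [0..<i]))))))"

definition ict_divides :: "nat \<Rightarrow> 's vocab \<Rightarrow> 'k rel \<Rightarrow> ('s, 'a) struc \<Rightarrow> nat \<Rightarrow> nat \<Rightarrow>
    ('s, 'a) pfm set \<Rightarrow> 'a set \<Rightarrow> bool" where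
  "ict_divides l \<tau> \<kappa> C n m p A \<longleftrightarrow>
     (l = 1 \<and> ict1_divides \<tau> \<kappa> C n m p A) \<or>
     (l = 2 \<and> ict2_divides \<tau> \<kappa> C n m p A) \<or>
     (l = 3 \<and> ict3_divides \<tau> \<kappa> C n m p A)"

definition ict_forks :: "nat \<Rightarrow> 's vocab \<Rightarrow> 'k rel \<Rightarrow> ('s, 'a) struc \<Rightarrow> nat \<Rightarrow> nat \<Rightarrow>
    ('s, 'a) pfm set \<Rightarrow> 'a set \<Rightarrow> bool" where
  "ict_forks l \<tau> \<kappa> C n m p A \<longleftrightarrow>
     (\<exists>F. finite F \<and>
        (\<forall>f\<in>F. pfm_in \<tau> (univ C) m f \<and> ict_divides l \<tau> \<kappa> C n m {f} A) \<and>
        (\<forall>c\<in>realizations C m p. \<exists>f\<in>F. psat C c f))"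

text \<open>Strong dependence of the complete theory whose monster model (with respect to \<open>\<kappa>\<close>) is
  \<open>C\<close>.  As always in a monster model, types are over small sets.\<close>

definition strongly_dependent ::
    "nat \<Rightarrow> 's vocab \<Rightarrow> 'k rel \<Rightarrow> ('s, 'a) struc \<Rightarrow> bool" where
  "strongly_dependent l \<tau> \<kappa> C \<longleftrightarrow>
     \<not> (\<exists>m p. is_type \<tau> C m p \<and> |Dom p| <o \<kappa> \<and>
          (\<forall>n A. finite A \<and> A \<subseteq> Dom p \<longrightarrow> ict_forks l \<tau> \<kappa> C n m p A))"

end

theory Submission
  imports Defs "HOL-Library.Countable_Set"
begin

text \<open>Dividing can be tested on indiscernible families indexed by \<open>\<omega>\<close>, and a type witnessing the
  failure of strong dependence can be cut down to the type of a tuple over a countable set.  So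
  strong dependence only depends on the theory, and the monster models of the two summands may be
  replaced by the two parts of the monster model of the sum.

  A formula over the sum is a finite disjunction of boxes \<open>\<alpha>(x\<^sub>L) \<and> \<beta>(x\<^sub>R)\<close>.  If
  such a box divides with \<open>2 n\<^sub>1 + 2 n\<^sub>2\<close> stages, then each stage is witnessed in the left part by all
  realizations of \<open>\<alpha>\<close>, or in the right part by all realizations of \<open>\<beta>\<close>; hence the left part takes care
  of \<open>2 n\<^sub>1\<close> stages or the right part of \<open>2 n\<^sub>2\<close>.  The remaining stages are dropped by grouping the family
  into blocks, which turns dividing with \<open>2 n\<^sub>1\<close> of the stages into forking with \<open>n\<^sub>1\<close> stages.  So
  non-forking in both parts yields non-forking in the sum.\<close>

section \<open>Partial elementary relations\<close>

text \<open>For \<open>l = 2\<close> and \<open>l = 3\<close> a stage cannot simply be deleted: the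
  tuples of omitted stages remain parameters of the comparisons at all later stages. Hence a kept
  stage must become a block that also contains the omitted stages after it. Now \<open>t i\<close>
  may lie inside the span of the block that starts at \<open>s i\<close>, so the second tuple of the
  new pair cannot be a block placed at \<open>t i\<close>. It is put later than the whole first
  block: as the tuples at \<open>s i\<close> and \<open>t i\<close> have different types, one of
  them differs in type from a common later tuple. Which one depends on the realization, and sorting
  the realizations by this choice is the reason why dividing only yields forking. The factor 2 pays
  for a gap between kept stages: consecutive stages may have \<open>t i = s (i + 1)\<close>, and
  then \<open>t i\<close> would belong to the next block. Types are treated throughout as elementary
  relations, which can be restricted, inverted, composed and glued along the two sides of a sum.
  Families over omega being countable, extending such relations element by element only needs types
  over finite sets.\<close>

primrec ren :: "(nat \<Rightarrow> nat) \<Rightarrow> 's fm \<Rightarrow> 's fm" where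
  "ren g (Eq i j) = Eq (g i) (g j)"
| "ren g (Rel S is) = Rel S (map g is)"
| "ren g (Neg \<phi>) = Neg (ren g \<phi>)"
| "ren g (Conj \<phi> \<psi>) = Conj (ren g \<phi>) (ren g \<psi>)"
| "ren g (Ex \<phi>) = Ex (ren (case_nat 0 (Suc \<circ> g)) \<phi>)"

lemma fm_in_ren:
  "fm_in \<tau> n \<phi> \<Longrightarrow> (\<And>i. i < n \<Longrightarrow> g i < k) \<Longrightarrow> fm_in \<tau> k (ren g \<phi>)"
proof (induction \<phi> arbitrary: n g k)
  case (Ex \<phi>)
  have "fm_in \<tau> (Suc k) (ren (case_nat 0 (Suc \<circ> g)) \<phi>)"
    by (rule Ex.IH[of "Suc n"]) (use Ex.prems in \<open>auto split: nat.splits\<close>)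
  then show ?case by simp
qed auto

lemma sat_ren:
  "fm_in \<tau> n \<phi> \<Longrightarrow> (\<And>i. i < n \<Longrightarrow> e' ! g i = e ! i) \<Longrightarrow> sat M e' (ren g \<phi>) \<longleftrightarrow> sat M e \<phi>"
proof (induction \<phi> arbitrary: n g e e')
  case (Rel S "is")
  then have "map (\<lambda>i. e' ! i) (map g is) = map (\<lambda>i. e ! i) is" by auto
  then show ?case by (simp only: ren.simps sat.simps)
next
  case (Ex \<phi>)
  have "sat M (a # e') (ren (case_nat 0 (Suc \<circ> g)) \<phi>) \<longleftrightarrow> sat M (a # e) \<phi>" for a
    by (rule Ex.IH[of "Suc n"]) (use Ex.prems in \<open>auto split: nat.splits\<close>)
  then show ?case by simp
next
  case (Conj \<phi> \<psi>)
  from Conj.prems(1) have "fm_in \<tau> n \<phi>" "fm_in \<tau> n \<psi>" by auto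
  with Conj.IH Conj.prems(2) show ?case by (metis ren.simps(4) sat.simps(4))
next
  case (Neg \<phi>)
  then show ?case by (metis fm_in.simps(3) ren.simps(3) sat.simps(3))
qed auto

text \<open>The empty conjunction must be a sentence, well-formed with no free variable at all;
  \<open>Eq 0 0\<close> is not, so its variable is bound.\<close>

definition conjs :: "'s fm list \<Rightarrow> 's fm" where
  "conjs \<phi>s = foldr Conj \<phi>s (Neg (Ex (Neg (Eq 0 0))))"

lemma fm_in_conjs [simp]: "fm_in \<tau> n (conjs \<phi>s) \<longleftrightarrow> (\<forall>\<phi>\<in>set \<phi>s. fm_in \<tau> n \<phi>)"
  by (induction \<phi>s) (auto simp: conjs_def)

lemma sat_conjs [simp]: "sat M e (conjs \<phi>s) \<longleftrightarrow> (\<forall>\<phi>\<in>set \<phi>s. sat M e \<phi>)"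
  by (induction \<phi>s) (auto simp: conjs_def)

text \<open>Elementary partial maps are kept as relations so that they can be inverted, composed and
  compared coordinatewise with \<open>zip\<close>, also between structures on different types. The
  one notion covers elementary equivalence (\<open>P\<close> empty), equality of types over a set
  (\<open>Id_on A\<close> added) and indiscernibility.\<close>

definition elem :: "'s vocab \<Rightarrow> ('s, 'a) struc \<Rightarrow> ('s, 'b) struc \<Rightarrow> ('a \<times> 'b) set \<Rightarrow> bool" where
  "elem \<tau> C D P \<longleftrightarrow> P \<subseteq> univ C \<times> univ D \<and>
     (\<forall>ps \<phi>. set ps \<subseteq> P \<and> fm_in \<tau> (length ps) \<phi> \<longrightarrow>
        (sat C (map fst ps) \<phi> \<longleftrightarrow> sat D (map snd ps) \<phi>))"

lemma elem_sat:
  "elem \<tau> C D P \<Longrightarrow> set ps \<subseteq> P \<Longrightarrow> fm_in \<tau> (length ps) \<phi> \<Longrightarrow>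
     sat C (map fst ps) \<phi> \<longleftrightarrow> sat D (map snd ps) \<phi>"
  by (auto simp: elem_def)

lemma elem_sat_zip:
  assumes "elem \<tau> C D P" "set (zip e e') \<subseteq> P" "length e = length e'" "fm_in \<tau> (length e) \<phi>"
  shows "sat C e \<phi> \<longleftrightarrow> sat D e' \<phi>"
  using elem_sat[OF assms(1,2), of \<phi>] assms(3,4) by simp

lemma elem_mono: "elem \<tau> C D P \<Longrightarrow> P' \<subseteq> P \<Longrightarrow> elem \<tau> C D P'"
  unfolding elem_def by blast

lemma elem_univ: "elem \<tau> C D P \<Longrightarrow> P \<subseteq> univ C \<times> univ D"
  by (auto simp: elem_def)

lemma elem_finitary:
  assumes "\<And>P'. finite P' \<Longrightarrow> P' \<subseteq> P \<Longrightarrow> elem \<tau> C D P'"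
  shows "elem \<tau> C D P"
  unfolding elem_def
proof (intro conjI allI impI)
  show "P \<subseteq> univ C \<times> univ D"
  proof
    fix p assume "p \<in> P"
    then have "elem \<tau> C D {p}" using assms[of "{p}"] by auto
    then show "p \<in> univ C \<times> univ D" by (auto simp: elem_def)
  qed
next
  fix ps \<phi> assume "set ps \<subseteq> P \<and> fm_in \<tau> (length ps) \<phi>"
  then show "sat C (map fst ps) \<phi> \<longleftrightarrow> sat D (map snd ps) \<phi>"
    using elem_sat[OF assms[of "set ps"]] by auto
qed

lemma elem_converse:
  assumes "elem \<tau> C D P" shows "elem \<tau> D C (P\<inverse>)"
  unfolding elem_def
proof (intro conjI allI impI)
  show "P\<inverse> \<subseteq> univ D \<times> univ C" using assms by (auto simp: elem_def)
next
  fix ps \<phi> assume A: "set ps \<subseteq> P\<inverse> \<and> fm_in \<tau> (length ps) \<phi>"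
  let ?qs = "map prod.swap ps"
  have "set ?qs \<subseteq> P" using A by auto
  with elem_sat[OF assms, of ?qs \<phi>] A
  show "sat D (map fst ps) \<phi> \<longleftrightarrow> sat C (map snd ps) \<phi>" by (simp add: comp_def)
qed

lemma elem_comp:
  assumes P: "elem \<tau> C D P" and Q: "elem \<tau> D E Q" shows "elem \<tau> C E (P O Q)"
  unfolding elem_def
proof (intro conjI allI impI)
  show "P O Q \<subseteq> univ C \<times> univ E" using assms by (auto simp: elem_def)
next
  fix ps \<phi> assume A: "set ps \<subseteq> P O Q \<and> fm_in \<tau> (length ps) \<phi>"
  have "\<forall>p\<in>set ps. \<exists>y. (fst p, y) \<in> P \<and> (y, snd p) \<in> Q"
  proof
    fix p assume "p \<in> set ps"
    with A have "p \<in> P O Q" by blast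
    then show "\<exists>y. (fst p, y) \<in> P \<and> (y, snd p) \<in> Q" by auto
  qed
  then obtain g where g: "\<And>p. p \<in> set ps \<Longrightarrow> (fst p, g p) \<in> P \<and> (g p, snd p) \<in> Q" by metis
  have "set (map (\<lambda>p. (fst p, g p)) ps) \<subseteq> P" "set (map (\<lambda>p. (g p, snd p)) ps) \<subseteq> Q"
    using g by (auto simp: image_subset_iff simp del: split_paired_All)
  note PQ = elem_sat[OF P this(1)] elem_sat[OF Q this(2)]
  have "sat C (map fst ps) \<phi> \<longleftrightarrow> sat D (map g ps) \<phi>"
    using PQ(1)[of \<phi>] A by (simp add: comp_def)
  also have "\<dots> \<longleftrightarrow> sat E (map snd ps) \<phi>"
    using PQ(2)[of \<phi>] A by (simp add: comp_def)
  finally show "sat C (map fst ps) \<phi> \<longleftrightarrow> sat E (map snd ps) \<phi>" .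
qed

text \<open>Equality is itself a formula. Together with \<open>elem_converse\<close> this makes an
  elementary relation the graph of an injective partial map.\<close>

lemma elem_unique:
  assumes "elem \<tau> C D P" "(x, y) \<in> P" "(x, y') \<in> P" shows "y = y'"
  using elem_sat[OF assms(1), of "[(x,y),(x,y')]" "Eq 0 1"] assms(2,3) by simp

lemma elem_empty:
  "elem \<tau> C D {} \<longleftrightarrow> (\<forall>\<phi>. fm_in \<tau> 0 \<phi> \<longrightarrow> (sat C [] \<phi> \<longleftrightarrow> sat D [] \<phi>))"
  by (auto simp: elem_def)

lemma elem_Id_on: "X \<subseteq> univ C \<Longrightarrow> elem \<tau> C C (Id_on X)"
proof -
  assume X: "X \<subseteq> univ C"
  have "map fst ps = map snd ps" if "set ps \<subseteq> Id_on X" for ps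
    using that by auto
  then have "sat C (map fst ps) \<phi> \<longleftrightarrow> sat C (map snd ps) \<phi>" if "set ps \<subseteq> Id_on X" for ps \<phi>
    by (simp only: that)
  then show ?thesis using X by (auto simp: elem_def)
qed

text \<open>A list of pairs from \<open>ps\<close>, with repetitions and in any order, arises from
  \<open>ps\<close> by a substitution of variables; so a single enumeration tests the whole
  relation.\<close>

lemma elem_of_listing:
  assumes "set ps \<subseteq> univ C \<times> univ D"
    and sat: "\<And>\<phi>. fm_in \<tau> (length ps) \<phi> \<Longrightarrow> sat C (map fst ps) \<phi> \<longleftrightarrow> sat D (map snd ps) \<phi>"
  shows "elem \<tau> C D (set ps)"
  unfolding elem_def
proof (intro conjI allI impI assms(1))
  fix qs \<phi> assume A: "set qs \<subseteq> set ps \<and> fm_in \<tau> (length qs) \<phi>"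
  then have "\<forall>q\<in>set qs. \<exists>i<length ps. ps ! i = q" by (auto simp: in_set_conv_nth subset_iff)
  then obtain f where f: "\<And>q. q \<in> set qs \<Longrightarrow> f q < length ps \<and> ps ! f q = q" by metis
  define g where "g = (\<lambda>i. f (qs ! i))"
  have g: "g i < length ps" "ps ! g i = qs ! i" if "i < length qs" for i
    using f that by (auto simp: g_def)
  have "sat C (map fst ps) (ren g \<phi>) \<longleftrightarrow> sat D (map snd ps) (ren g \<phi>)"
    using A g by (intro sat fm_in_ren[of \<tau> "length qs"]) auto
  moreover have "sat C (map fst ps) (ren g \<phi>) \<longleftrightarrow> sat C (map fst qs) \<phi>"
    using A g by (intro sat_ren[of \<tau> "length qs"]) auto
  moreover have "sat D (map snd ps) (ren g \<phi>) \<longleftrightarrow> sat D (map snd qs) \<phi>"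
    using A g by (intro sat_ren[of \<tau> "length qs"]) auto
  ultimately show "sat C (map fst qs) \<phi> \<longleftrightarrow> sat D (map snd qs) \<phi>" by blast
qed

section \<open>Types of tuples and omega-saturation\<close>

lemma in_lists_zip:
  "length x = length y \<Longrightarrow> set (zip x y) \<subseteq> A \<times> B \<longleftrightarrow> set x \<subseteq> A \<and> set y \<subseteq> B"
  by (induction x y rule: list_induct2) auto

text \<open>The formula \<open>x_i = x_i\<close> is well-formed for a tuple exactly when
  \<open>i\<close> is below its length.\<close>

lemma tp_eq_length:
  assumes "tp \<tau> C c A = tp \<tau> C c' A" shows "length c = length c'"
proof -
  have *: "(Eq i i, []) \<in> tp \<tau> C c A \<longleftrightarrow> i < length c" for i c
    by (auto simp: tp_def pfm_in_def psat_def)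
  have "i < length c \<longleftrightarrow> i < length c'" for i using * assms by metis
  then show ?thesis by (metis linorder_neqE_nat less_irrefl)
qed

text \<open>Left to right, a formula sees only finitely many parameters, and these are appended to
  both tuples.\<close>

lemma tp_eq_iff:
  assumes len: "length c = length c'" and c: "set c \<subseteq> univ C" and c': "set c' \<subseteq> univ C"
    and A: "A \<subseteq> univ C"
  shows "tp \<tau> C c A = tp \<tau> C c' A \<longleftrightarrow> elem \<tau> C C (set (zip c c') \<union> Id_on A)"
proof
  assume tp: "tp \<tau> C c A = tp \<tau> C c' A"
  show "elem \<tau> C C (set (zip c c') \<union> Id_on A)"
  proof (rule elem_finitary)
    fix P' assume P': "finite P'" "P' \<subseteq> set (zip c c') \<union> Id_on A"
    define B where "B = {a. (a, a) \<in> P' \<and> a \<in> A}"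
    have "finite ((\<lambda>a. (a, a)) ` B)" by (rule finite_subset[OF _ P'(1)]) (auto simp: B_def)
    then have "finite B" by (rule finite_imageD) (auto simp: inj_on_def)
    then obtain d where d: "set d = B" using finite_list by blast
    have dA: "set d \<subseteq> A" using d by (auto simp: B_def)
    have "elem \<tau> C C (set (zip (c @ d) (c' @ d)))"
    proof (rule elem_of_listing)
      show "set (zip (c @ d) (c' @ d)) \<subseteq> univ C \<times> univ C"
        using len c c' A dA by (subst in_lists_zip) auto
    next
      fix \<phi> assume "fm_in \<tau> (length (zip (c @ d) (c' @ d))) \<phi>"
      then have \<phi>: "fm_in \<tau> (length c + length d) \<phi>" using len by simp
      have "(\<phi>, d) \<in> tp \<tau> C c A \<longleftrightarrow> sat C (c @ d) \<phi>"
        using \<phi> dA by (simp add: tp_def pfm_in_def psat_def)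
      moreover have "(\<phi>, d) \<in> tp \<tau> C c' A \<longleftrightarrow> sat C (c' @ d) \<phi>"
        using \<phi> dA len by (simp add: tp_def pfm_in_def psat_def)
      ultimately show "sat C (map fst (zip (c @ d) (c' @ d))) \<phi> =
        sat C (map snd (zip (c @ d) (c' @ d))) \<phi>"
        using tp len by simp
    qed
    moreover have "P' \<subseteq> set (zip (c @ d) (c' @ d))"
      using P'(2) d len by (auto simp: B_def zip_same)
    ultimately show "elem \<tau> C C P'" by (rule elem_mono)
  qed
next
  assume E: "elem \<tau> C C (set (zip c c') \<union> Id_on A)"
  have "psat C c (\<phi>, d) \<longleftrightarrow> psat C c' (\<phi>, d)"
    if "pfm_in \<tau> A (length c) (\<phi>, d)" for \<phi> d
  proof -
    have "sat C (c @ d) \<phi> \<longleftrightarrow> sat C (c' @ d) \<phi>"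
      by (rule elem_sat_zip[OF E]) (use that len in \<open>auto simp: pfm_in_def zip_same\<close>)
    then show ?thesis by (simp add: psat_def)
  qed
  then show "tp \<tau> C c A = tp \<tau> C c' A"
    using len by (auto simp: tp_def)
qed

text \<open>This is omega-saturation. It mentions no cardinal, so it is shared by monster models for
  different \<open>\<kappa>\<close>, and it descends to the parts of a sum.\<close>

definition fsat :: "'s vocab \<Rightarrow> ('s, 'a) struc \<Rightarrow> bool" where
  "fsat \<tau> C \<longleftrightarrow> (\<forall>m p. is_type \<tau> C m p \<and> finite (Dom p) \<longrightarrow> realizations C m p \<noteq> {})"

text \<open>The forth step: the type of \<open>x\<close> over the domain of \<open>P\<close>, read
  with parameters in the range, is finitely satisfiable because \<open>P\<close> preserves
  existential formulas, and \<open>fsat\<close> realizes it.\<close>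

lemma elem_extend1:
  assumes E: "elem \<tau> C D P" and fin: "finite P" and D: "fsat \<tau> D" and x: "x \<in> univ C"
  obtains y where "elem \<tau> C D (insert (x, y) P)"
proof -
  obtain ps where ps: "set ps = P" using finite_list[OF fin] by blast
  define d where "d = map snd ps"
  define p where "p = {(\<phi>, d) | \<phi>. fm_in \<tau> (Suc (length ps)) \<phi> \<and> sat C (x # map fst ps) \<phi>}"
  have psU: "set ps \<subseteq> univ C \<times> univ D" using E ps by (simp add: elem_def)
  have dU: "set d \<subseteq> univ D" using psU by (auto simp: d_def)
  have "is_type \<tau> D 1 p"
    unfolding is_type_def
  proof (intro conjI allI impI ballI)
    fix f assume "f \<in> p"
    then show "pfm_in \<tau> (univ D) 1 f" using dU by (auto simp: p_def pfm_in_def d_def)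
  next
    fix q assume q: "finite q \<and> q \<subseteq> p"
    then obtain \<phi>s where \<phi>s: "set \<phi>s = fst ` q" using finite_list[of "fst ` q"] by auto
    have \<phi>sp: "fm_in \<tau> (Suc (length ps)) \<phi> \<and> sat C (x # map fst ps) \<phi>" if "\<phi> \<in> set \<phi>s" for \<phi>
      using that q unfolding \<phi>s p_def by auto
    have "sat C (map fst ps) (Ex (conjs \<phi>s))" using \<phi>sp x by auto
    then have "sat D (map snd ps) (Ex (conjs \<phi>s))"
      using elem_sat[OF E, of ps "Ex (conjs \<phi>s)"] \<phi>sp ps by auto
    then obtain y where y: "y \<in> univ D" "\<forall>\<phi>\<in>fst ` q. sat D (y # d) \<phi>" using \<phi>s by (auto simp: d_def)
    have "[y] \<in> realizations D 1 q"
      using y q by (auto simp: realizations_def tuples_def psat_def p_def subset_iff)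
    then show "realizations D 1 q \<noteq> {}" by blast
  qed
  moreover have "finite (Dom p)" by (rule finite_subset[of _ "set d"]) (auto simp: Dom_def p_def)
  ultimately obtain c where "c \<in> realizations D 1 p" using D by (auto simp: fsat_def)
  then obtain y where y: "y \<in> univ D" and sy: "\<And>f. f \<in> p \<Longrightarrow> psat D [y] f"
    by (auto simp: realizations_def tuples_def length_Suc_conv)
  have "elem \<tau> C D (set ((x, y) # ps))"
  proof (rule elem_of_listing)
    show "set ((x, y) # ps) \<subseteq> univ C \<times> univ D" using x y psU by auto
  next
    fix \<phi> assume \<phi>: "fm_in \<tau> (length ((x, y) # ps)) \<phi>"
    have "sat D (y # d) \<psi>" if "sat C (x # map fst ps) \<psi>" "fm_in \<tau> (Suc (length ps)) \<psi>" for \<psi>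
      using sy[of "(\<psi>, d)"] that by (auto simp: p_def psat_def)
    \<comment> \<open>The type \<open>p\<close> is complete, so one implication for both
      \<open>\<phi>\<close> and its negation gives the equivalence.\<close>
    from this[of \<phi>] this[of "Neg \<phi>"] \<phi>
    show "sat C (map fst ((x, y) # ps)) \<phi> \<longleftrightarrow> sat D (map snd ((x, y) # ps)) \<phi>"
      by (auto simp: d_def)
  qed
  then show thesis using that ps by simp
qed

abbreviation graph :: "('a \<Rightarrow> 'b) \<Rightarrow> 'a set \<Rightarrow> ('a \<times> 'b) set" where
  "graph g X \<equiv> (\<lambda>x. (x, g x)) ` X"

text \<open>Iterates the forth step along an enumeration of \<open>X\<close>. Each intermediate
  relation is finite, so types over finite sets suffice, and the union is elementary because
  formulas are finitary.\<close>

lemma elem_extend_countable: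
  assumes E: "elem \<tau> C D P" and fin: "finite P" and D: "fsat \<tau> D"
    and X: "countable X" "X \<subseteq> univ C"
  obtains g where "elem \<tau> C D (P \<union> graph g X)"
proof (cases "X = {}")
  case True
  then show thesis using that E by simp
next
  case False
  define x where "x = from_nat_into X"
  have x: "range x = X" using X False by (simp add: x_def range_from_nat_into)
  have "\<exists>Q. \<forall>k. (finite (Q k) \<and> elem \<tau> C D (Q k) \<and> P \<subseteq> Q k) \<and>
      (Q k \<subseteq> Q (Suc k) \<and> x k \<in> Domain (Q (Suc k)))"
  proof (rule dependent_nat_choice)
    show "\<exists>Q. finite Q \<and> elem \<tau> C D Q \<and> P \<subseteq> Q" using E fin by blast
  next
    fix Q k assume Q: "finite Q \<and> elem \<tau> C D Q \<and> P \<subseteq> Q"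
    have "x k \<in> univ C" using x X by auto
    with Q D obtain y where "elem \<tau> C D (insert (x k, y) Q)" by (auto elim: elem_extend1)
    with Q show "\<exists>R. (finite R \<and> elem \<tau> C D R \<and> P \<subseteq> R) \<and> (Q \<subseteq> R \<and> x k \<in> Domain R)"
      by (intro exI[of _ "insert (x k, y) Q"]) auto
  qed
  then obtain Q where Q: "\<And>k. finite (Q k)" "\<And>k. elem \<tau> C D (Q k)" "\<And>k. P \<subseteq> Q k"
    "\<And>k. Q k \<subseteq> Q (Suc k)" "\<And>k. x k \<in> Domain (Q (Suc k))" by blast
  have inc: "i \<le> j \<Longrightarrow> Q i \<subseteq> Q j" for i j using lift_Suc_mono_le[of Q] Q(4) by blast
  have U: "elem \<tau> C D (\<Union>k. Q k)"
  proof (rule elem_finitary)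
    fix P' assume P': "finite P'" "P' \<subseteq> (\<Union>k. Q k)"
    have "\<exists>k. P' \<subseteq> Q k" using P'
    proof (induction rule: finite_induct)
      case (insert p P')
      then obtain i j where "P' \<subseteq> Q i" "p \<in> Q j" by auto
      then have "insert p P' \<subseteq> Q (max i j)"
        using inc[of i "max i j"] inc[of j "max i j"] by auto
      then show ?case by blast
    qed auto
    then show "elem \<tau> C D P'" using Q(2) elem_mono by blast
  qed
  have "\<forall>a\<in>X. \<exists>b. (a, b) \<in> (\<Union>k. Q k)" using Q(5) x by blast
  then obtain g where "\<And>a. a \<in> X \<Longrightarrow> (a, g a) \<in> (\<Union>k. Q k)" by metis
  then have "P \<union> graph g X \<subseteq> (\<Union>k. Q k)" using Q(3) by blast
  with U that show thesis by (meson elem_mono)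
qed

lemma tuplesD: "c \<in> tuples C m \<Longrightarrow> set c \<subseteq> univ C \<and> length c = m"
  by (auto simp: tuples_def)

lemma tuplesI: "set c \<subseteq> univ C \<Longrightarrow> length c = m \<Longrightarrow> c \<in> tuples C m"
  by (auto simp: tuples_def)

lemma pfm_in_mono: "pfm_in \<tau> A m f \<Longrightarrow> A \<subseteq> B \<Longrightarrow> pfm_in \<tau> B m f"
  by (auto simp: pfm_in_def split: prod.splits)

text \<open>Compactness inside one structure: \<open>f\<close> with the negations of
  \<open>\<Phi>\<close> is unrealized, hence, all parameters lying in the finite set
  \<open>B\<close>, not finitely satisfiable. The members of \<open>\<Phi>\<close> negated in an
  inconsistent finite part form the subcover.\<close>

lemma finite_subcover:
  assumes C: "fsat \<tau> C" and B: "finite B" "B \<subseteq> univ C"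
    and f: "pfm_in \<tau> B m f" and \<Phi>: "\<And>g. g \<in> \<Phi> \<Longrightarrow> pfm_in \<tau> B m g"
    and cover: "\<And>c. c \<in> tuples C m \<Longrightarrow> psat C c f \<Longrightarrow> \<exists>g\<in>\<Phi>. psat C c g"
  obtains F where "finite F" "F \<subseteq> \<Phi>"
    "\<And>c. c \<in> tuples C m \<Longrightarrow> psat C c f \<Longrightarrow> \<exists>g\<in>F. psat C c g"
proof -
  define neg :: "('a, 'b) pfm \<Rightarrow> ('a, 'b) pfm" where "neg = (\<lambda>(\<phi>, d). (Neg \<phi>, d))"
  have neg: "psat C c (neg g) \<longleftrightarrow> \<not> psat C c g" for c g
    by (cases g) (simp add: neg_def psat_def)
  define p where "p = insert f (neg ` \<Phi>)"
  have pB: "pfm_in \<tau> B m g" if "g \<in> p" for g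
  proof -
    have "pfm_in \<tau> B m (neg h) \<longleftrightarrow> pfm_in \<tau> B m h" for h
      by (cases h) (simp add: neg_def pfm_in_def)
    then show ?thesis using that f \<Phi> by (auto simp: p_def)
  qed
  have "realizations C m p = {}"
  proof -
    have False if "c \<in> realizations C m p" for c
    proof -
      have "c \<in> tuples C m" "psat C c f" "\<And>g. g \<in> \<Phi> \<Longrightarrow> psat C c (neg g)"
        using that by (auto simp: realizations_def p_def)
      with cover neg show False by blast
    qed
    then show ?thesis by blast
  qed
  moreover have "finite (Dom p)"
  proof (rule finite_subset[OF _ B(1)])
    show "Dom p \<subseteq> B"
    proof
      fix x assume "x \<in> Dom p"
      then obtain g where "g \<in> p" "x \<in> set (snd g)" by (auto simp: Dom_def)
      with pB[of g] show "x \<in> B" by (auto simp: pfm_in_def split: prod.splits)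
    qed
  qed
  ultimately have "\<not> is_type \<tau> C m p" using C by (auto simp: fsat_def)
  then obtain q where q: "finite q" "q \<subseteq> p" "realizations C m q = {}"
    using pfm_in_mono[OF pB B(2)] unfolding is_type_def by blast
  define F where "F = {g \<in> \<Phi>. neg g \<in> q}"
  have "inj neg" by (auto simp: neg_def inj_def)
  moreover have "finite (neg ` F)" by (rule finite_subset[OF _ q(1)]) (auto simp: F_def)
  ultimately have "finite F" by (meson finite_imageD inj_on_subset subset_UNIV)
  moreover have "\<exists>g\<in>F. psat C c g" if "c \<in> tuples C m" "psat C c f" for c
  proof (rule ccontr)
    assume "\<not> (\<exists>g\<in>F. psat C c g)"
    then have "c \<in> realizations C m q"
      using that q(2) neg unfolding realizations_def p_def F_def by blast
    then show False using q(3) by blast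
  qed
  ultimately show thesis using that[of F] by (auto simp: F_def)
qed

section \<open>Indiscernible families\<close>

abbreviation index_map :: "('i \<Rightarrow> 'j) \<Rightarrow> 'i + 'i list \<Rightarrow> 'j + 'j list" where
  "index_map f \<equiv> map_sum f (map f)"

definition index_set :: "nat \<Rightarrow> 'i set \<Rightarrow> 'i rel \<Rightarrow> ('i + 'i list) set" where
  "index_set n I r = Inl ` I \<union> Inr ` {ts \<in> incr I r. length ts < n}"

definition seq_length :: "'i + 'i list \<Rightarrow> nat option" where
  "seq_length u = (case u of Inl _ \<Rightarrow> None | Inr ts \<Rightarrow> Some (length ts))"

definition idx_less :: "'i rel \<Rightarrow> 'i + 'i list \<Rightarrow> 'i + 'i list \<Rightarrow> bool" where
  "idx_less r u u' = (case (u, u') of (Inl s, Inl t) \<Rightarrow> lt r s t | _ \<Rightarrow> False)"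

definition entries :: "'i + 'i list \<Rightarrow> 'i + 'i list \<Rightarrow> nat set" where
  "entries u u' = (case (u, u') of (Inr ts, Inl t) \<Rightarrow> {k. k < length ts \<and> ts ! k = t} | _ \<Rightarrow> {})"

text \<open>The quantifier-free type of a pair of indices.  A sequence is related to an element only by
  having it as its \<open>k\<close>-th entry, so the order between an element and the other entries does not
  show.\<close>

definition pattern where
  "pattern r u u' = (u = u', seq_length u, idx_less r u u', entries u u')"

definition same_qftp :: "'i rel \<Rightarrow> 'j rel \<Rightarrow> (('i + 'i list) \<times> ('j + 'j list)) set \<Rightarrow> bool" where
  "same_qftp r r' Z \<longleftrightarrow> (\<forall>(u, v)\<in>Z. \<forall>(u', v')\<in>Z. pattern r u u' = pattern r' v v')"

lemma same_qftpD: "same_qftp r r' Z \<Longrightarrow> (u, v) \<in> Z \<Longrightarrow> (u', v') \<in> Z \<Longrightarrow> pattern r u u' = pattern r' v v'"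
  by (auto simp: same_qftp_def)

lemma same_qftpI:
  "(\<And>u v u' v'. (u, v) \<in> Z \<Longrightarrow> (u', v') \<in> Z \<Longrightarrow> pattern r u u' = pattern r' v v') \<Longrightarrow> same_qftp r r' Z"
  by (auto simp: same_qftp_def)

lemma same_qftp_mono: "same_qftp r r' Z \<Longrightarrow> Z' \<subseteq> Z \<Longrightarrow> same_qftp r r' Z'"
  unfolding same_qftp_def by blast

lemma same_qftp_converse: "same_qftp r r' Z \<Longrightarrow> same_qftp r' r (Z\<inverse>)"
  by (rule same_qftpI) (metis converseD same_qftpD)

lemma same_qftp_comp: "same_qftp r r' Z \<Longrightarrow> same_qftp r' r'' Z' \<Longrightarrow> same_qftp r r'' (Z O Z')"
  by (rule same_qftpI, elim relcompEpair) (metis same_qftpD)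

lemma same_qftp_seq_length: "same_qftp r r' Z \<Longrightarrow> (u, v) \<in> Z \<Longrightarrow> seq_length u = seq_length v"
  by (drule (2) same_qftpD) (simp add: pattern_def)

lemma univ_idx_struc [simp]: "univ (idx_struc n I r) = index_set n I r"
  by (simp add: idx_struc_def index_set_def Let_def)

lemma rel_idx_struc:
  assumes "u \<in> index_set n I r" "u' \<in> index_set n I r"
  shows "[u, u'] \<in> rel (idx_struc n I r) LessS \<longleftrightarrow> idx_less r u u'"
    and "[u] \<in> rel (idx_struc n I r) (LenS k) \<longleftrightarrow> seq_length u = Some k"
    and "[u, u'] \<in> rel (idx_struc n I r) (EntryS k) \<longleftrightarrow> k \<in> entries u u'"
  using assms
  by (auto simp: idx_struc_def index_set_def Let_def idx_less_def seq_length_def entries_def)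

text \<open>Every atomic formula of the index vocabulary has at most two variables, so the
  quantifier-free type of a list is determined by the patterns of pairs of its entries.\<close>

lemma qftp_eq_iff:
  assumes "us \<in> lists (index_set n I r)" "vs \<in> lists (index_set n I r)" "length us = length vs"
  shows "qftp idx_vocab (idx_struc n I r) us = qftp idx_vocab (idx_struc n I r) vs \<longleftrightarrow>
         same_qftp r r (set (zip us vs))" (is "?l \<longleftrightarrow> ?r")
proof (intro iffI)
  have us: "us ! i \<in> index_set n I r" "vs ! i \<in> index_set n I r" if "i < length us" for i
    using assms that nth_mem by (auto simp: in_lists_conv_set) 
  let ?M = "idx_struc n I r"
  show ?r if l: ?l
  proof -
    have sat: "sat ?M us \<phi> \<longleftrightarrow> sat ?M vs \<phi>" if "qfree \<phi>" "fm_in idx_vocab (length us) \<phi>" for \<phi>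
      using l that assms(3) by (auto simp: qftp_def set_eq_iff)
    show ?thesis
    proof (rule same_qftpI)
      fix u v u' v' assume "(u, v) \<in> set (zip us vs)" "(u', v') \<in> set (zip us vs)"
      then obtain i j where ij: "i < length us" "j < length us" "u = us ! i" "v = vs ! i"
        "u' = us ! j" "v' = vs ! j" by (auto simp: in_set_zip)
      have "seq_length u = Some k \<longleftrightarrow> seq_length v = Some k" for k
        using sat[of "Rel (LenS k) [i]"] ij rel_idx_struc(2)[OF us(1)[OF ij(1)] us(1)[OF ij(1)]]
          rel_idx_struc(2)[OF us(2)[OF ij(1)] us(2)[OF ij(1)]] by (simp add: idx_vocab_def)
      then have "seq_length u = seq_length v" by (metis not_None_eq)
      moreover have "k \<in> entries u u' \<longleftrightarrow> k \<in> entries v v'" for k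
        using sat[of "Rel (EntryS k) [i, j]"] ij rel_idx_struc(3)[OF us(1)[OF ij(1)] us(1)[OF ij(2)]]
          rel_idx_struc(3)[OF us(2)[OF ij(1)] us(2)[OF ij(2)]] by (simp add: idx_vocab_def)
      moreover have "idx_less r u u' \<longleftrightarrow> idx_less r v v'"
        using sat[of "Rel LessS [i, j]"] ij rel_idx_struc(1)[OF us(1)[OF ij(1)] us(1)[OF ij(2)]]
          rel_idx_struc(1)[OF us(2)[OF ij(1)] us(2)[OF ij(2)]] by (simp add: idx_vocab_def)
      moreover have "u = u' \<longleftrightarrow> v = v'"
        using sat[of "Eq i j"] ij by simp
      ultimately show "pattern r u u' = pattern r v v'" by (auto simp: pattern_def)
    qed
  qed
  show ?l if r: ?r
  proof -
    have p: "pattern r (us ! i) (us ! j) = pattern r (vs ! i) (vs ! j)"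
      if "i < length us" "j < length us" for i j
      using same_qftpD[OF r, of "us ! i" "vs ! i" "us ! j" "vs ! j"] that assms(3)
      by (auto simp: in_set_zip)
    have "sat ?M us \<phi> \<longleftrightarrow> sat ?M vs \<phi>" if "qfree \<phi>" "fm_in idx_vocab (length us) \<phi>" for \<phi>
      using that
    proof (induction \<phi>)
      case (Eq i j)
      then show ?case using p[of i j] by (simp add: pattern_def)
    next
      case (Rel S "is")
      show ?case
      proof (cases S)
        case LessS
        with Rel obtain i j where "is = [i, j]" "i < length us" "j < length us"
          by (auto simp: idx_vocab_def length_Suc_conv numeral_2_eq_2)
        with LessS p[of i j] rel_idx_struc(1)[OF us(1)[of i] us(1)[of j]]
          rel_idx_struc(1)[OF us(2)[of i] us(2)[of j]]
        show ?thesis by (simp add: pattern_def)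
      next
        case (LenS k)
        with Rel obtain i where "is = [i]" "i < length us"
          by (auto simp: idx_vocab_def length_Suc_conv)
        with LenS p[of i i] rel_idx_struc(2)[OF us(1)[of i] us(1)[of i]] rel_idx_struc(2)[OF us(2)[of i] us(2)[of i]]
        show ?thesis by (simp add: pattern_def)
      next
        case (EntryS k)
        with Rel obtain i j where "is = [i, j]" "i < length us" "j < length us"
          by (auto simp: idx_vocab_def length_Suc_conv numeral_2_eq_2)
        with EntryS p[of i j] rel_idx_struc(3)[OF us(1)[of i] us(1)[of j]]
          rel_idx_struc(3)[OF us(2)[of i] us(2)[of j]]
        show ?thesis by (simp add: pattern_def)
      qed
    qed auto
    then show ?thesis using assms(3) by (auto simp: qftp_def)
  qed
qed

text \<open>The element correspondence induced by an index correspondence: \<open>elem\<close> of it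
  says that the two families have the same type along \<open>Z\<close>.\<close>

definition pairs :: "('u \<Rightarrow> 'a list) \<Rightarrow> ('v \<Rightarrow> 'b list) \<Rightarrow> ('u \<times> 'v) set \<Rightarrow> ('a \<times> 'b) set" where
  "pairs a b Z = (\<Union>(u, v)\<in>Z. set (zip (a u) (b v)))"

lemma pairsI: "(u, v) \<in> Z \<Longrightarrow> (x, y) \<in> set (zip (a u) (b v)) \<Longrightarrow> (x, y) \<in> pairs a b Z"
  by (auto simp: pairs_def)

lemma pairs_mono: "Z \<subseteq> Z' \<Longrightarrow> pairs a b Z \<subseteq> pairs a b Z'"
  by (auto simp: pairs_def)

lemma set_zip_concat:
  assumes "length us = length vs" "\<forall>(u, v)\<in>set (zip us vs). length (a u) = length (b v)"
  shows "set (zip (concat (map a us)) (concat (map b vs))) = pairs a b (set (zip us vs)) \<and>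
    length (concat (map a us)) = length (concat (map b vs))"
  using assms
proof (induction us vs rule: list_induct2)
  case (Cons u us v vs)
  then have "length (a u) = length (b v)" by simp
  with Cons show ?case by (simp add: pairs_def)
qed (simp add: pairs_def)

text \<open>Since \<open>zip\<close> truncates, the middle tuple must be long enough to supply an
  intermediate element at each position.\<close>

lemma pairs_comp:
  assumes "\<And>u w v. (u, w) \<in> Z \<Longrightarrow> (w, v) \<in> Z' \<Longrightarrow> length (a u) = length (b w)"
  shows "pairs a c (Z O Z') \<subseteq> pairs a b Z O pairs b c Z'"
proof
  fix p assume "p \<in> pairs a c (Z O Z')"
  then obtain u w v where *: "(u, w) \<in> Z" "(w, v) \<in> Z'" "p \<in> set (zip (a u) (c v))"
    by (auto simp: pairs_def)
  then obtain i where "i < length (a u)" "i < length (c v)" "p = (a u ! i, c v ! i)"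
    by (auto simp: in_set_zip)
  moreover have "(a u ! i, b w ! i) \<in> set (zip (a u) (b w))" "(b w ! i, c v ! i) \<in> set (zip (b w) (c v))"
    using calculation assms[OF *(1,2)] by (auto simp: in_set_zip)
  ultimately show "p \<in> pairs a b Z O pairs b c Z'" using * by (auto simp: pairs_def)
qed

lemma pairs_converse:
  fixes a :: "'u \<Rightarrow> 'a list" and b :: "'v \<Rightarrow> 'b list"
  shows "pairs b a (Z\<inverse>) = (pairs a b Z)\<inverse>"
proof -
  have "set (zip y x) = (set (zip x y))\<inverse>" for x :: "'a list" and y :: "'b list"
    by (auto simp: in_set_zip)
  then show ?thesis by (auto simp: pairs_def)
qed

text \<open>Indiscernibility with arbitrary, possibly infinite, relations in place of pairs of
  lists; in this form it works together with composition and inversion of index correspondences.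
  Equal lengths are demanded separately because \<open>pairs\<close> ignores the surplus of a longer
  tuple.\<close>

definition indisc ::
    "'s vocab \<Rightarrow> ('s, 'a) struc \<Rightarrow> 'a set \<Rightarrow> nat \<Rightarrow> 'i set \<Rightarrow> 'i rel \<Rightarrow> ('i + 'i list \<Rightarrow> 'a list) \<Rightarrow> bool" where
  "indisc \<tau> C A n I r a \<longleftrightarrow> (\<forall>u\<in>index_set n I r. set (a u) \<subseteq> univ C) \<and>
     (\<forall>Z\<subseteq>index_set n I r \<times> index_set n I r. same_qftp r r Z \<longrightarrow>
        elem \<tau> C C (Id_on A \<union> pairs a a Z) \<and> (\<forall>(u, v)\<in>Z. length (a u) = length (a v)))"

lemma indisc_elem:
  "indisc \<tau> C A n I r a \<Longrightarrow> Z \<subseteq> index_set n I r \<times> index_set n I r \<Longrightarrow> same_qftp r r Z \<Longrightarrow>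
    elem \<tau> C C (Id_on A \<union> pairs a a Z)"
  by (auto simp: indisc_def)

lemma indisc_length:
  "indisc \<tau> C A n I r a \<Longrightarrow> u \<in> index_set n I r \<Longrightarrow> v \<in> index_set n I r \<Longrightarrow>
    same_qftp r r {(u, v)} \<Longrightarrow> length (a u) = length (a v)"
  unfolding indisc_def by (elim conjE allE[of _ "{(u, v)}"]) auto

lemma indisc_univ: "indisc \<tau> C A n I r a \<Longrightarrow> u \<in> index_set n I r \<Longrightarrow> set (a u) \<subseteq> univ C"
  by (auto simp: indisc_def)

lemma elem_Id_on_pairs_finitary:
  assumes A: "A \<subseteq> univ C"
    and fin: "\<And>us vs. length us = length vs \<Longrightarrow> set (zip us vs) \<subseteq> Z \<Longrightarrow>
      elem \<tau> C C (Id_on A \<union> pairs a a (set (zip us vs)))"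
  shows "elem \<tau> C C (Id_on A \<union> pairs a a Z)"
proof (rule elem_finitary)
  fix P' assume P': "finite P'" "P' \<subseteq> Id_on A \<union> pairs a a Z"
  then have "\<exists>Z0. finite Z0 \<and> Z0 \<subseteq> Z \<and> P' \<subseteq> Id_on A \<union> pairs a a Z0"
  proof (induction rule: finite_induct)
    case (insert p P')
    then obtain Z0 where Z0: "finite Z0" "Z0 \<subseteq> Z" "P' \<subseteq> Id_on A \<union> pairs a a Z0" by auto
    show ?case
    proof (cases "p \<in> Id_on A")
      case True
      with Z0 show ?thesis by (intro exI[of _ Z0]) auto
    next
      case False
      with insert.prems obtain z where "z \<in> Z" "p \<in> pairs a a {z}" by (auto simp: pairs_def)
      with Z0 show ?thesis by (intro exI[of _ "insert z Z0"]) (auto simp: pairs_def)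
    qed
  qed auto
  then obtain zs where zs: "set zs \<subseteq> Z" "P' \<subseteq> Id_on A \<union> pairs a a (set zs)"
    using finite_list by metis
  have "elem \<tau> C C (Id_on A \<union> pairs a a (set (zip (map fst zs) (map snd zs))))"
    by (rule fin) (use zs in \<open>simp_all add: zip_map_fst_snd\<close>)
  with zs(2) show "elem \<tau> C C P'" by (metis elem_mono zip_map_fst_snd)
qed

text \<open>By \<open>qftp_eq_iff\<close> two lists with equal quantifier-free type form a relation
  with \<open>same_qftp\<close>, and an infinite relation reduces to finite lists. Equal types force
  equal lengths, which yields the clause on lengths.\<close>

lemma indisc_family_iff:
  assumes A: "A \<subseteq> univ C"
  shows "indisc_family \<tau> C A n I r a \<longleftrightarrow> indisc \<tau> C A n I r a"
proof
  let ?J = "index_set n I r"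
  assume L: "indisc_family \<tau> C A n I r a"
  then have aU: "set (a u) \<subseteq> univ C" if "u \<in> ?J" for u
  proof -
    from L have "\<forall>u\<in>?J. a u \<in> lists (univ C)"
      unfolding indisc_family_def Let_def univ_idx_struc by (elim conjE)
    with that show ?thesis by auto
  qed
  have tp: "tp \<tau> C (concat (map a us)) A = tp \<tau> C (concat (map a vs)) A"
    if "us \<in> lists ?J" "vs \<in> lists ?J" "length us = length vs" "same_qftp r r (set (zip us vs))" for us vs
  proof -
    from L have "\<forall>us\<in>lists ?J. \<forall>vs\<in>lists ?J. length us = length vs \<and>
        qftp idx_vocab (idx_struc n I r) us = qftp idx_vocab (idx_struc n I r) vs \<longrightarrow>
        tp \<tau> C (concat (map a us)) A = tp \<tau> C (concat (map a vs)) A"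
      unfolding indisc_family_def Let_def univ_idx_struc by (elim conjE)
    with that qftp_eq_iff[OF that(1-3)] show ?thesis by blast
  qed
  have len: "length (a u) = length (a v)" if "u \<in> ?J" "v \<in> ?J" "same_qftp r r {(u, v)}" for u v
    using tp_eq_length[OF tp[of "[u]" "[v]"]] that by simp
  show "indisc \<tau> C A n I r a"
    unfolding indisc_def
  proof (intro conjI ballI allI impI)
    fix Z assume Z: "Z \<subseteq> ?J \<times> ?J" "same_qftp r r Z"
    have lenZ: "length (a u) = length (a v)" if "(u, v) \<in> Z" for u v
      by (rule len) (use Z(1) that same_qftp_mono[OF Z(2), of "{(u, v)}"] in auto)
    then show "\<And>z. z \<in> Z \<Longrightarrow> case z of (u, v) \<Rightarrow> length (a u) = length (a v)" by auto
    show "elem \<tau> C C (Id_on A \<union> pairs a a Z)"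
    proof (rule elem_Id_on_pairs_finitary[OF A])
      fix us vs assume uv: "length us = length vs" "set (zip us vs) \<subseteq> Z"
      have "set us \<subseteq> ?J \<and> set vs \<subseteq> ?J"
        using in_lists_zip[OF uv(1), of ?J ?J] order_trans[OF uv(2) Z(1)] by blast
      then have l: "us \<in> lists ?J" "vs \<in> lists ?J" by auto
      have z: "set (zip (concat (map a us)) (concat (map a vs))) = pairs a a (set (zip us vs)) \<and>
        length (concat (map a us)) = length (concat (map a vs))"
        by (rule set_zip_concat[OF uv(1)]) (use uv lenZ in auto)
      have U: "set (concat (map a us)) \<subseteq> univ C" "set (concat (map a vs)) \<subseteq> univ C"
        using l aU by fastforce+
      show "elem \<tau> C C (Id_on A \<union> pairs a a (set (zip us vs)))"
        using tp[OF l uv(1) same_qftp_mono[OF Z(2) uv(2)]] z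
        unfolding tp_eq_iff[OF conjunct2[OF z] U A] by (simp only: Un_commute)
    qed
  qed (use aU in blast)
next
  let ?J = "index_set n I r"
  assume R: "indisc \<tau> C A n I r a"
  show "indisc_family \<tau> C A n I r a"
    unfolding indisc_family_def Let_def univ_idx_struc
  proof (intro conjI ballI impI)
    fix us vs assume us: "us \<in> lists ?J" and vs: "vs \<in> lists ?J" and
      q: "length us = length vs \<and> qftp idx_vocab (idx_struc n I r) us = qftp idx_vocab (idx_struc n I r) vs"
    then have s: "same_qftp r r (set (zip us vs))" using qftp_eq_iff[OF us vs] by blast
    have J: "set (zip us vs) \<subseteq> ?J \<times> ?J" using us vs q in_lists_zip[of us vs ?J ?J] by auto
    have "\<forall>(u, v)\<in>set (zip us vs). length (a u) = length (a v)"
      using conjunct2[OF R[unfolded indisc_def], rule_format, OF J s] by blast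
    then have z: "set (zip (concat (map a us)) (concat (map a vs))) = pairs a a (set (zip us vs)) \<and>
        length (concat (map a us)) = length (concat (map a vs))"
      using q by (intro set_zip_concat) auto
    have U: "set (concat (map a us)) \<subseteq> univ C" "set (concat (map a vs)) \<subseteq> univ C"
      using us vs indisc_univ[OF R] by fastforce+
    show "tp \<tau> C (concat (map a us)) A = tp \<tau> C (concat (map a vs)) A"
      using indisc_elem[OF R J s] z
      unfolding tp_eq_iff[OF conjunct2[OF z] U A] by (simp only: Un_commute)
  qed (use indisc_univ[OF R] in auto)
qed

lemma pairs_concat:
  assumes "\<And>u v. (u, v) \<in> Z \<Longrightarrow> length (ex u) = length (ex v)"
    and "\<And>x y. (x, y) \<in> pairs ex ex Z \<Longrightarrow> length (a x) = length (a y)"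
  shows "pairs (\<lambda>u. concat (map a (ex u))) (\<lambda>u. concat (map a (ex u))) Z = pairs a a (pairs ex ex Z)"
    and "(u, v) \<in> Z \<Longrightarrow> length (concat (map a (ex u))) = length (concat (map a (ex v)))"
proof -
  have *: "set (zip (concat (map a (ex u))) (concat (map a (ex v)))) = pairs a a (set (zip (ex u) (ex v))) \<and>
    length (concat (map a (ex u))) = length (concat (map a (ex v)))" if "(u, v) \<in> Z" for u v
  proof (rule set_zip_concat)
    show "\<forall>(x, y)\<in>set (zip (ex u) (ex v)). length (a x) = length (a y)"
      using assms(2)[OF pairsI[OF that]] by auto
  qed (rule assms(1)[OF that])
  have "pairs (\<lambda>u. concat (map a (ex u))) (\<lambda>u. concat (map a (ex u))) Z =
    (\<Union>z\<in>Z. pairs a a (set (zip (ex (fst z)) (ex (snd z)))))"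
    unfolding pairs_def[of _ _ Z] case_prod_beta
    by (intro SUP_cong refl) (simp add: *)
  also have "\<dots> = pairs a a (pairs ex ex Z)"
    by (simp add: pairs_def case_prod_beta)
  finally show "pairs (\<lambda>u. concat (map a (ex u))) (\<lambda>u. concat (map a (ex u))) Z = pairs a a (pairs ex ex Z)" .
  show "(u, v) \<in> Z \<Longrightarrow> length (concat (map a (ex u))) = length (concat (map a (ex v)))" by (simp add: *)
qed

text \<open>Regrouping: once \<open>ex\<close> carries index correspondences to index
  correspondences, nothing about types has to be checked again. Used with singleton lists for
  reindexing and with long ones for blocks.\<close>

lemma indisc_pullback:
  assumes a: "indisc \<tau> C A n I r a"
    and ex: "\<And>u. u \<in> index_set n' I' r' \<Longrightarrow> set (ex u) \<subseteq> index_set n I r"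
    and len: "\<And>u v. u \<in> index_set n' I' r' \<Longrightarrow> v \<in> index_set n' I' r' \<Longrightarrow> seq_length u = seq_length v \<Longrightarrow>
      length (ex u) = length (ex v)"
    and sim: "\<And>Z. Z \<subseteq> index_set n' I' r' \<times> index_set n' I' r' \<Longrightarrow> same_qftp r' r' Z \<Longrightarrow>
      same_qftp r r (pairs ex ex Z)"
  shows "indisc \<tau> C A n' I' r' (\<lambda>u. concat (map a (ex u)))"
  unfolding indisc_def
proof (intro conjI ballI allI impI)
  fix u assume "u \<in> index_set n' I' r'"
  then have "set (a x) \<subseteq> univ C" if "x \<in> set (ex u)" for x using ex indisc_univ[OF a] that by blast
  then show "set (concat (map a (ex u))) \<subseteq> univ C" by auto
next
  fix Z assume Z: "Z \<subseteq> index_set n' I' r' \<times> index_set n' I' r'" "same_qftp r' r' Z"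
  let ?Y = "pairs ex ex Z"
  have Y: "?Y \<subseteq> index_set n I r \<times> index_set n I r"
  proof
    fix p assume "p \<in> ?Y"
    then obtain u v where uv: "(u, v) \<in> Z" "p \<in> set (zip (ex u) (ex v))" by (auto simp: pairs_def)
    then have "fst p \<in> set (ex u)" "snd p \<in> set (ex v)"
      by (metis prod.collapse set_zip_leftD) (metis uv(2) prod.collapse set_zip_rightD)
    with uv(1) Z(1) ex[of u] ex[of v] have "fst p \<in> index_set n I r" "snd p \<in> index_set n I r" by blast+
    then show "p \<in> index_set n I r \<times> index_set n I r" by (cases p) simp
  qed
  note s = sim[OF Z]
  have lY: "length (a x) = length (a y)" if "(x, y) \<in> ?Y" for x y
    using indisc_length[OF a] Y that same_qftp_mono[OF s] by blast
  have lZ: "length (ex u) = length (ex v)" if "(u, v) \<in> Z" for u v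
    using len same_qftp_seq_length[OF Z(2) that] Z(1) that by blast
  note p = pairs_concat[where ex = ex and a = a, OF lZ lY]
  show "elem \<tau> C C (Id_on A \<union> pairs (\<lambda>u. concat (map a (ex u))) (\<lambda>u. concat (map a (ex u))) Z)"
    using indisc_elem[OF a Y s] p(1) by simp
  show "\<And>z. z \<in> Z \<Longrightarrow> case z of (u, v) \<Rightarrow>
      length (concat (map a (ex u))) = length (concat (map a (ex v)))" using p(2) by blast
qed

text \<open>Correspondences of the image family are conjugates, by the graph of \<open>g\<close>, of
  those of \<open>a\<close>.\<close>

lemma indisc_move:
  assumes a: "indisc \<tau> C A n I r a" and g: "elem \<tau> C D (graph g X)"
    and X: "A \<subseteq> X" "\<And>u. u \<in> index_set n I r \<Longrightarrow> set (a u) \<subseteq> X"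
  shows "indisc \<tau> D (g ` A) n I r (\<lambda>u. map g (a u))"
  unfolding indisc_def
proof (intro conjI ballI allI impI)
  fix u assume "u \<in> index_set n I r"
  then have "g ` set (a u) \<subseteq> g ` X" using X by blast
  also have "\<dots> \<subseteq> univ D" using elem_univ[OF g] by auto
  finally show "set (map g (a u)) \<subseteq> univ D" by simp
next
  let ?J = "index_set n I r"
  fix Z assume Z: "Z \<subseteq> ?J \<times> ?J" "same_qftp r r Z"
  have "elem \<tau> D D ((graph g X)\<inverse> O (Id_on A \<union> pairs a a Z) O graph g X)"
    by (intro elem_comp[OF elem_converse[OF g]] elem_comp[OF indisc_elem[OF a Z] g])
  moreover have "Id_on (g ` A) \<subseteq> (graph g X)\<inverse> O (Id_on A \<union> pairs a a Z) O graph g X"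
    using X(1) by blast
  moreover have "pairs (\<lambda>u. map g (a u)) (\<lambda>u. map g (a u)) Z \<subseteq>
      (graph g X)\<inverse> O (Id_on A \<union> pairs a a Z) O graph g X"
  proof
    fix p assume "p \<in> pairs (\<lambda>u. map g (a u)) (\<lambda>u. map g (a u)) Z"
    then obtain u v where uv: "(u, v) \<in> Z" "p \<in> set (zip (map g (a u)) (map g (a v)))"
      by (auto simp: pairs_def)
    then obtain x y where xy: "(x, y) \<in> set (zip (a u) (a v))" "p = (g x, g y)"
      by (auto simp: zip_map_map)
    have "u \<in> ?J" "v \<in> ?J" using uv(1) Z(1) by auto
    then have "x \<in> X" "y \<in> X"
      using X(2) set_zip_leftD[OF xy(1)] set_zip_rightD[OF xy(1)] by auto
    then have "(g x, x) \<in> (graph g X)\<inverse>" "(y, g y) \<in> graph g X" by auto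
    moreover have "(x, y) \<in> Id_on A \<union> pairs a a Z" using uv xy by (auto simp: pairs_def)
    ultimately show "p \<in> (graph g X)\<inverse> O (Id_on A \<union> pairs a a Z) O graph g X"
      using xy(2) by (blast intro: relcompI)
  qed
  ultimately show "elem \<tau> D D (Id_on (g ` A) \<union> pairs (\<lambda>u. map g (a u)) (\<lambda>u. map g (a u)) Z)"
    by (meson Un_least elem_mono)
  show "\<And>z. z \<in> Z \<Longrightarrow> case z of (u, v) \<Rightarrow> length (map g (a u)) = length (map g (a v))"
    using a Z unfolding indisc_def by (simp add: case_prod_beta)
qed

section \<open>Stretching a family to index set \<open>\<omega>\<close>\<close>

lemma set_zip_same: "set (zip xs xs) = Id_on (set xs)"
  by (auto simp: zip_same)

definition natle :: "nat rel" where
  "natle = {(x, y). x \<le> y}"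

lemma lt_natle [simp]: "lt natle x y \<longleftrightarrow> x < y"
  by (auto simp: lt_def natle_def)

lemma natle_iff: "(v, w) \<in> natle \<longleftrightarrow> v \<le> w"
  by (simp add: natle_def)

lemma linear_natle: "linear_order_on UNIV natle"
  by (auto simp: linear_order_on_def partial_order_on_def preorder_on_def refl_on_def trans_def
      antisym_def total_on_def natle_def)

definition emb :: "'i rel \<Rightarrow> 'j rel \<Rightarrow> ('i \<Rightarrow> 'j) \<Rightarrow> 'i set \<Rightarrow> bool" where
  "emb r r' f S \<longleftrightarrow> inj_on f S \<and> (\<forall>x\<in>S. \<forall>y\<in>S. lt r x y \<longleftrightarrow> lt r' (f x) (f y))"

lemma index_set_mono: "S \<subseteq> I \<Longrightarrow> index_set n S r \<subseteq> index_set n I r"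
  unfolding index_set_def incr_def by fast

lemma Inl_index_set [simp]: "Inl x \<in> index_set n I r \<longleftrightarrow> x \<in> I"
  by (auto simp: index_set_def)

lemma Inr_index_set [simp]:
  "Inr ts \<in> index_set n I r \<longleftrightarrow> set ts \<subseteq> I \<and> sorted_wrt (lt r) ts \<and> length ts < n"
  by (auto simp: index_set_def incr_def)

lemma finite_index_set: "finite S \<Longrightarrow> finite (index_set n S r)"
proof -
  assume S: "finite S"
  have "finite {ts. set ts \<subseteq> S \<and> length ts \<le> n}" by (rule finite_lists_length_le[OF S])
  moreover have "{ts \<in> incr S r. length ts < n} \<subseteq> {ts. set ts \<subseteq> S \<and> length ts \<le> n}"
    by (auto simp: incr_def)
  ultimately have "finite {ts \<in> incr S r. length ts < n}" by (rule finite_subset[rotated])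
  then show ?thesis using S by (simp add: index_set_def)
qed

lemma same_qftp_emb:
  assumes "emb r r' f S"
  shows "same_qftp r r' (graph (index_map f) (index_set n S r))"
proof (rule same_qftpI)
  have inj: "inj_on f S" and lt: "\<And>x y. x \<in> S \<Longrightarrow> y \<in> S \<Longrightarrow> lt r' (f x) (f y) \<longleftrightarrow> lt r x y"
    using assms by (auto simp: emb_def)
  have eq: "f x = f y \<longleftrightarrow> x = y" if "x \<in> S" "y \<in> S" for x y using inj that by (meson inj_on_eq_iff)
  have eqs: "map f ts = map f us \<longleftrightarrow> ts = us" if "set ts \<subseteq> S" "set us \<subseteq> S" for ts us
    by (rule inj_on_map_eq_map, rule inj_on_subset[OF inj]) (use that in auto)
  fix u v u' v'
  assume "(u, v) \<in> graph (index_map f) (index_set n S r)" "(u', v') \<in> graph (index_map f) (index_set n S r)"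
  then have u: "u \<in> index_set n S r" "u' \<in> index_set n S r" "v = index_map f u" "v' = index_map f u'"
    by auto
  have m: "ts ! k \<in> S" if "Inr ts \<in> index_set n S r" "k < length ts" for ts k
    using that nth_mem by fastforce
  show "pattern r u u' = pattern r' v v'"
  proof (cases u; cases u')
    fix x y assume "u = Inl x" "u' = Inl y"
    with u show ?thesis
      by (simp add: pattern_def seq_length_def idx_less_def entries_def eq lt)
  next
    fix x ts assume "u = Inl x" "u' = Inr ts"
    with u show ?thesis
      by (simp add: pattern_def seq_length_def idx_less_def entries_def)
  next
    fix ts x assume U: "u = Inr ts" "u' = Inl x"
    then have "{k. k < length ts \<and> ts ! k = x} = {k. k < length ts \<and> f (ts ! k) = f x}"
      using u(1,2) m by (auto simp: eq simp del: Inr_index_set)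
    moreover have "{k. k < length ts \<and> f (ts ! k) = f x} = {k. k < length ts \<and> map f ts ! k = f x}"
      by auto
    ultimately show ?thesis using U u(3,4)
      by (simp add: pattern_def seq_length_def idx_less_def entries_def)
  next
    fix ts us assume "u = Inr ts" "u' = Inr us"
    with u show ?thesis
      by (simp add: pattern_def seq_length_def idx_less_def entries_def eqs)
  qed
qed

lemma index_map_mem:
  assumes "emb r r' f S" "f ` S \<subseteq> I" "u \<in> index_set n S r"
  shows "index_map f u \<in> index_set n I r'"
proof (cases u)
  case (Inl x)
  then show ?thesis using assms by auto
next
  case (Inr ts)
  then have ts: "set ts \<subseteq> S" "sorted_wrt (lt r) ts" "length ts < n" using assms(3) by auto
  have "sorted_wrt (\<lambda>x y. lt r' (f x) (f y)) ts"
    by (rule sorted_wrt_mono_rel[OF _ ts(2)]) (use ts(1) assms(1) in \<open>auto simp: emb_def\<close>)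
  then show ?thesis using Inr ts assms(2) by (auto simp: sorted_wrt_map)
qed

lemma linear_orderD:
  assumes "linear_order_on I r"
  shows "antisym r" "trans r" "\<And>x y. x \<in> I \<Longrightarrow> y \<in> I \<Longrightarrow> x \<noteq> y \<Longrightarrow> (x, y) \<in> r \<or> (y, x) \<in> r"
  using assms by (auto simp: linear_order_on_def partial_order_on_def preorder_on_def total_on_def)

lemma lt_trans: "trans r \<Longrightarrow> antisym r \<Longrightarrow> lt r x y \<Longrightarrow> lt r y z \<Longrightarrow> lt r x z"
  unfolding lt_def by (metis antisymD transD)

lemma lt_asym: "antisym r \<Longrightarrow> lt r x y \<Longrightarrow> \<not> lt r y x"
  unfolding lt_def by (metis antisymD)

lemma emb_nth:
  assumes r: "antisym r" and us: "us \<in> incr I r"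
  shows "emb natle r (nth us) {..<length us}"
proof -
  have s: "lt r (us ! i) (us ! j)" if "i < j" "j < length us" for i j
    using us that by (auto simp: incr_def sorted_wrt_iff_nth_less)
  have irr: "\<not> lt r x x" for x by (simp add: lt_def)
  have "us ! i = us ! j \<longrightarrow> i = j" if "i < length us" "j < length us" for i j
    using s[of i j] s[of j i] irr that by (metis linorder_neqE_nat)
  moreover have "i < j \<longleftrightarrow> lt r (us ! i) (us ! j)" if "i < length us" "j < length us" for i j
    using s[of i j] s[of j i] irr lt_asym[OF r] that by (metis linorder_neqE_nat)
  ultimately show ?thesis by (auto simp: emb_def inj_on_def)
qed

lemma incr_listing:
  assumes r: "linear_order_on I r" and X: "finite X" "X \<subseteq> I"
  obtains us where "us \<in> incr I r" "set us = X"
proof -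
  note lo = linear_orderD[OF r]
  have "\<exists>us. sorted_wrt (lt r) us \<and> set us = X" using X
  proof (induction rule: finite_induct)
    case (insert x X)
    then obtain us where us: "sorted_wrt (lt r) us" "set us = X" by auto
    let ?vs = "filter (\<lambda>y. lt r y x) us @ x # filter (\<lambda>y. lt r x y) us"
    have "lt r y x \<or> lt r x y" if "y \<in> X" for y
      using lo(3)[of x y] insert that by (auto simp: lt_def)
    then have "set ?vs = insert x X" using us(2) by auto
    moreover have "sorted_wrt (lt r) ?vs"
      using us(1) lt_trans[OF lo(2,1)]
      by (auto simp: sorted_wrt_append intro: sorted_wrt_filter)
    ultimately show ?case by blast
  qed simp
  then show thesis using that X(2) by (auto simp: incr_def)
qed

lemma length_incr: "us \<in> incr I r \<Longrightarrow> length us = card (set us)"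
proof -
  assume "us \<in> incr I r"
  then have "sorted_wrt (lt r) us" by (simp add: incr_def)
  then have "distinct us" by (induction us) (auto simp: lt_def)
  then show ?thesis by (simp add: distinct_card)
qed

lemma incr_of_length:
  assumes r: "linear_order_on I r" and I: "infinite I"
  obtains us where "us \<in> incr I r" "length us = k"
proof -
  obtain X where X: "X \<subseteq> I" "card X = k" "finite X" using infinite_arbitrarily_large[OF I] by blast
  obtain us where "us \<in> incr I r" "set us = X" using incr_listing[OF r X(3,1)] by blast
  with X length_incr that show thesis by metis
qed

text \<open>Relates each index built over the list \<open>us\<close> to its copy over the positions
  in \<open>us\<close>, so that \<open>I\<close> and omega can be compared on finite parts.\<close>

definition place :: "nat \<Rightarrow> 'i list \<Rightarrow> (('i + 'i list) \<times> (nat + nat list)) set" where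
  "place n us = (\<lambda>u. (index_map (nth us) u, u)) ` index_set n {..<length us} natle"

lemma place_graph: "place n us = (graph (index_map (nth us)) (index_set n {..<length us} natle))\<inverse>"
  by (auto simp: place_def)

lemma same_qftp_place:
  "antisym r \<Longrightarrow> us \<in> incr I r \<Longrightarrow> same_qftp r natle (place n us)"
  unfolding place_graph by (intro same_qftp_converse same_qftp_emb emb_nth)

lemma place_mem:
  assumes "antisym r" "us \<in> incr I r" "(x, u) \<in> place n us"
  shows "x \<in> index_set n I r" "u \<in> index_set n {..<length us} natle" "x = index_map (nth us) u"
proof -
  show u: "u \<in> index_set n {..<length us} natle" "x = index_map (nth us) u"
    using assms(3) by (auto simp: place_def)
  have "nth us ` {..<length us} \<subseteq> I" using assms(2) by (auto simp: incr_def)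
  then show "x \<in> index_set n I r" using index_map_mem[OF emb_nth[OF assms(1,2)] _ u(1)] u(2) by blast
qed

lemma finite_place: "finite (place n us)"
  by (simp add: place_def finite_index_set)

lemma finite_pairs: "finite Z \<Longrightarrow> finite (pairs a b Z)"
  by (auto simp: pairs_def)

text \<open>What matters is that \<open>u\<close> lives over the numbers below its bound; the sum of
  the entries avoids a maximum over a possibly empty list.\<close>

fun bound :: "nat + nat list \<Rightarrow> nat" where
  "bound (Inl t) = Suc t"
| "bound (Inr ts) = Suc (sum_list ts)"

lemma index_set_bound: "u \<in> index_set n UNIV natle \<Longrightarrow> bound u \<le> k \<Longrightarrow> u \<in> index_set n {..<k} natle"
proof (cases u)
  case (Inr ts)
  assume "u \<in> index_set n UNIV natle" "bound u \<le> k"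
  moreover have "x \<le> sum_list ts" if "x \<in> set ts" for x using member_le_sum_list[of x ts] that by simp
  ultimately show ?thesis using Inr by fastforce
qed auto

lemma length_pairs_comp:
  "(\<And>u v. (u, v) \<in> Z \<Longrightarrow> length (a u) = length (b v)) \<Longrightarrow>
    (\<And>u v. (u, v) \<in> Z' \<Longrightarrow> length (b u) = length (c v)) \<Longrightarrow>
    (u, v) \<in> Z O Z' \<Longrightarrow> length (a u) = length (c v)"
  by (metis relcompEpair)

lemma elem_pairs_comp:
  assumes "elem \<tau> C D (Id_on A \<union> pairs a b Z)" "elem \<tau> D E (Id_on A \<union> pairs b c Z')"
    and "\<And>u w v. (u, w) \<in> Z \<Longrightarrow> (w, v) \<in> Z' \<Longrightarrow> length (a u) = length (b w)"
  shows "elem \<tau> C E (Id_on A \<union> pairs a c (Z O Z'))"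
proof (rule elem_mono[OF elem_comp[OF assms(1,2)]])
  have "pairs a c (Z O Z') \<subseteq> pairs a b Z O pairs b c Z'" by (rule pairs_comp[OF assms(3)])
  then show "Id_on A \<union> pairs a c (Z O Z') \<subseteq> (Id_on A \<union> pairs a b Z) O (Id_on A \<union> pairs b c Z')"
    by blast
qed

lemma elem_pairs_converse:
  "elem \<tau> C D (Id_on A \<union> pairs a b Z) \<Longrightarrow> elem \<tau> D C (Id_on A \<union> pairs b a (Z\<inverse>))"
  by (drule elem_converse) (simp add: pairs_converse converse_Un)

text \<open>On the first \<open>length us\<close> positions, \<open>e\<close> realizes over
  \<open>A\<close> the Ehrenfeucht-Mostowski pattern of \<open>a\<close> read off at
  \<open>us\<close>.\<close>

definition em :: "'s vocab \<Rightarrow> ('s, 'a) struc \<Rightarrow> 'a set \<Rightarrow> nat \<Rightarrow> ('i + 'i list \<Rightarrow> 'a list) \<Rightarrow>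
    (nat + nat list \<Rightarrow> 'a list) \<Rightarrow> 'i list \<Rightarrow> bool" where
  "em \<tau> C A n a e us \<longleftrightarrow> elem \<tau> C C (Id_on A \<union> pairs a e (place n us)) \<and>
     (\<forall>(x, u)\<in>place n us. length (a x) = length (e u))"

text \<open>The finite relation sending \<open>a\<close> along \<open>take k us\<close> to the old
  \<open>e\<close> extends to the finitely many elements that occur in \<open>a\<close> along
  \<open>us\<close>.\<close>

lemma em_step:
  assumes a: "indisc \<tau> C A n I r a" and r: "linear_order_on I r"
    and C: "fsat \<tau> C" and A: "finite A"
    and us: "us \<in> incr I r" "length us = Suc k" and e: "em \<tau> C A n a e (take k us)"
  obtains e' where "em \<tau> C A n a e' us" "\<And>u. u \<in> index_set n {..<k} natle \<Longrightarrow> e' u = e u"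
proof -
  note anti = linear_orderD(1)[OF r]
  let ?J = "index_set n {..<k} natle"
  let ?X = "\<Union>u\<in>index_set n {..<Suc k} natle. set (a (index_map (nth us) u))"
  have usk: "take k us \<in> incr I r" using us by (auto simp: incr_def sorted_wrt_take dest: in_set_takeD)
  have X: "?X \<subseteq> univ C"
  proof (rule UN_least)
    fix u assume "u \<in> index_set n {..<Suc k} natle"
    then have "index_map (nth us) u \<in> index_set n I r"
      using place_mem(1)[OF anti us(1), of "index_map (nth us) u" u n] us(2) by (auto simp: place_def)
    then show "set (a (index_map (nth us) u)) \<subseteq> univ C" by (rule indisc_univ[OF a])
  qed
  have fin: "finite (Id_on A \<union> pairs a e (place n (take k us)))"
    using A finite_pairs[OF finite_place] by (simp add: Id_on_def)
  have cX: "countable ?X" by (intro countable_finite finite_UN_I finite_index_set) auto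
  obtain g where g: "elem \<tau> C C ((Id_on A \<union> pairs a e (place n (take k us))) \<union> graph g ?X)"
    using elem_extend_countable[OF _ fin C cX X] e by (auto simp: em_def)
  \<comment> \<open>On old indices \<open>e\<close> is kept literally, so that the successive
    approximations are coherent; new indices get the image of the true tuple.\<close>
  define e' where "e' = (\<lambda>u. if u \<in> ?J then e u else map g (a (index_map (nth us) u)))"
  have old: "(index_map (nth us) u, u) \<in> place n (take k us)" if "u \<in> ?J" for u
  proof -
    have "index_map (nth us) u = index_map (nth (take k us)) u"
      using that by (cases u) auto
    then show ?thesis using that us(2) by (auto simp: place_def)
  qed
  have "set (zip (a x) (e' u)) \<subseteq> (Id_on A \<union> pairs a e (place n (take k us))) \<union> graph g ?X \<and>
      length (a x) = length (e' u)"
    if "(x, u) \<in> place n us" for x u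
  proof (cases "u \<in> ?J")
    case True
    have "x = index_map (nth us) u" using place_mem[OF anti us(1) that] by blast
    with old[OF True] have p: "(x, u) \<in> place n (take k us)" by simp
    then have "length (a x) = length (e u)" using e by (auto simp: em_def)
    moreover have "set (zip (a x) (e u)) \<subseteq> pairs a e (place n (take k us))"
      using p by (auto simp: pairs_def)
    ultimately show ?thesis using True by (auto simp: e'_def)
  next
    case False
    have x: "x = index_map (nth us) u" "u \<in> index_set n {..<Suc k} natle"
      using place_mem[OF anti us(1) that] us(2) by auto
    have "set (zip (a x) (map g (a x))) = graph g (set (a x))"
      by (simp add: zip_map2 zip_same_conv_map)
    moreover have "set (a x) \<subseteq> ?X" using x by blast
    ultimately show ?thesis using False x by (auto simp: e'_def)
  qed
  then have "pairs a e' (place n us) \<subseteq> (Id_on A \<union> pairs a e (place n (take k us))) \<union> graph g ?X"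
    "\<forall>(x, u)\<in>place n us. length (a x) = length (e' u)"
    unfolding pairs_def by blast+
  then have "em \<tau> C A n a e' us" unfolding em_def by (intro conjI elem_mono[OF g]) auto
  then show thesis by (rule that) (simp add: e'_def)
qed

text \<open>By indiscernibility \<open>vs\<close> and \<open>us\<close> look the same in
  \<open>a\<close>; composing with that correspondence moves the pattern from \<open>us\<close> to
  \<open>vs\<close>.\<close>

lemma em_all:
  assumes a: "indisc \<tau> C A n I r a" and r: "linear_order_on I r"
    and us: "us \<in> incr I r" and e: "em \<tau> C A n a e us" and vs: "vs \<in> incr I r" "length vs = length us"
  shows "em \<tau> C A n a e vs"
proof -
  note anti = linear_orderD(1)[OF r]
  let ?W = "place n vs O (place n us)\<inverse>"
  have W: "?W \<subseteq> index_set n I r \<times> index_set n I r" "same_qftp r r ?W"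
    using place_mem(1)[OF anti us] place_mem(1)[OF anti vs(1)]
      same_qftp_comp[OF same_qftp_place[OF anti vs(1)] same_qftp_converse[OF same_qftp_place[OF anti us]]]
    by auto
  have lW: "length (a x) = length (a y)" if "(x, y) \<in> ?W" for x y
  proof -
    have "same_qftp r r {(x, y)}" by (rule same_qftp_mono[OF W(2)]) (use that in blast)
    then show ?thesis using indisc_length[OF a] W(1) that by blast
  qed
  have sub: "place n vs \<subseteq> ?W O place n us"
  proof
    fix p assume "p \<in> place n vs"
    then obtain u where u: "u \<in> index_set n {..<length vs} natle" "p = (index_map (nth vs) u, u)"
      by (auto simp: place_def)
    then have "p \<in> place n vs" "(index_map (nth us) u, u) \<in> place n us" using vs(2) by (auto simp: place_def)
    then show "p \<in> ?W O place n us" using u(2) by blast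
  qed
  have "elem \<tau> C C (Id_on A \<union> pairs a e (?W O place n us))"
    by (rule elem_pairs_comp[OF indisc_elem[OF a W]]) (use e lW in \<open>auto simp: em_def\<close>)
  then have "elem \<tau> C C (Id_on A \<union> pairs a e (place n vs))"
    by (rule elem_mono) (use pairs_mono[OF sub] in blast)
  moreover have "length (a x) = length (e u)" if "(x, u) \<in> place n vs" for x u
    by (rule length_pairs_comp[of ?W a a "place n us" e]) (use lW e sub that in \<open>auto simp: em_def\<close>)
  ultimately show ?thesis by (auto simp: em_def)
qed

lemma em_cong:
  assumes "\<And>u. u \<in> index_set n {..<length us} natle \<Longrightarrow> e u = e' u"
  shows "em \<tau> C A n a e us \<longleftrightarrow> em \<tau> C A n a e' us"
proof -
  have "e u = e' u" if "(x, u) \<in> place n us" for x u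
    using that assms by (auto simp: place_def)
  then have "pairs a e (place n us) = pairs a e' (place n us)"
    "(\<forall>(x, u)\<in>place n us. length (a x) = length (e u)) \<longleftrightarrow> (\<forall>(x, u)\<in>place n us. length (a x) = length (e' u))"
    by (auto simp: pairs_def)
  then show ?thesis by (simp add: em_def)
qed

text \<open>Finite approximations along longer and longer increasing lists are glued to one family.
  An infinite \<open>I\<close> supplies lists of every length, and by \<open>em_all\<close> it does
  not matter which list is used for a given length.\<close>

lemma stretch:
  assumes a: "indisc \<tau> C A n I r a" and r: "linear_order_on I r" and I: "infinite I"
    and C: "fsat \<tau> C" and A: "finite A" "A \<subseteq> univ C"
  obtains e where "indisc \<tau> C A n UNIV natle e" "\<And>us. us \<in> incr I r \<Longrightarrow> em \<tau> C A n a e us"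
proof -
  note anti = linear_orderD(1)[OF r]
  have "\<exists>E. \<forall>k. (\<forall>us\<in>incr I r. length us = k \<longrightarrow> em \<tau> C A n a (E k) us) \<and>
      (\<forall>u\<in>index_set n {..<k} natle. E (Suc k) u = E k u)"
  proof (rule dependent_nat_choice)
    \<comment> \<open>Over the empty list the only possible index is the empty sequence, present if
      \<open>n > 0\<close>. The constant family with value \<open>a (Inr [])\<close> therefore gives
      a relation inside the identity.\<close>
    have "pairs a (\<lambda>u. a (Inr [])) (place n []) \<subseteq> Id_on (univ C)"
    proof
      fix p assume "p \<in> pairs a (\<lambda>u. a (Inr [])) (place n [])"
      then obtain x where "x = Inr []" "x \<in> index_set n I r" "p \<in> set (zip (a x) (a x))"
        by (auto simp: pairs_def place_def index_set_def incr_def split: if_splits)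
      then show "p \<in> Id_on (univ C)" using indisc_univ[OF a, of x] by (auto simp: set_zip_same)
    qed
    with A(2) have "Id_on A \<union> pairs a (\<lambda>u. a (Inr [])) (place n []) \<subseteq> Id_on (univ C)" by blast
    moreover have "length (a x) = length (a (Inr []))" if "(x, u) \<in> place n []" for x u
      using that by (auto simp: place_def index_set_def incr_def)
    ultimately have "em \<tau> C A n a (\<lambda>u. a (Inr [])) []"
      unfolding em_def using elem_mono[OF elem_Id_on[OF order_refl]] by blast
    then show "\<exists>e. \<forall>us\<in>incr I r. length us = 0 \<longrightarrow> em \<tau> C A n a e us" by blast
  next
    fix e k assume e: "\<forall>us\<in>incr I r. length us = k \<longrightarrow> em \<tau> C A n a e us"
    obtain us where us: "us \<in> incr I r" "length us = Suc k" by (rule incr_of_length[OF r I])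
    have "take k us \<in> incr I r" using us by (auto simp: incr_def sorted_wrt_take dest: in_set_takeD)
    then have "em \<tau> C A n a e (take k us)" using e us(2) by simp
    then obtain e' where e': "em \<tau> C A n a e' us" "\<And>u. u \<in> index_set n {..<k} natle \<Longrightarrow> e' u = e u"
      using em_step[OF a r C A(1) us] by blast
    then show "\<exists>e'. (\<forall>us\<in>incr I r. length us = Suc k \<longrightarrow> em \<tau> C A n a e' us) \<and>
        (\<forall>u\<in>index_set n {..<k} natle. e' u = e u)"
      using em_all[OF a r us(1) e'(1)] us(2) e'(2) by (intro exI[of _ e']) simp
  qed
  then obtain E where E: "\<And>k us. us \<in> incr I r \<Longrightarrow> length us = k \<Longrightarrow> em \<tau> C A n a (E k) us"
    and E': "\<And>k u. u \<in> index_set n {..<k} natle \<Longrightarrow> E (Suc k) u = E k u" by blast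
  have EE: "E j u = E k u" if "u \<in> index_set n {..<k} natle" "k \<le> j" for j k u
    using that(2)
  proof (induction j rule: dec_induct)
    case (step j)
    then have "u \<in> index_set n {..<j} natle" using that(1) index_set_mono[of "{..<k}" "{..<j}"] by auto
    with E' step show ?case by simp
  qed simp
  \<comment> \<open>The approximations are constant from stage \<open>bound u\<close> on, so this is
    their limit.\<close>
  define e where "e = (\<lambda>u. E (bound u) u)"
  have Ee: "E k u = e u" if "u \<in> index_set n {..<k} natle" for u k
  proof -
    have "u \<in> index_set n UNIV natle" using that index_set_mono[of "{..<k}" UNIV] by auto
    then have "u \<in> index_set n {..<bound u} natle" by (rule index_set_bound) simp
    then have "E (max k (bound u)) u = e u" unfolding e_def by (rule EE) simp
    moreover have "E (max k (bound u)) u = E k u" by (rule EE[OF that]) simp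
    ultimately show ?thesis by simp
  qed
  have em: "em \<tau> C A n a e us" if "us \<in> incr I r" for us
    using E[OF that refl] em_cong[of n us "E (length us)" e \<tau> C A a] Ee by blast
  have key: "elem \<tau> C C (Id_on A \<union> pairs e e Z) \<and> (\<forall>(u, v)\<in>Z. length (e u) = length (e v))"
    if Z: "Z \<subseteq> index_set n {..<k} natle \<times> index_set n {..<k} natle" "same_qftp natle natle Z" for Z k
  proof -
    obtain us where us: "us \<in> incr I r" "length us = k" by (rule incr_of_length[OF r I])
    note P = place_mem[OF anti us(1)] and sP = same_qftp_place[OF anti us(1)]
    have P': "(index_map (nth us) u, u) \<in> place n us" if "u \<in> index_set n {..<k} natle" for u
      using that us(2) by (auto simp: place_def)
    \<comment> \<open>A correspondence among positions is conjugated to one among indices over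
      \<open>I\<close>, where the indiscernibility of \<open>a\<close> applies.\<close>
    let ?W = "(place n us O Z) O (place n us)\<inverse>"
    have W: "?W \<subseteq> index_set n I r \<times> index_set n I r" using P(1) by blast
    have sW: "same_qftp r r ?W"
      by (intro same_qftp_comp[OF same_qftp_comp[OF sP Z(2)]] same_qftp_converse sP)
    have lW: "length (a x) = length (a y)" if "(x, y) \<in> ?W" for x y
    proof -
      have "same_qftp r r {(x, y)}" by (rule same_qftp_mono[OF sW]) (use that in blast)
      then show ?thesis using indisc_length[OF a] W that by blast
    qed
    have lP: "length (a x) = length (e u)" if "(x, u) \<in> place n us" for x u
      using em[OF us(1)] that by (auto simp: em_def)
    have sub: "Z \<subseteq> (place n us)\<inverse> O (?W O place n us)"
    proof (rule subrelI)
      fix u v assume uv: "(u, v) \<in> Z"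
      then have "(index_map (nth us) u, u) \<in> place n us" "(index_map (nth us) v, v) \<in> place n us"
        using Z(1) P' by auto
      with uv show "(u, v) \<in> (place n us)\<inverse> O (?W O place n us)" by blast
    qed
    have 1: "elem \<tau> C C (Id_on A \<union> pairs a e (place n us))" using em[OF us(1)] by (simp add: em_def)
    have 2: "elem \<tau> C C (Id_on A \<union> pairs a e (?W O place n us))"
      by (rule elem_pairs_comp[OF indisc_elem[OF a W sW] 1]) (rule lW)
    have "elem \<tau> C C (Id_on A \<union> pairs e e ((place n us)\<inverse> O (?W O place n us)))"
      by (rule elem_pairs_comp[OF elem_pairs_converse[OF 1] 2]) (simp add: lP)
    then have "elem \<tau> C C (Id_on A \<union> pairs e e Z)"
      by (rule elem_mono) (use pairs_mono[OF sub] in blast)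
    moreover have "length (e u) = length (e v)" if "(u, v) \<in> Z" for u v
    proof -
      have "u \<in> index_set n {..<k} natle" "v \<in> index_set n {..<k} natle" using that Z(1) by auto
      then have *: "(index_map (nth us) u, u) \<in> place n us" "(index_map (nth us) v, v) \<in> place n us"
        by (auto intro: P')
      with that have "(index_map (nth us) u, index_map (nth us) v) \<in> ?W" by blast
      from lW[OF this] lP[OF *(1)] lP[OF *(2)] show ?thesis by simp
    qed
    ultimately show ?thesis by blast
  qed
  let ?J = "index_set n UNIV natle"
  have bounded: "Z \<subseteq> index_set n {..<k} natle \<times> index_set n {..<k} natle"
    if "Z \<subseteq> ?J \<times> ?J" "\<And>u v. (u, v) \<in> Z \<Longrightarrow> bound u \<le> k \<and> bound v \<le> k" for Z k
  proof (rule subrelI)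
    fix u v assume uv: "(u, v) \<in> Z"
    then have "u \<in> ?J" "v \<in> ?J" using that(1) by auto
    then show "(u, v) \<in> index_set n {..<k} natle \<times> index_set n {..<k} natle"
      using that(2)[OF uv] by (simp add: index_set_bound)
  qed
  have "indisc \<tau> C A n UNIV natle e"
    unfolding indisc_def
  proof (intro conjI ballI allI impI)
    fix u assume u: "u \<in> ?J"
    have "elem \<tau> C C (Id_on A \<union> pairs e e {(u, u)})"
      using key[OF bounded[of "{(u,u)}" "bound u"]] u by (auto simp: same_qftp_def)
    from elem_univ[OF this] show "set (e u) \<subseteq> univ C" by (auto simp: pairs_def set_zip_same Id_on_def)
  next
    fix Z assume Z: "Z \<subseteq> ?J \<times> ?J" "same_qftp natle natle Z"
    show "elem \<tau> C C (Id_on A \<union> pairs e e Z)"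
    proof (rule elem_Id_on_pairs_finitary[OF A(2)])
      fix us vs assume uv: "length us = length vs" "set (zip us vs) \<subseteq> Z"
      define k where "k = sum_list (map bound (us @ vs))"
      have "bound u \<le> k" if "u \<in> set (us @ vs)" for u
        unfolding k_def using that member_le_sum_list[of "bound u" "map bound (us @ vs)"] by auto
      then have "set (zip us vs) \<subseteq> index_set n {..<k} natle \<times> index_set n {..<k} natle"
        by (intro bounded order_trans[OF uv(2) Z(1)])
          (metis UnCI set_append set_zip_leftD set_zip_rightD)
      with key same_qftp_mono[OF Z(2) uv(2)]
      show "elem \<tau> C C (Id_on A \<union> pairs e e (set (zip us vs)))" by blast
    qed
    fix z assume z: "z \<in> Z"
    obtain u v where uv: "z = (u, v)" by force
    have "{z} \<subseteq> index_set n {..<max (bound u) (bound v)} natle \<times> index_set n {..<max (bound u) (bound v)} natle"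
      using z uv Z(1) by (intro bounded) auto
    moreover have "same_qftp natle natle {z}" using same_qftp_mono[OF Z(2)] z by auto
    ultimately show "case z of (u, v) \<Rightarrow> length (e u) = length (e v)" using key by blast
  qed
  then show thesis using that em by blast
qed

section \<open>Dividing along \<open>\<omega>\<close>\<close>

text \<open>All tuples of a family over omega form a countable set, so a finite elementary relation
  prescribing values at the indices in \<open>U\<close> extends to all of it. Moving the family by
  the extension fixes \<open>A\<close> and attains the prescribed values.\<close>

lemma relocate:
  assumes e: "indisc \<tau> C A n UNIV natle e" and C: "fsat \<tau> C" and A: "finite A" "A \<subseteq> univ C"
    and U: "finite U" "U \<subseteq> index_set n UNIV natle"
    and el: "elem \<tau> C C (Id_on A \<union> pairs e b (Id_on U))"
    and len: "\<And>u. u \<in> U \<Longrightarrow> length (e u) = length (b u)"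
  obtains e' where "indisc \<tau> C A n UNIV natle e'" "\<And>u. u \<in> U \<Longrightarrow> e' u = b u"
    "\<And>u. length (e' u) = length (e u)"
proof -
  let ?J = "index_set n UNIV natle"
  let ?P = "Id_on A \<union> pairs e b (Id_on U)"
  define X where "X = A \<union> (\<Union>u\<in>?J. set (e u))"
  have fin: "finite ?P" using A(1) U(1) by (auto simp: pairs_def Id_on_def)
  have X: "countable X" "X \<subseteq> univ C"
  proof -
    show "countable X" unfolding X_def
      using A(1) by (intro countable_Un countable_UN countableI_type) (auto intro: countable_finite)
    show "X \<subseteq> univ C" unfolding X_def using A(2) indisc_univ[OF e] by blast
  qed
  obtain g where g: "elem \<tau> C C (?P \<union> graph g X)"
    using elem_extend_countable[OF el fin C X] by blast
  have gA: "g x = x" if "x \<in> A" for x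
    by (rule elem_unique[OF g]) (use that X_def in auto)
  have gU: "map g (e u) = b u" if "u \<in> U" for u
  proof (rule nth_equalityI)
    show "length (map g (e u)) = length (b u)" using len[OF that] by simp
    fix i assume i: "i < length (map g (e u))"
    have "(e u ! i, b u ! i) \<in> set (zip (e u) (b u))" using i len[OF that] by (auto simp: in_set_zip)
    then have 1: "(e u ! i, b u ! i) \<in> ?P \<union> graph g X"
      using pairsI[of u u "Id_on U" _ _ e b] that by blast
    have "e u ! i \<in> set (e u)" using i by simp
    then have "e u ! i \<in> X" using U(2) that unfolding X_def by blast
    then have 2: "(e u ! i, g (e u ! i)) \<in> ?P \<union> graph g X" by blast
    show "map g (e u) ! i = b u ! i" using elem_unique[OF g 2 1] i by simp
  qed
  have "indisc \<tau> C (g ` A) n UNIV natle (\<lambda>u. map g (e u))"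
    by (rule indisc_move[OF e elem_mono[OF g Un_upper2]]) (auto simp: X_def)
  moreover have "g ` A = A" using gA by force
  ultimately show thesis using that[of "\<lambda>u. map g (e u)"] gU by simp
qed

definition params :: "nat \<Rightarrow> ('i + 'i list \<Rightarrow> 'a list) \<Rightarrow> (nat \<Rightarrow> 'i) \<Rightarrow> nat \<Rightarrow> 'a set" where
  "params l a s i = (if l = 2 then (\<Union>j<i. set (a (Inl (s j))))
     else if l = 3 then set (a (Inr (map s [0..<i]))) else {})"

text \<open>The pairs, apart from the diagonal of the realization \<open>c\<close>, that enter the
  comparison at stage \<open>i\<close>: the two types are equal exactly if this together with
  \<open>Id_on (set c)\<close> is elementary (\<open>tp_iff_contrast\<close>).\<close>

definition contrast :: "nat \<Rightarrow> ('i + 'i list \<Rightarrow> 'a list) \<Rightarrow> 'a set \<Rightarrow> (nat \<Rightarrow> 'i) \<Rightarrow> (nat \<Rightarrow> 'i) \<Rightarrow> nat \<Rightarrow>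
    ('a \<times> 'a) set" where
  "contrast l a A s t i = Id_on (A \<union> params l a s i) \<union> set (zip (a (Inl (s i))) (a (Inl (t i))))"

text \<open>Indiscernible sequences (\<open>l = 1\<close> and \<open>l = 2\<close>) are encoded as families whose tuples at the
  sequence indices are empty.\<close>

definition gdiv :: "nat \<Rightarrow> 's vocab \<Rightarrow> ('s, 'a) struc \<Rightarrow> nat \<Rightarrow> nat \<Rightarrow> ('s, 'a) pfm \<Rightarrow> 'a set \<Rightarrow>
    'i set \<Rightarrow> 'i rel \<Rightarrow> bool" where
  "gdiv l \<tau> C n m f A I r \<longleftrightarrow> (\<exists>a s t. indisc \<tau> C A n I r a \<and>
     (l \<noteq> 3 \<longrightarrow> (\<forall>ts. Inr ts \<in> index_set n I r \<longrightarrow> a (Inr ts) = [])) \<and> interleaved I r n s t \<and>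
     (\<forall>c\<in>tuples C m. psat C c f \<longrightarrow> (\<forall>i<n. \<not> elem \<tau> C C (Id_on (set c) \<union> contrast l a A s t i))))"

abbreviation ndiv :: "nat \<Rightarrow> 's vocab \<Rightarrow> ('s, 'a) struc \<Rightarrow> nat \<Rightarrow> nat \<Rightarrow> ('s, 'a) pfm \<Rightarrow> 'a set \<Rightarrow> bool" where
  "ndiv l \<tau> C n m f A \<equiv> gdiv l \<tau> C n m f A UNIV natle"

lemma interleaved_less:
  assumes il: "interleaved I r n s t" and r: "linear_order_on I r" and ij: "i < j" "j < n"
  shows "lt r (s i) (s j)" "lt r (t i) (t j)" "(t i, s j) \<in> r"
proof -
  note lo = linear_orderD[OF r]
  have st: "lt r (s i) (t i)" if "i < n" for i using il that by (auto simp: interleaved_def)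
  have ts: "(t i, s (Suc i)) \<in> r" if "Suc i < n" for i using il that by (auto simp: interleaved_def)
  have mix: "lt r x z" if "lt r x y" "(y, z) \<in> r" for x y z
    using that lo(1,2) unfolding lt_def by (metis antisymD transD)
  have mix': "lt r x z" if "(x, y) \<in> r" "lt r y z" for x y z
    using that lo(1,2) unfolding lt_def by (metis antisymD transD)
  have "(t i, s j) \<in> r" using ij
  proof (induction j)
    case (Suc j)
    show ?case
    proof (cases "i = j")
      case True
      then show ?thesis using ts Suc.prems by simp
    next
      case False
      then have "(t i, s j) \<in> r" using Suc by simp
      then have "lt r (t i) (s (Suc j))" using mix[OF mix' ts[OF Suc.prems(2)]] st[of j] Suc.prems by simp
      then show ?thesis by (simp add: lt_def)
    qed
  qed simp
  then show "(t i, s j) \<in> r" "lt r (s i) (s j)" "lt r (t i) (t j)"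
    using mix[OF st[of i]] mix'[OF _ st[of j]] ij by auto
qed

lemma map_sorted_Inr:
  assumes "interleaved I r n s t" "linear_order_on I r" "i < n"
  shows "Inr (map s [0..<i]) \<in> index_set n I r"
  using assms interleaved_less(1)[OF assms(1,2)]
  by (auto simp: sorted_wrt_iff_nth_less interleaved_def)

text \<open>The dividing pattern touches only the indices \<open>s i\<close>, \<open>t i\<close> and
  sequences of them. After stretching to omega, the original tuples are put back at finitely many
  positions, so that literally the same contrasts occur.\<close>

lemma ndiv_of_gdiv:
  assumes g: "gdiv l \<tau> C n m f A I r" and r: "linear_order_on I r" "infinite I"
    and C: "fsat \<tau> C" and A: "finite A" "A \<subseteq> univ C"
  shows "ndiv l \<tau> C n m f A"
proof -
  note anti = linear_orderD(1)[OF r(1)]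
  obtain a s t where a: "indisc \<tau> C A n I r a"
    and nil: "\<And>ts. l \<noteq> 3 \<Longrightarrow> Inr ts \<in> index_set n I r \<Longrightarrow> a (Inr ts) = []"
    and il: "interleaved I r n s t"
    and con: "\<And>c i. c \<in> tuples C m \<Longrightarrow> psat C c f \<Longrightarrow> i < n \<Longrightarrow>
      \<not> elem \<tau> C C (Id_on (set c) \<union> contrast l a A s t i)"
    using g unfolding gdiv_def by blast
  have stI: "s i \<in> I" "t i \<in> I" if "i < n" for i using il that by (auto simp: interleaved_def)
  \<comment> \<open>All relevant elements of \<open>I\<close> in increasing order;
    \<open>\<sigma>\<close> and \<open>\<rho>\<close> below give positions in this list.\<close>
  obtain us where us: "us \<in> incr I r" "set us = s ` {..<n} \<union> t ` {..<n}"
    by (rule incr_listing[OF r(1), of "s ` {..<n} \<union> t ` {..<n}"]) (use stI in auto)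
  have "\<forall>i<n. \<exists>k<length us. us ! k = s i" "\<forall>i<n. \<exists>k<length us. us ! k = t i"
    using us(2) by (metis UnCI image_eqI in_set_conv_nth lessThan_iff)+
  then obtain \<sigma> \<rho> where \<sigma>: "\<And>i. i < n \<Longrightarrow> \<sigma> i < length us \<and> us ! \<sigma> i = s i"
    and \<rho>: "\<And>i. i < n \<Longrightarrow> \<rho> i < length us \<and> us ! \<rho> i = t i" by metis
  have em: "emb natle r (nth us) {..<length us}" by (rule emb_nth[OF anti us(1)])
  then have emlt: "i < j \<longleftrightarrow> lt r (us ! i) (us ! j)" if "i < length us" "j < length us" for i j
    using that by (auto simp: emb_def)
  have emle: "(i, j) \<in> natle" if "i < length us" "j < length us" "(us ! i, us ! j) \<in> r" for i j
  proof -
    have "\<not> lt r (us ! j) (us ! i)" using that(3) anti by (metis lt_asym lt_def)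
    then show ?thesis using emlt[of j i] that by (auto simp: natle_def)
  qed
  have il': "interleaved UNIV natle n \<sigma> \<rho>"
    unfolding interleaved_def
  proof (intro conjI allI impI)
    fix i assume "i < n"
    then show "lt natle (\<sigma> i) (\<rho> i)" using emlt \<sigma> \<rho> il by (auto simp: interleaved_def)
  next
    fix i assume "Suc i < n"
    then show "(\<rho> i, \<sigma> (Suc i)) \<in> natle" using emle \<sigma> \<rho> il by (auto simp: interleaved_def)
  qed auto
  obtain e where e: "indisc \<tau> C A n UNIV natle e" and ee: "\<And>us. us \<in> incr I r \<Longrightarrow> em \<tau> C A n a e us"
    using stretch[OF a r C A] by blast
  let ?U = "index_set n {..<length us} natle"
  define b where "b = (\<lambda>u. a (index_map (nth us) u))"
  have E: "elem \<tau> C C (Id_on A \<union> pairs a e (place n us))" and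
    El: "\<And>x u. (x, u) \<in> place n us \<Longrightarrow> length (a x) = length (e u)"
    using ee[OF us(1)] by (auto simp: em_def)
  have "pairs e b (Id_on ?U) = pairs e a ((place n us)\<inverse>)"
    by (auto simp: pairs_def place_def b_def Id_on_def)
  then have el: "elem \<tau> C C (Id_on A \<union> pairs e b (Id_on ?U))"
    using elem_pairs_converse[OF E] by simp
  have lenb: "length (e u) = length (b u)" if "u \<in> ?U" for u
    using El[of "index_map (nth us) u" u] that by (auto simp: place_def b_def)
  obtain e' where e': "indisc \<tau> C A n UNIV natle e'" "\<And>u. u \<in> ?U \<Longrightarrow> e' u = b u"
    "\<And>u. length (e' u) = length (e u)"
    using relocate[OF e C A finite_index_set index_set_mono[OF subset_UNIV] el lenb] by auto
  \<comment> \<open>The pattern \<open>em\<close> preserves lengths, and so does relocation; hence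
    emptiness at sequence indices survives.\<close>
  have nil': "e' (Inr ts) = []" if l: "l \<noteq> 3" and ts: "Inr ts \<in> index_set n UNIV natle" for ts
  proof -
    let ?k = "bound (Inr ts)"
    obtain vs where vs: "vs \<in> incr I r" "length vs = ?k" by (rule incr_of_length[OF r])
    have "Inr ts \<in> index_set n {..<?k} natle" by (rule index_set_bound[OF ts]) simp
    then have p: "(index_map (nth vs) (Inr ts), Inr ts) \<in> place n vs"
      unfolding place_def vs(2) by (rule imageI)
    have "a (index_map (nth vs) (Inr ts)) = []"
      using nil[OF l] place_mem(1)[OF anti vs(1) p] by simp
    moreover have "length (a (index_map (nth vs) (Inr ts))) = length (e (Inr ts))"
      using ee[OF vs(1)] p unfolding em_def by blast
    ultimately show ?thesis using e'(3)[of "Inr ts"] by simp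
  qed
  have es: "e' (Inl (\<sigma> i)) = a (Inl (s i))" "e' (Inl (\<rho> i)) = a (Inl (t i))" if "i < n" for i
    using \<sigma>[OF that] \<rho>[OF that] by (simp_all add: e'(2) b_def)
  have eI: "e' (Inr (map \<sigma> [0..<i])) = a (Inr (map s [0..<i]))" if "i < n" for i
  proof -
    from map_sorted_Inr[OF il' linear_natle that] have "Inr (map \<sigma> [0..<i]) \<in> ?U"
      using \<sigma> that by auto
    then have "e' (Inr (map \<sigma> [0..<i])) = a (Inr (map (nth us) (map \<sigma> [0..<i])))"
      by (simp add: e'(2) b_def)
    also have "map (nth us) (map \<sigma> [0..<i]) = map s [0..<i]" using \<sigma> that by simp
    finally show ?thesis .
  qed
  have "contrast l e' A \<sigma> \<rho> i = contrast l a A s t i" if "i < n" for i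
    using es[OF that] eI[OF that] es that by (simp add: contrast_def params_def)
  with con have "\<forall>c\<in>tuples C m. psat C c f \<longrightarrow>
      (\<forall>i<n. \<not> elem \<tau> C C (Id_on (set c) \<union> contrast l e' A \<sigma> \<rho> i))" by simp
  with e'(1) nil' il' show ?thesis unfolding gdiv_def by blast
qed

text \<open>Copies omega into another type by an injection, in order to reach the type of
  \<open>\<kappa>\<close>, where index orders are required to live.\<close>

lemma gdiv_of_ndiv:
  assumes f: "inj (f :: nat \<Rightarrow> 'k)" and g: "ndiv l \<tau> C n m \<phi> A"
  defines "r \<equiv> {(f x, f y) | x y. x \<le> y}"
  shows "gdiv l \<tau> C n m \<phi> A (range f) r" "linear_order_on (range f) r"
proof -
  have rf: "(f x, f y) \<in> r \<longleftrightarrow> x \<le> y" for x y using f by (auto simp: r_def inj_eq)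
  have ltf: "lt r (f x) (f y) \<longleftrightarrow> x < y" for x y using f by (auto simp: lt_def rf inj_eq)
  let ?g = "inv f"
  have gf: "?g (f x) = x" for x by (rule inv_f_f[OF f])
  show "linear_order_on (range f) r"
    unfolding linear_order_on_def partial_order_on_def preorder_on_def
  proof (intro conjI)
    show "r \<subseteq> range f \<times> range f" by (auto simp: r_def)
    show "refl_on (range f) r" by (auto simp: refl_on_def r_def)
    show "trans r" by (rule transI) (use f in \<open>auto simp: r_def inj_eq\<close>)
    show "antisym r" by (rule antisymI) (use f in \<open>auto simp: r_def inj_eq\<close>)
    show "total_on (range f) r" by (auto simp: total_on_def rf)
  qed
  have emb: "emb r natle ?g (range f)" by (auto simp: emb_def inj_on_def gf ltf)
  obtain a s t where a: "indisc \<tau> C A n UNIV natle a"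
    and nil: "\<And>ts. l \<noteq> 3 \<Longrightarrow> Inr ts \<in> index_set n UNIV natle \<Longrightarrow> a (Inr ts) = []"
    and il: "interleaved UNIV natle n s t"
    and con: "\<forall>c\<in>tuples C m. psat C c \<phi> \<longrightarrow>
      (\<forall>i<n. \<not> elem \<tau> C C (Id_on (set c) \<union> contrast l a A s t i))"
    using g unfolding gdiv_def by blast
  have mem: "index_map ?g u \<in> index_set n UNIV natle" if "u \<in> index_set n (range f) r" for u
    by (rule index_map_mem[OF emb _ that]) simp
  define b where "b = (\<lambda>u. concat (map a [index_map ?g u]))"
  have b: "b u = a (index_map ?g u)" for u by (simp add: b_def)
  have ib: "indisc \<tau> C A n (range f) r b"
    unfolding b_def
  proof (rule indisc_pullback[OF a])
    fix Z assume Z: "Z \<subseteq> index_set n (range f) r \<times> index_set n (range f) r" "same_qftp r r Z"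
    let ?G = "graph (index_map ?g) (index_set n (range f) r)"
    have G: "same_qftp r natle ?G" by (rule same_qftp_emb[OF emb])
    have "same_qftp natle natle (?G\<inverse> O (Z O ?G))"
      by (intro same_qftp_comp[OF same_qftp_converse[OF G]] same_qftp_comp[OF Z(2) G])
    moreover have "pairs (\<lambda>u. [index_map ?g u]) (\<lambda>u. [index_map ?g u]) Z \<subseteq> ?G\<inverse> O (Z O ?G)"
    proof
      fix p assume "p \<in> pairs (\<lambda>u. [index_map ?g u]) (\<lambda>u. [index_map ?g u]) Z"
      then obtain u v where uv: "(u, v) \<in> Z" "p = (index_map ?g u, index_map ?g v)"
        by (auto simp: pairs_def)
      with Z(1) have "(u, index_map ?g u) \<in> ?G" "(v, index_map ?g v) \<in> ?G" by blast+
      with uv show "p \<in> ?G\<inverse> O (Z O ?G)" by blast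
    qed
    ultimately show "same_qftp natle natle (pairs (\<lambda>u. [index_map ?g u]) (\<lambda>u. [index_map ?g u]) Z)"
      by (rule same_qftp_mono)
  qed (use mem in auto)
  have "contrast l b A (f \<circ> s) (f \<circ> t) i = contrast l a A s t i" for i
    by (simp add: contrast_def params_def b gf comp_def)
  moreover have "interleaved (range f) r n (f \<circ> s) (f \<circ> t)"
  proof -
    have "(x, y) \<in> natle \<longleftrightarrow> x \<le> y" for x y by (simp add: natle_def)
    with il show ?thesis by (simp add: interleaved_def ltf rf)
  qed
  moreover have "l \<noteq> 3 \<longrightarrow> (\<forall>ts. Inr ts \<in> index_set n (range f) r \<longrightarrow> b (Inr ts) = [])"
    using nil mem unfolding b by fastforce
  ultimately show "gdiv l \<tau> C n m \<phi> A (range f) r"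
    using ib con unfolding gdiv_def by metis
qed

section \<open>Agreement of the encoding with the definitions of dividing\<close>

lemma tp_append_iff:
  assumes "set c \<subseteq> univ C" "set x \<subseteq> univ C" "set y \<subseteq> univ C" "B \<subseteq> univ C" "length x = length y"
  shows "tp \<tau> C (c @ x) B = tp \<tau> C (c @ y) B \<longleftrightarrow>
    elem \<tau> C C (Id_on (set c) \<union> (Id_on B \<union> set (zip x y)))"
proof -
  have "set (zip (c @ x) (c @ y)) \<union> Id_on B = Id_on (set c) \<union> (Id_on B \<union> set (zip x y))"
    by (simp add: set_zip_same Un_ac)
  then show ?thesis using assms by (subst tp_eq_iff) auto
qed

lemma place_Inl: "i < length us \<Longrightarrow> (Inl (us ! i), Inl i) \<in> place n us"
  unfolding place_def by (rule image_eqI[of _ _ "Inl i"]) auto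

text \<open>Two increasing lists of equal length have the same quantifier-free type, both being
  placed over the same positions.\<close>

lemma indisc_seq_of_indisc:
  fixes r :: "'i rel"
  assumes a: "indisc \<tau> C A n I r a" and r: "antisym r" and A: "A \<subseteq> univ C"
  shows "indisc_seq \<tau> C A I r (\<lambda>t. a (Inl t))"
  unfolding indisc_seq_def
proof (intro conjI ballI impI)
  fix t assume "t \<in> I"
  then show "a (Inl t) \<in> lists (univ C)" using indisc_univ[OF a, of "Inl t"] by auto
next
  fix us vs assume us: "us \<in> incr I r" and vs: "vs \<in> incr I r" and len: "length us = length vs"
  let ?us = "map Inl us :: ('i + 'i list) list" and ?vs = "map Inl vs :: ('i + 'i list) list"
  let ?Z = "set (zip ?us ?vs)"
  have "?Z \<subseteq> place n us O (place n vs)\<inverse>"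
  proof
    fix p assume "p \<in> ?Z"
    then obtain i where i: "i < length us" "p = (Inl (us ! i), Inl (vs ! i))"
      using len by (auto simp: in_set_zip)
    have "(Inl (us ! i), Inl i) \<in> place n us" "(Inl (vs ! i), Inl i) \<in> place n vs"
      using i(1) len by (auto intro: place_Inl)
    then show "p \<in> place n us O (place n vs)\<inverse>" using i(2) by auto
  qed
  then have s: "same_qftp r r ?Z"
    by (rule same_qftp_mono[OF same_qftp_comp[OF same_qftp_place[OF r us] same_qftp_converse[OF same_qftp_place[OF r vs]]]])
  have J: "?Z \<subseteq> index_set n I r \<times> index_set n I r"
    using len us vs by (subst in_lists_zip) (auto simp: incr_def)
  have U: "set (concat (map a ?us)) \<subseteq> univ C" "set (concat (map a ?vs)) \<subseteq> univ C"
  proof -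
    have "set (a (Inl x)) \<subseteq> univ C" if "x \<in> I" for x using indisc_univ[OF a, of "Inl x"] that by simp
    then show "set (concat (map a ?us)) \<subseteq> univ C" "set (concat (map a ?vs)) \<subseteq> univ C"
      using us vs by (auto simp: incr_def)
  qed
  have "\<forall>(u, v)\<in>?Z. length (a u) = length (a v)"
    using conjunct2[OF a[unfolded indisc_def], rule_format, OF J s] by blast
  then have z: "set (zip (concat (map a ?us)) (concat (map a ?vs))) = pairs a a ?Z \<and>
      length (concat (map a ?us)) = length (concat (map a ?vs))"
    using len by (intro set_zip_concat) auto
  have "tp \<tau> C (concat (map a ?us)) A = tp \<tau> C (concat (map a ?vs)) A"
    using indisc_elem[OF a J s] z
    unfolding tp_eq_iff[OF conjunct2[OF z] U A] by (simp only: Un_commute)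
  then show "tp \<tau> C (concat (map (\<lambda>t. a (Inl t)) us)) A = tp \<tau> C (concat (map (\<lambda>t. a (Inl t)) vs)) A"
    by (simp add: comp_def)
qed

text \<open>A \<open>same_qftp\<close> relation sends elements to elements and sequences to
  sequences. The empty tuples at sequences contribute nothing, and a finite part on elements is an
  order-preserving map, whose domain can be listed increasingly.\<close>

lemma indisc_of_indisc_seq:
  assumes b: "indisc_seq \<tau> C A I r b" and r: "linear_order_on I r" and A: "A \<subseteq> univ C"
  shows "indisc \<tau> C A n I r (case_sum b (\<lambda>_. []))"
proof -
  let ?J = "index_set n I r" and ?a = "case_sum b (\<lambda>_. [])"
  have bU: "set (b t) \<subseteq> univ C" if "t \<in> I" for t using b that unfolding indisc_seq_def by blast
  have tp: "tp \<tau> C (concat (map b us)) A = tp \<tau> C (concat (map b vs)) A"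
    if "us \<in> incr I r" "vs \<in> incr I r" "length us = length vs" for us vs
    using b that unfolding indisc_seq_def by blast
  have len: "length (b s) = length (b t)" if "s \<in> I" "t \<in> I" for s t
    using tp_eq_length[OF tp[of "[s]" "[t]"]] that by (simp add: incr_def)
  have image_Inl: "\<exists>t\<in>I. v = Inl t" if "Z \<subseteq> ?J \<times> ?J" "same_qftp r r Z" "(Inl s, v) \<in> Z" for Z s v
  proof -
    have "seq_length v = None" using same_qftp_seq_length[OF that(2,3)] by (simp add: seq_length_def)
    moreover have "v \<in> ?J" using that by auto
    ultimately show ?thesis by (cases v) (auto simp: seq_length_def)
  qed
  have image_Inr: "\<exists>ts. v = Inr ts" if "same_qftp r r Z" "(Inr us, v) \<in> Z" for Z us v
    using same_qftp_seq_length[OF that] by (cases v) (auto simp: seq_length_def)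
  show ?thesis
    unfolding indisc_def
  proof (intro conjI ballI allI impI)
    fix u assume "u \<in> ?J"
    then show "set (?a u) \<subseteq> univ C" using bU by (cases u) auto
  next
    fix Z assume Z: "Z \<subseteq> ?J \<times> ?J" "same_qftp r r Z"
    show "elem \<tau> C C (Id_on A \<union> pairs ?a ?a Z)"
    proof (rule elem_Id_on_pairs_finitary[OF A])
      fix us vs assume uv: "length us = length vs" "set (zip us vs) \<subseteq> Z"
      let ?Y = "set (zip us vs)"
      note Y = order_trans[OF uv(2) Z(1)] same_qftp_mono[OF Z(2) uv(2)]
      let ?S = "{s. Inl s \<in> fst ` ?Y}"
      have "finite (Inl -` (fst ` ?Y))" by (rule finite_vimageI) auto
      then have "finite ?S" by (simp add: vimage_def)
      moreover have SI: "?S \<subseteq> I"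
      proof
        fix s assume "s \<in> ?S"
        then obtain v where "(Inl s, v) \<in> ?Y" by auto
        then have "Inl s \<in> ?J" using Y(1) by blast
        then show "s \<in> I" by simp
      qed
      ultimately obtain xs where xs: "xs \<in> incr I r" "set xs = ?S" by (rule incr_listing[OF r])
      have "\<exists>t\<in>I. (Inl s, Inl t) \<in> ?Y" if "s \<in> ?S" for s
      proof -
        obtain v where "(Inl s, v) \<in> ?Y" using \<open>s \<in> ?S\<close> by auto
        then show ?thesis using image_Inl[OF Y, of s v] by blast
      qed
      then obtain f where f: "\<And>s. s \<in> ?S \<Longrightarrow> f s \<in> I \<and> (Inl s, Inl (f s)) \<in> ?Y" by metis
      have lt: "lt r (f x) (f y) \<longleftrightarrow> lt r x y" if "x \<in> ?S" "y \<in> ?S" for x y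
        using same_qftpD[OF Y(2) conjunct2[OF f[OF that(1)]] conjunct2[OF f[OF that(2)]]]
        by (simp add: pattern_def idx_less_def)
      let ?ys = "map f xs"
      have ys: "?ys \<in> incr I r"
      proof -
        have "sorted_wrt (\<lambda>x y. lt r (f x) (f y)) xs"
          by (rule sorted_wrt_mono_rel[of _ "lt r"]) (use xs lt in \<open>auto simp: incr_def\<close>)
        moreover have "f ` set xs \<subseteq> I" unfolding xs(2) using f by blast
        ultimately show ?thesis by (auto simp: incr_def sorted_wrt_map)
      qed
      have subI: "set xs \<subseteq> I" "set ?ys \<subseteq> I" using xs(1) ys by (auto simp: incr_def)
      have z: "set (zip (concat (map b xs)) (concat (map b ?ys))) = pairs b b (set (zip xs ?ys)) \<and>
          length (concat (map b xs)) = length (concat (map b ?ys))"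
      proof (rule set_zip_concat)
        show "\<forall>(u, v)\<in>set (zip xs ?ys). length (b u) = length (b v)"
        proof clarify
          fix u v assume "(u, v) \<in> set (zip xs ?ys)"
          then have "u \<in> set xs" "v \<in> set ?ys" by (auto dest: set_zip_leftD set_zip_rightD)
          then show "length (b u) = length (b v)" using subI by (intro len) blast+
        qed
      qed simp
      have U: "set (concat (map b xs)) \<subseteq> univ C" "set (concat (map b ?ys)) \<subseteq> univ C"
      proof -
        show "set (concat (map b xs)) \<subseteq> univ C" "set (concat (map b ?ys)) \<subseteq> univ C"
        proof -
          have "set (b x) \<subseteq> univ C" "set (b (f x)) \<subseteq> univ C" if "x \<in> set xs" for x
            using subI that by (auto intro!: bU)
          then show "set (concat (map b xs)) \<subseteq> univ C" "set (concat (map b ?ys)) \<subseteq> univ C"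
            by auto
        qed
      qed
      have "elem \<tau> C C (Id_on A \<union> pairs b b (set (zip xs ?ys)))"
        using tp[OF xs(1) ys] z unfolding tp_eq_iff[OF conjunct2[OF z] U A]
        by (simp add: Un_commute)
      moreover have "pairs ?a ?a ?Y \<subseteq> pairs b b (set (zip xs ?ys))"
      proof
        fix p assume "p \<in> pairs ?a ?a ?Y"
        then obtain u v where uv: "(u, v) \<in> ?Y" "p \<in> set (zip (?a u) (?a v))" by (auto simp: pairs_def)
        then obtain s where s: "u = Inl s" by (cases u) auto
        then have sS: "s \<in> ?S" using uv(1) by force
        have "v = Inl (f s)"
          using same_qftpD[OF Y(2) uv(1)[unfolded s] conjunct2[OF f[OF sS]]] by (simp add: pattern_def)
        moreover have "(s, f s) \<in> set (zip xs ?ys)" using sS xs(2) by (auto simp: zip_map2 zip_same_conv_map)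
        ultimately show "p \<in> pairs b b (set (zip xs ?ys))"
          using uv(2) s pairsI[of s "f s" "set (zip xs ?ys)" "fst p" "snd p" b b] by simp
      qed
      ultimately show "elem \<tau> C C (Id_on A \<union> pairs ?a ?a ?Y)" by (meson Un_mono elem_mono subset_refl)
    qed
    fix z assume z: "z \<in> Z"
    obtain u v where uv: "z = (u, v)" by force
    show "case z of (u, v) \<Rightarrow> length (?a u) = length (?a v)"
    proof (cases u)
      case (Inl s)
      with z uv have "(Inl s, v) \<in> Z" by simp
      from image_Inl[OF Z this] obtain t where t: "t \<in> I" "v = Inl t" by blast
      have "s \<in> I" using z uv Z(1) Inl by auto
      from len[OF this t(1)] show ?thesis using t(2) Inl uv by simp
    next
      case (Inr us)
      with z uv have "(Inr us, v) \<in> Z" by simp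
      from image_Inr[OF Z(2) this] obtain vs where "v = Inr vs" by blast
      then show ?thesis using Inr uv by simp
    qed
  qed
qed

lemma params_subset:
  assumes a: "indisc \<tau> C A n I r a" and il: "interleaved I r n s t" and r: "linear_order_on I r" and i: "i < n"
  shows "params l a s i \<subseteq> univ C"
proof -
  have "set (a (Inl (s j))) \<subseteq> univ C" if "j < i" for j
    using indisc_univ[OF a, of "Inl (s j)"] il that i by (auto simp: interleaved_def)
  moreover have "set (a (Inr (map s [0..<i]))) \<subseteq> univ C"
    by (rule indisc_univ[OF a map_sorted_Inr[OF il r i]])
  ultimately show ?thesis unfolding params_def by auto
qed

lemma indisc_Inl_length:
  "indisc \<tau> C A n I r a \<Longrightarrow> s \<in> I \<Longrightarrow> t \<in> I \<Longrightarrow> length (a (Inl s)) = length (a (Inl t))"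
  by (rule indisc_length)
    (auto simp: same_qftp_def pattern_def seq_length_def idx_less_def entries_def lt_def)

lemma tp_iff_contrast:
  assumes a: "indisc \<tau> C A n I r a" and il: "interleaved I r n s t" and r: "linear_order_on I r"
    and A: "A \<subseteq> univ C" and c: "c \<in> tuples C m" and i: "i < n"
  shows "tp \<tau> C (c @ a (Inl (s i))) (A \<union> params l a s i) = tp \<tau> C (c @ a (Inl (t i))) (A \<union> params l a s i)
    \<longleftrightarrow> elem \<tau> C C (Id_on (set c) \<union> contrast l a A s t i)"
proof -
  have st: "s i \<in> I" "t i \<in> I" using il i by (auto simp: interleaved_def)
  show ?thesis
    unfolding contrast_def
  proof (rule tp_append_iff)
    show "set c \<subseteq> univ C" using tuplesD[OF c] by simp
    show "set (a (Inl (s i))) \<subseteq> univ C" "set (a (Inl (t i))) \<subseteq> univ C"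
      using st by (auto intro!: indisc_univ[OF a])
    show "A \<union> params l a s i \<subseteq> univ C" using A params_subset[OF a il r i] by (rule Un_least)
    show "length (a (Inl (s i))) = length (a (Inl (t i)))" by (rule indisc_Inl_length[OF a st])
  qed
qed

text \<open>For \<open>l = 3\<close> this rests on \<open>indisc_family_iff\<close>; for the other
  two, an indiscernible sequence is the same as an indiscernible family that is empty at sequence
  indices.\<close>

lemma ict_divides_iff:
  fixes \<kappa> :: "'k rel" and C :: "('s, 'a) struc"
  assumes l: "l \<in> {1, 2, 3}" and A: "A \<subseteq> univ C"
  shows "ict_divides l \<tau> \<kappa> C n m {f} A \<longleftrightarrow> (\<exists>I r. index_order \<kappa> I r \<and> gdiv l \<tau> C n m f A I r)"
proof -
  have R: "c \<in> realizations C m {f} \<longleftrightarrow> c \<in> tuples C m \<and> psat C c f" for c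
    by (simp add: realizations_def)
  have main: "(\<forall>c\<in>realizations C m {f}. \<forall>i<n. tp \<tau> C (c @ a (Inl (s i))) (A \<union> params l a s i) \<noteq>
        tp \<tau> C (c @ a (Inl (t i))) (A \<union> params l a s i)) \<longleftrightarrow>
      (\<forall>c\<in>tuples C m. psat C c f \<longrightarrow> (\<forall>i<n. \<not> elem \<tau> C C (Id_on (set c) \<union> contrast l a A s t i)))"
    if "indisc \<tau> C A n I r a" "interleaved I r n s t" "index_order \<kappa> I r" for I r a s t
  proof -
    have "tp \<tau> C (c @ a (Inl (s i))) (A \<union> params l a s i) = tp \<tau> C (c @ a (Inl (t i))) (A \<union> params l a s i)
      \<longleftrightarrow> elem \<tau> C C (Id_on (set c) \<union> contrast l a A s t i)" if "c \<in> tuples C m" "i < n" for c i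
      by (rule tp_iff_contrast[OF \<open>indisc _ _ _ _ _ _ _\<close> \<open>interleaved _ _ _ _ _\<close> _ A that])
        (use \<open>index_order _ _ _\<close> in \<open>simp add: index_order_def\<close>)
    then show ?thesis by (auto simp: R)
  qed
  have gd: "(\<exists>I r. index_order \<kappa> I r \<and> gdiv l \<tau> C n m f A I r) \<longleftrightarrow>
      (\<exists>I r a s t. index_order \<kappa> I r \<and> indisc \<tau> C A n I r a \<and>
        (l \<noteq> 3 \<longrightarrow> (\<forall>ts. Inr ts \<in> index_set n I r \<longrightarrow> a (Inr ts) = [])) \<and> interleaved I r n s t \<and>
        (\<forall>c\<in>realizations C m {f}. \<forall>i<n. tp \<tau> C (c @ a (Inl (s i))) (A \<union> params l a s i) \<noteq>
        tp \<tau> C (c @ a (Inl (t i))) (A \<union> params l a s i)))" (is "?L \<longleftrightarrow> ?R")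
  proof
    assume ?L
    then obtain I r a s t where *: "index_order \<kappa> I r" "indisc \<tau> C A n I r a"
      "l \<noteq> 3 \<longrightarrow> (\<forall>ts. Inr ts \<in> index_set n I r \<longrightarrow> a (Inr ts) = [])" "interleaved I r n s t"
      "\<forall>c\<in>tuples C m. psat C c f \<longrightarrow> (\<forall>i<n. \<not> elem \<tau> C C (Id_on (set c) \<union> contrast l a A s t i))"
      unfolding gdiv_def by blast
    note ** = main[OF *(2,4,1), THEN iffD2, OF *(5)]
    show ?R by (rule exI[of _ I], rule exI[of _ r], rule exI[of _ a], rule exI[of _ s], rule exI[of _ t], intro conjI) (fact *(1) *(2) *(3) *(4) **)+
  next
    assume ?R
    then obtain I r a s t where *: "index_order \<kappa> I r" "indisc \<tau> C A n I r a"
      "l \<noteq> 3 \<longrightarrow> (\<forall>ts. Inr ts \<in> index_set n I r \<longrightarrow> a (Inr ts) = [])" "interleaved I r n s t"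
      "\<forall>c\<in>realizations C m {f}. \<forall>i<n. tp \<tau> C (c @ a (Inl (s i))) (A \<union> params l a s i) \<noteq>
        tp \<tau> C (c @ a (Inl (t i))) (A \<union> params l a s i)"
      by blast
    note ** = main[OF *(2,4,1), THEN iffD1, OF *(5)]
    have "gdiv l \<tau> C n m f A I r" unfolding gdiv_def
      by (rule exI[of _ a], rule exI[of _ s], rule exI[of _ t], intro conjI) (fact *(2) *(3) *(4) **)+
    with *(1) show ?L by blast
  qed
  have seq: "indisc_seq \<tau> C A I r b \<longleftrightarrow> (\<exists>a. indisc \<tau> C A n I r a \<and>
      (\<forall>ts. Inr ts \<in> index_set n I r \<longrightarrow> a (Inr ts) = []) \<and> b = (\<lambda>t. a (Inl t)))"
    if "index_order \<kappa> I r" for I r and b :: "'k \<Rightarrow> 'a list"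
  proof
    assume "indisc_seq \<tau> C A I r b"
    then have "indisc \<tau> C A n I r (case_sum b (\<lambda>_. []))"
      by (rule indisc_of_indisc_seq) (use that A in \<open>simp_all add: index_order_def\<close>)
    then show "\<exists>a. indisc \<tau> C A n I r a \<and>
      (\<forall>ts. Inr ts \<in> index_set n I r \<longrightarrow> a (Inr ts) = []) \<and> b = (\<lambda>t. a (Inl t))"
      by (intro exI[of _ "case_sum b (\<lambda>_. [])"]) simp
  next
    assume "\<exists>a. indisc \<tau> C A n I r a \<and>
      (\<forall>ts. Inr ts \<in> index_set n I r \<longrightarrow> a (Inr ts) = []) \<and> b = (\<lambda>t. a (Inl t))"
    then obtain a where a: "indisc \<tau> C A n I r a" "b = (\<lambda>t. a (Inl t))" by (elim exE conjE)
    have "linear_order_on I r" using that by (simp add: index_order_def)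
    then show "indisc_seq \<tau> C A I r b"
      unfolding a(2) by (intro indisc_seq_of_indisc[OF a(1) _ A] linear_orderD(1))
  qed
  show ?thesis
  proof (cases "l = 3")
    case True
    have A1: "ict_divides l \<tau> \<kappa> C n m {f} A \<longleftrightarrow> (\<exists>I r a s t. index_order \<kappa> I r \<and> indisc \<tau> C A n I r a \<and>
        interleaved I r n s t \<and>
        (\<forall>c\<in>realizations C m {f}. \<forall>i<n. tp \<tau> C (c @ a (Inl (s i))) (A \<union> params l a s i) \<noteq>
        tp \<tau> C (c @ a (Inl (t i))) (A \<union> params l a s i)))"
      unfolding ict_divides_def ict3_divides_def indisc_family_iff[OF A] using True by (simp add: params_def)
    show ?thesis unfolding A1 gd by (simp only: True simp_thms)
  next
    case False
    then have P: "params l a s i = (if l = 2 then \<Union>j<i. set (a (Inl (s j))) else {})"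
      for a :: "'k + 'k list \<Rightarrow> 'a list" and s i
      by (simp add: params_def)
    have A1: "ict_divides l \<tau> \<kappa> C n m {f} A \<longleftrightarrow> (\<exists>I r b s t. index_order \<kappa> I r \<and> indisc_seq \<tau> C A I r b \<and>
        interleaved I r n s t \<and> (\<forall>c\<in>realizations C m {f}. \<forall>i<n.
          tp \<tau> C (c @ b (s i)) (A \<union> (if l = 2 then \<Union>j<i. set (b (s j)) else {})) \<noteq>
          tp \<tau> C (c @ b (t i)) (A \<union> (if l = 2 then \<Union>j<i. set (b (s j)) else {}))))"
      (is "_ \<longleftrightarrow> ?X")
    proof (cases "l = 2")
      case True
      then show ?thesis by (simp add: ict_divides_def ict2_divides_def)
    next
      case nl: False
      with False l have "l = 1" by simp
      then show ?thesis by (simp add: ict_divides_def ict1_divides_def)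
    qed
    have A2: "?X \<longleftrightarrow> (\<exists>I r a s t. index_order \<kappa> I r \<and> indisc \<tau> C A n I r a \<and>
        (\<forall>ts. Inr ts \<in> index_set n I r \<longrightarrow> a (Inr ts) = []) \<and> interleaved I r n s t \<and>
        (\<forall>c\<in>realizations C m {f}. \<forall>i<n. tp \<tau> C (c @ a (Inl (s i))) (A \<union> params l a s i) \<noteq>
        tp \<tau> C (c @ a (Inl (t i))) (A \<union> params l a s i)))"
      (is "?L \<longleftrightarrow> ?R")
    proof
      assume ?L
      then obtain I r b s t where *: "index_order \<kappa> I r" "indisc_seq \<tau> C A I r b" "interleaved I r n s t"
        "\<forall>c\<in>realizations C m {f}. \<forall>i<n.
          tp \<tau> C (c @ b (s i)) (A \<union> (if l = 2 then \<Union>j<i. set (b (s j)) else {})) \<noteq>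
          tp \<tau> C (c @ b (t i)) (A \<union> (if l = 2 then \<Union>j<i. set (b (s j)) else {}))" by blast
      then obtain a where a: "indisc \<tau> C A n I r a" "\<forall>ts. Inr ts \<in> index_set n I r \<longrightarrow> a (Inr ts) = []"
        "b = (\<lambda>t. a (Inl t))" using seq[OF *(1), THEN iffD1, OF *(2)] by (elim exE conjE)
      have "\<forall>c\<in>realizations C m {f}. \<forall>i<n. tp \<tau> C (c @ a (Inl (s i))) (A \<union> params l a s i) \<noteq>
        tp \<tau> C (c @ a (Inl (t i))) (A \<union> params l a s i)"
        using *(4) unfolding a(3) P .
      note ** = this
      show ?R by (rule exI[of _ I], rule exI[of _ r], rule exI[of _ a], rule exI[of _ s], rule exI[of _ t], intro conjI) (fact *(1) a(1,2) *(3) **)+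
    next
      assume ?R
      then obtain I r a s t where *: "index_order \<kappa> I r" "indisc \<tau> C A n I r a"
        "\<forall>ts. Inr ts \<in> index_set n I r \<longrightarrow> a (Inr ts) = []" "interleaved I r n s t"
        "\<forall>c\<in>realizations C m {f}. \<forall>i<n. tp \<tau> C (c @ a (Inl (s i))) (A \<union> params l a s i) \<noteq>
        tp \<tau> C (c @ a (Inl (t i))) (A \<union> params l a s i)" by blast
      have **: "indisc_seq \<tau> C A I r (\<lambda>t. a (Inl t))"
        by (rule seq[OF *(1), THEN iffD2], rule exI[of _ a], intro conjI) (fact *(2) *(3) refl)+
      have ***: "\<forall>c\<in>realizations C m {f}. \<forall>i<n.
          tp \<tau> C (c @ a (Inl (s i))) (A \<union> (if l = 2 then \<Union>j<i. set (a (Inl (s j))) else {})) \<noteq>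
          tp \<tau> C (c @ a (Inl (t i))) (A \<union> (if l = 2 then \<Union>j<i. set (a (Inl (s j))) else {}))"
        using *(5) unfolding P .
      show ?L by (rule exI[of _ I], rule exI[of _ r], rule exI[of _ "\<lambda>t. a (Inl t)"], rule exI[of _ s], rule exI[of _ t], intro conjI) (fact *(1) ** *(4) ***)+
    qed
    show ?thesis unfolding A1 A2 gd by (simp only: False simp_thms)
  qed
qed

text \<open>Since \<open>\<kappa>\<close> is uncountable, omega embeds as a small index order into
  the type of \<open>\<kappa>\<close>; conversely \<open>ndiv_of_gdiv\<close> brings every index
  order to omega. The right-hand side no longer depends on \<open>\<kappa>\<close>.\<close>

lemma ict_divides_ndiv:
  fixes \<kappa> :: "'k rel" and C :: "('s, 'a) struc"
  assumes l: "l \<in> {1, 2, 3}" and \<kappa>: "natLeq <o \<kappa>"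
    and C: "fsat \<tau> C" and A: "finite A" "A \<subseteq> univ C"
  shows "ict_divides l \<tau> \<kappa> C n m {f} A \<longleftrightarrow> ndiv l \<tau> C n m f A"
proof
  assume "ict_divides l \<tau> \<kappa> C n m {f} A"
  then obtain I r where Ir: "index_order \<kappa> I r" "gdiv l \<tau> C n m f A I r"
    using ict_divides_iff[OF l A(2)] by blast
  then show "ndiv l \<tau> C n m f A"
    by (intro ndiv_of_gdiv[OF Ir(2) _ _ C A]) (simp_all add: index_order_def)
next
  assume nd: "ndiv l \<tau> C n m f A"
  have "|Field natLeq| \<le>o |Field \<kappa>|" by (rule card_of_mono2[OF ordLess_imp_ordLeq[OF \<kappa>]])
  then obtain h :: "nat \<Rightarrow> 'k" where h: "inj h"
    unfolding Field_natLeq card_of_ordLeq[symmetric] by blast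
  note g = gdiv_of_ndiv[OF h nd]
  have "|range h| \<le>o |UNIV :: nat set|" by (rule card_of_image)
  then have "|range h| <o \<kappa>"
    using card_of_nat \<kappa> by (meson ordIso_ordLess_trans ordLeq_ordLess_trans)
  moreover have "infinite (range h)" using h by (simp add: range_inj_infinite)
  ultimately have "index_order \<kappa> (range h) {(h x, h y) |x y. x \<le> y}"
    using g(2) by (simp add: index_order_def)
  with g(1) show "ict_divides l \<tau> \<kappa> C n m {f} A"
    unfolding ict_divides_iff[OF l A(2)] by blast
qed

section \<open>Transfer of dividing and forking between elementarily equivalent structures\<close>

lemma Id_on_conj_subset:
  assumes "\<And>x. x \<in> X \<Longrightarrow> (x, h x) \<in> H" "Id_on (h ` X) \<subseteq> K"
  shows "Id_on X \<subseteq> H O K O H\<inverse>"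
proof
  fix p assume "p \<in> Id_on X"
  then obtain x where x: "x \<in> X" "p = (x, x)" by auto
  have "(h x, h x) \<in> K" using assms(2) x(1) by blast
  with assms(1)[OF x(1)] x(2) show "p \<in> H O K O H\<inverse>" by blast
qed

lemma zip_conj_subset:
  assumes "\<And>x. x \<in> set xs \<union> set ys \<Longrightarrow> (x, h x) \<in> H" "set (zip (map h xs) (map h ys)) \<subseteq> K"
  shows "set (zip xs ys) \<subseteq> H O K O H\<inverse>"
proof
  fix p assume p: "p \<in> set (zip xs ys)"
  obtain x y where xy: "p = (x, y)" by force
  have "(h x, h y) \<in> set (zip (map h xs) (map h ys))" using p xy by (auto simp: zip_map_map)
  then have "(h x, h y) \<in> K" using assms(2) by blast
  moreover have "(x, h x) \<in> H" "(y, h y) \<in> H"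
    using assms(1) p xy by (auto dest: set_zip_leftD set_zip_rightD)
  ultimately show "p \<in> H O K O H\<inverse>" using xy by blast
qed

text \<open>The countable family is carried to \<open>D\<close> along with \<open>A\<close> and
  \<open>d\<close>. If a realization in \<open>D\<close> saw no difference at some stage, it could
  be pulled back to a realization in \<open>C\<close> with the same defect.\<close>

lemma ndiv_transfer:
  assumes nd: "ndiv l \<tau> C n m (\<phi>, d) A" and g: "elem \<tau> C D (graph g (A \<union> set d))"
    and A: "finite A" and \<phi>: "pfm_in \<tau> (univ C) m (\<phi>, d)"
    and C: "fsat \<tau> C" and D: "fsat \<tau> D"
  shows "ndiv l \<tau> D n m (\<phi>, map g d) (g ` A)"
proof -
  let ?J = "index_set n UNIV natle"
  obtain a s t where a: "indisc \<tau> C A n UNIV natle a"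
    and nil: "\<And>ts. l \<noteq> 3 \<Longrightarrow> Inr ts \<in> ?J \<Longrightarrow> a (Inr ts) = []"
    and il: "interleaved UNIV natle n s t"
    and con: "\<And>c i. c \<in> tuples C m \<Longrightarrow> psat C c (\<phi>, d) \<Longrightarrow> i < n \<Longrightarrow>
      \<not> elem \<tau> C C (Id_on (set c) \<union> contrast l a A s t i)"
    using nd unfolding gdiv_def by blast
  define X where "X = (A \<union> set d) \<union> (\<Union>u\<in>?J. set (a u))"
  have AU: "A \<union> set d \<subseteq> univ C" using elem_univ[OF g] by auto
  have X: "countable X" "X \<subseteq> univ C"
  proof -
    have "countable (\<Union>u\<in>?J. set (a u))" by (intro countable_UN countableI_type) (auto intro: countable_finite)
    then show "countable X" unfolding X_def using A by (auto intro: countable_finite)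
    show "X \<subseteq> univ C" unfolding X_def using AU indisc_univ[OF a] by blast
  qed
  obtain h where h: "elem \<tau> C D (graph g (A \<union> set d) \<union> graph h X)"
    using elem_extend_countable[OF g _ D X] A by auto
  have hg: "h x = g x" if "x \<in> A \<union> set d" for x
    by (rule elem_unique[OF h]) (use that X_def in auto)
  have hA: "h ` A = g ` A" and hd: "map h d = map g d" using hg by auto
  have hX: "elem \<tau> C D (graph h X)" by (rule elem_mono[OF h]) simp
  define b where "b = (\<lambda>u. map h (a u))"
  have b: "indisc \<tau> D (g ` A) n UNIV natle b"
    unfolding hA[symmetric] b_def by (rule indisc_move[OF a hX]) (auto simp: X_def)
  have pb: "params l b s i = h ` params l a s i" for i
    by (simp add: params_def b_def image_UN)
  have "\<not> elem \<tau> D D (Id_on (set c) \<union> contrast l b (g ` A) s t i)"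
    if c: "c \<in> tuples D m" and sc: "psat D c (\<phi>, map g d)" and i: "i < n" for c i
  proof
    assume E: "elem \<tau> D D (Id_on (set c) \<union> contrast l b (g ` A) s t i)"
    \<comment> \<open>Pulling back extends a finite relation, so only the part of \<open>X\<close>
      that matters at stage \<open>i\<close> is kept.\<close>
    define Y where "Y = A \<union> set d \<union> params l a s i \<union> set (a (Inl (s i))) \<union> set (a (Inl (t i)))"
    have "params l a s i \<subseteq> X"
    proof -
      have "set (a (Inl (s j))) \<subseteq> X" for j unfolding X_def by auto
      moreover have "set (a (Inr (map s [0..<i]))) \<subseteq> X"
        using map_sorted_Inr[OF il linear_natle i] unfolding X_def by blast
      ultimately show ?thesis unfolding params_def by auto
    qed
    moreover have "set (a (Inl k)) \<subseteq> X" for k unfolding X_def by auto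
    moreover have "A \<subseteq> X" "set d \<subseteq> X" unfolding X_def by auto
    ultimately have YX: "Y \<subseteq> X" unfolding Y_def by blast
    have "finite (params l a s i)" by (simp add: params_def)
    then have finY: "finite Y" using A by (simp add: Y_def)
    have H: "elem \<tau> D C ((graph h Y)\<inverse>)"
      by (rule elem_converse[OF elem_mono[OF hX]]) (use YX in blast)
    obtain k where k: "elem \<tau> D C ((graph h Y)\<inverse> \<union> graph k (set c))"
      using elem_extend_countable[OF H _ C countable_finite] finY tuplesD[OF c] by auto
    let ?K = "(graph h Y)\<inverse> \<union> graph k (set c)"
    let ?c = "map k c"
    have kc: "?c \<in> tuples C m"
      using elem_univ[OF k] tuplesD[OF c] by (intro tuplesI) auto
    have "sat D (c @ map g d) \<phi> \<longleftrightarrow> sat C (?c @ d) \<phi>"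
    proof (rule elem_sat_zip[OF k])
      have "set (zip c ?c) = graph k (set c)" by (simp add: zip_map2 zip_same_conv_map)
      moreover have "set (zip (map h d) d) = (graph h (set d))\<inverse>"
        by (auto simp: zip_map1 zip_same_conv_map)
      moreover have "set d \<subseteq> Y" by (auto simp: Y_def)
      ultimately show "set (zip (c @ map g d) (?c @ d)) \<subseteq> ?K" unfolding hd[symmetric] by auto
      show "fm_in \<tau> (length (c @ map g d)) \<phi>" using \<phi> tuplesD[OF c] by (simp add: pfm_in_def)
    qed simp
    then have "psat C ?c (\<phi>, d)" using sc by (simp add: psat_def)
    from con[OF kc this i] have "\<not> elem \<tau> C C (Id_on (set ?c) \<union> contrast l a A s t i)" .
    moreover have "elem \<tau> C C (?K\<inverse> O (Id_on (set c) \<union> contrast l b (g ` A) s t i) O ?K)"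
      by (intro elem_comp[OF elem_converse[OF k]] elem_comp[OF E k])
    moreover have "Id_on (set ?c) \<subseteq> ?K\<inverse> O (Id_on (set c) \<union> contrast l b (g ` A) s t i) O ?K"
      by force
    moreover have "contrast l a A s t i \<subseteq> ?K\<inverse> O (Id_on (set c) \<union> contrast l b (g ` A) s t i) O ?K"
    proof -
      have K: "(x, h x) \<in> ?K\<inverse>" if "x \<in> Y" for x using that by blast
      have "Id_on (A \<union> params l a s i) \<subseteq> ?K\<inverse> O (Id_on (set c) \<union> contrast l b (g ` A) s t i) O (?K\<inverse>)\<inverse>"
      proof (rule Id_on_conj_subset)
        show "(x, h x) \<in> ?K\<inverse>" if "x \<in> A \<union> params l a s i" for x
          using that by (intro K) (auto simp: Y_def)
        show "Id_on (h ` (A \<union> params l a s i)) \<subseteq> Id_on (set c) \<union> contrast l b (g ` A) s t i"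
          unfolding image_Un hA pb[symmetric] contrast_def by blast
      qed
      moreover have "set (zip (a (Inl (s i))) (a (Inl (t i)))) \<subseteq>
          ?K\<inverse> O (Id_on (set c) \<union> contrast l b (g ` A) s t i) O (?K\<inverse>)\<inverse>"
      proof (rule zip_conj_subset)
        show "(x, h x) \<in> ?K\<inverse>" if "x \<in> set (a (Inl (s i))) \<union> set (a (Inl (t i)))" for x
          using that by (intro K) (auto simp: Y_def)
        show "set (zip (map h (a (Inl (s i)))) (map h (a (Inl (t i))))) \<subseteq>
            Id_on (set c) \<union> contrast l b (g ` A) s t i"
          unfolding contrast_def b_def by blast
      qed
      ultimately show ?thesis unfolding contrast_def[of l a] converse_converse by (rule Un_least)
    qed
    ultimately show False by (meson Un_least elem_mono)
  qed
  moreover have "l \<noteq> 3 \<longrightarrow> (\<forall>ts. Inr ts \<in> ?J \<longrightarrow> b (Inr ts) = [])"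
    using nil by (simp add: b_def)
  ultimately show ?thesis using b il unfolding gdiv_def by blast
qed

text \<open>Forking over \<open>A\<close> of the type of \<open>c\<close> over \<open>B\<close>,
  with compactness already carried out: having the type of \<open>c\<close> over a finite
  \<open>b\<close> suffices to be covered.\<close>

definition nfork :: "nat \<Rightarrow> 's vocab \<Rightarrow> ('s, 'a) struc \<Rightarrow> nat \<Rightarrow> nat \<Rightarrow> 'a list \<Rightarrow> 'a set \<Rightarrow> 'a set \<Rightarrow> bool" where
  "nfork l \<tau> C n m c B A \<longleftrightarrow> (\<exists>b F. finite b \<and> b \<subseteq> B \<and> finite F \<and>
     (\<forall>f\<in>F. pfm_in \<tau> (univ C) m f \<and> ndiv l \<tau> C n m f A) \<and>
     (\<forall>c'\<in>tuples C m. elem \<tau> C C (set (zip c c') \<union> Id_on b) \<longrightarrow> (\<exists>f\<in>F. psat C c' f)))"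

text \<open>Failure of strong dependence witnessed by a complete type over a countable set, so that
  it involves no cardinal and can be compared between models.\<close>

definition nonsd :: "nat \<Rightarrow> 's vocab \<Rightarrow> ('s, 'a) struc \<Rightarrow> bool" where
  "nonsd l \<tau> C \<longleftrightarrow> (\<exists>m c B. c \<in> tuples C m \<and> countable B \<and> B \<subseteq> univ C \<and>
     (\<forall>n A. finite A \<and> A \<subseteq> B \<longrightarrow> nfork l \<tau> C n m c B A))"

text \<open>One map carries \<open>c\<close> and the countable set \<open>B\<close> to
  \<open>D\<close>. Each instance of forking is then transferred by a finite restriction of this
  map, extended to the parameters of the forking formulas.\<close>

lemma nonsd_transfer:
  assumes ns: "nonsd l \<tau> C" and C: "fsat \<tau> C" and D: "fsat \<tau> D" and eq: "elem \<tau> C D {}"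
  shows "nonsd l \<tau> D"
proof -
  from ns obtain m c B where mcB: "c \<in> tuples C m \<and> countable B \<and> B \<subseteq> univ C \<and>
     (\<forall>n A. finite A \<and> A \<subseteq> B \<longrightarrow> nfork l \<tau> C n m c B A)"
    unfolding nonsd_def by (elim exE)
  then have c: "c \<in> tuples C m" and B: "countable B" "B \<subseteq> univ C" by simp_all
  have fk: "nfork l \<tau> C n m c B A" if "finite A" "A \<subseteq> B" for n A
    using mcB that by (elim conjE) simp
  have cX: "countable (set c \<union> B)" "set c \<union> B \<subseteq> univ C"
    using B tuplesD[OF c] by (auto intro: countable_finite)
  obtain g where "elem \<tau> C D ({} \<union> graph g (set c \<union> B))"
    using elem_extend_countable[OF eq _ D cX] by auto
  then have g: "elem \<tau> C D (graph g (set c \<union> B))" by simp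
  have gc: "map g c \<in> tuples D m" using elem_univ[OF g] tuplesD[OF c] by (intro tuplesI) auto
  have gB: "countable (g ` B)" "g ` B \<subseteq> univ D" using B elem_univ[OF g] by auto
  have "nfork l \<tau> D n m (map g c) (g ` B) A1" if A1: "finite A1" "A1 \<subseteq> g ` B" for n A1
  proof -
    obtain A where A: "A \<subseteq> B" "finite A" "A1 = g ` A" using finite_subset_image[OF A1] by blast
    obtain b F where bF: "finite b" "b \<subseteq> B" "finite F"
      "\<And>f. f \<in> F \<Longrightarrow> pfm_in \<tau> (univ C) m f \<and> ndiv l \<tau> C n m f A"
      "\<And>c'. c' \<in> tuples C m \<Longrightarrow> elem \<tau> C C (set (zip c c') \<union> Id_on b) \<Longrightarrow> \<exists>f\<in>F. psat C c' f"
      using fk[OF A(2,1), of n] unfolding nfork_def by blast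
    \<comment> \<open>The forking formulas may have parameters outside \<open>B\<close>, on which
      nothing is known about \<open>g\<close>.\<close>
    define Z where "Z = (\<Union>f\<in>F. set (snd f))"
    have Z: "finite Z" "Z \<subseteq> univ C"
      using bF(3,4) by (auto simp: Z_def pfm_in_def split: prod.splits) blast
    let ?P = "graph g (set c \<union> b \<union> A)"
    have P: "elem \<tau> C D ?P" by (rule elem_mono[OF g]) (use bF(2) A(1) in blast)
    have "countable (set c \<union> b \<union> A \<union> Z)" "finite ?P"
      using bF(1) A(2) Z(1) by (auto intro: countable_finite)
    moreover have "set c \<union> b \<union> A \<union> Z \<subseteq> univ C"
      using bF(2) A(1) B(2) Z(2) tuplesD[OF c] by blast
    ultimately obtain h where h: "elem \<tau> C D (?P \<union> graph h (set c \<union> b \<union> A \<union> Z))"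
      using elem_extend_countable[OF P _ D] by blast
    have hg: "h x = g x" if "x \<in> set c \<union> b \<union> A" for x
      by (rule elem_unique[OF h]) (use that in auto)
    have hh: "elem \<tau> C D (graph h (set c \<union> b \<union> A \<union> Z))" by (rule elem_mono[OF h]) simp
    define G where "G = (\<lambda>(\<phi>, d). (\<phi>, map h d)) ` F"
    have "pfm_in \<tau> (univ D) m f \<and> ndiv l \<tau> D n m f A1" if "f \<in> G" for f
    proof -
      obtain \<phi> d where fd: "(\<phi>, d) \<in> F" "f = (\<phi>, map h d)"
        using \<open>f \<in> G\<close> by (auto simp: G_def)
      have d: "set d \<subseteq> Z" using fd(1) by (force simp: Z_def)
      have "ndiv l \<tau> D n m (\<phi>, map h d) (h ` A)"
        by (rule ndiv_transfer[OF conjunct2[OF bF(4)[OF fd(1)]] elem_mono[OF hh] A(2) conjunct1[OF bF(4)[OF fd(1)]] C D])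
          (use d in blast)
      moreover have "h ` A = A1" using hg A(3) by auto
      moreover have "h ` set d \<subseteq> univ D" using elem_univ[OF hh] d by auto
      ultimately show ?thesis using bF(4)[OF fd(1)] fd(2) by (auto simp: pfm_in_def)
    qed
    moreover have "\<exists>f\<in>G. psat D c' f"
      if c': "c' \<in> tuples D m" and E: "elem \<tau> D D (set (zip (map g c) c') \<union> Id_on (g ` b))" for c'
    proof -
      let ?H = "(graph h (b \<union> Z))\<inverse>"
      have H: "elem \<tau> D C ?H" by (rule elem_converse[OF elem_mono[OF hh]]) blast
      obtain k where k: "elem \<tau> D C (?H \<union> graph k (set c'))"
        using elem_extend_countable[OF H _ C countable_finite] tuplesD[OF c'] bF(1) Z(1) by auto
      let ?K = "?H \<union> graph k (set c')" and ?E = "set (zip (map g c) c') \<union> Id_on (g ` b)"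
      have kc: "map k c' \<in> tuples C m" using elem_univ[OF k] tuplesD[OF c'] by (intro tuplesI) auto
      \<comment> \<open>The chain from \<open>c\<close> to its image, to \<open>c'\<close> and to
        the pullback of \<open>c'\<close> shows that the pullback has the type of \<open>c\<close>
        over \<open>b\<close>, where the cover in \<open>C\<close> applies.\<close>
      have "elem \<tau> C C (graph g (set c \<union> b \<union> A) O (?E O ?K))"
        by (intro elem_comp[OF P] elem_comp[OF E k])
      moreover have "set (zip c (map k c')) \<union> Id_on b \<subseteq> graph g (set c \<union> b \<union> A) O (?E O ?K)"
      proof (rule Un_least)
        show "set (zip c (map k c')) \<subseteq> graph g (set c \<union> b \<union> A) O (?E O ?K)"
        proof (rule subrelI)
          fix x y assume "(x, y) \<in> set (zip c (map k c'))"
          then obtain z where z: "(x, z) \<in> set (zip c c')" "y = k z" by (auto simp: zip_map2)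
          then have "x \<in> set c" "z \<in> set c'" by (auto dest: set_zip_leftD set_zip_rightD)
          moreover have "(g x, z) \<in> ?E" using z(1) by (auto simp: zip_map1)
          ultimately show "(x, y) \<in> graph g (set c \<union> b \<union> A) O (?E O ?K)" using z(2) by blast
        qed
        show "Id_on b \<subseteq> graph g (set c \<union> b \<union> A) O (?E O ?K)"
        proof
          fix p assume "p \<in> Id_on b"
          then obtain x where x: "x \<in> b" "p = (x, x)" by auto
          have "h x = g x" using x(1) by (intro hg) auto
          moreover have "(h x, x) \<in> ?K" using x(1) by auto
          ultimately have "(g x, x) \<in> ?K" by simp
          moreover have "(x, g x) \<in> graph g (set c \<union> b \<union> A)" "(g x, g x) \<in> ?E" using x(1) by auto
          ultimately have "(x, x) \<in> graph g (set c \<union> b \<union> A) O (?E O ?K)" by (intro relcompI)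
          then show "p \<in> graph g (set c \<union> b \<union> A) O (?E O ?K)" unfolding x(2) .
        qed
      qed
      ultimately have "elem \<tau> C C (set (zip c (map k c')) \<union> Id_on b)" by (rule elem_mono)
      from bF(5)[OF kc this] obtain \<phi> d where f: "(\<phi>, d) \<in> F" "sat C (map k c' @ d) \<phi>"
        by (auto simp: psat_def)
      have d: "set d \<subseteq> Z" using f(1) by (force simp: Z_def)
      have "sat D (c' @ map h d) \<phi> \<longleftrightarrow> sat C (map k c' @ d) \<phi>"
      proof (rule elem_sat_zip[OF k])
        have "set (zip c' (map k c')) = graph k (set c')" by (simp add: zip_map2 zip_same_conv_map)
        moreover have "set (zip (map h d) d) = (graph h (set d))\<inverse>"
          by (auto simp: zip_map1 zip_same_conv_map)
        ultimately show "set (zip (c' @ map h d) (map k c' @ d)) \<subseteq> ?K" using d by auto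
        show "fm_in \<tau> (length (c' @ map h d)) \<phi>"
          using bF(4)[OF f(1)] tuplesD[OF c'] by (simp add: pfm_in_def)
      qed simp
      with f have "psat D c' (\<phi>, map h d)" by (simp add: psat_def)
      moreover have "(\<phi>, map h d) \<in> G" using f(1) by (force simp: G_def)
      ultimately show ?thesis by blast
    qed
    moreover have "finite G" using bF(3) by (simp add: G_def)
    moreover have "finite (g ` b)" "g ` b \<subseteq> g ` B" using bF(1,2) by auto
    ultimately show ?thesis unfolding nfork_def by blast
  qed
  with gc gB show ?thesis
    unfolding nonsd_def by (intro exI[of _ m] exI[of _ "map g c"] exI[of _ "g ` B"]) simp
qed

section \<open>A description of strong dependence without \<open>\<kappa>\<close>\<close>

lemma fsat_if_saturated:
  assumes "saturated \<tau> \<kappa> C" "natLeq <o \<kappa>" shows "fsat \<tau> C"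
  unfolding fsat_def
proof (intro allI impI)
  fix m p assume p: "is_type \<tau> C m p \<and> finite (Dom p)"
  then have "|Dom p| <o natLeq" by (simp add: finite_iff_ordLess_natLeq)
  then have "|Dom p| <o \<kappa>" using assms(2) by (rule ordLess_transitive)
  with assms(1) p show "realizations C m p \<noteq> {}" by (simp add: saturated_def)
qed

lemma countable_ordLess:
  assumes "countable B" "natLeq <o \<kappa>" shows "|B| <o \<kappa>"
proof -
  obtain f :: "'a \<Rightarrow> nat" where "inj_on f B" using assms(1) by (rule countableE)
  then have "|B| \<le>o |UNIV :: nat set|" using card_of_ordLeq[of B "UNIV :: nat set"] by auto
  then have "|B| \<le>o natLeq" using card_of_nat by (rule ordLeq_ordIso_trans)
  then show ?thesis using assms(2) by (rule ordLeq_ordLess_trans)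
qed

text \<open>Closing off in omega steps under the countably many finitary operations
  \<open>g n\<close>; a countable set has only countably many finite subsets.\<close>

lemma countable_closure:
  assumes g: "\<And>n A. finite A \<Longrightarrow> A \<subseteq> B0 \<Longrightarrow> finite (g n A) \<and> g n A \<subseteq> B0"
  obtains B where "countable B" "B \<subseteq> B0" "\<And>(n :: nat) A. finite A \<Longrightarrow> A \<subseteq> B \<Longrightarrow> g n A \<subseteq> B"
proof -
  define S where "S = (\<lambda>B. B \<union> (\<Union>n. \<Union>A\<in>{A. finite A \<and> A \<subseteq> B}. g n A))"
  define T where "T = (\<lambda>k. (S ^^ k) {})"
  have T: "countable (T k) \<and> T k \<subseteq> B0" for k
  proof (induction k)
    case (Suc k)
    have "countable {A. finite A \<and> A \<subseteq> T k}"
      using countable_Collect_finite_subset[of "T k"] Suc by simp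
    moreover have "countable (g n A)" if "A \<in> {A. finite A \<and> A \<subseteq> T k}" for n A
    proof -
      have "finite A" "A \<subseteq> B0" using that Suc by auto
      then show ?thesis using g by (simp add: countable_finite)
    qed
    ultimately have "countable (S (T k))" unfolding S_def using Suc
      by (intro countable_Un countable_UN countableI_type) auto
    moreover have "S (T k) \<subseteq> B0"
    proof -
      have "g n A \<subseteq> B0" if "finite A" "A \<subseteq> T k" for n A using g[of A n] that Suc by auto
      then show ?thesis using Suc unfolding S_def by blast
    qed
    ultimately show ?case by (simp add: T_def)
  qed (simp add: T_def)
  have inc: "i \<le> j \<Longrightarrow> T i \<subseteq> T j" for i j
    by (rule lift_Suc_mono_le[of T]) (auto simp: T_def S_def)
  have "g n A \<subseteq> (\<Union>k. T k)" if A: "finite A" "A \<subseteq> (\<Union>k. T k)" for n A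
  proof -
    have "\<exists>k. A \<subseteq> T k" using A
    proof (induction rule: finite_induct)
      case (insert x A)
      then obtain i j where "A \<subseteq> T i" "x \<in> T j" by auto
      then have "insert x A \<subseteq> T (max i j)" using inc[of i "max i j"] inc[of j "max i j"] by auto
      then show ?case by blast
    qed auto
    then obtain k where "A \<subseteq> T k" by blast
    then have "g n A \<subseteq> T (Suc k)" using A(1) by (auto simp: T_def S_def)
    then show ?thesis by blast
  qed
  moreover have "countable (\<Union>k. T k)" "(\<Union>k. T k) \<subseteq> B0" using T by auto
  ultimately show thesis by (intro that[of "\<Union>k. T k"])
qed

lemma psat_Neg: "psat C c (Neg \<phi>, d) \<longleftrightarrow> \<not> psat C c (\<phi>, d)"
  by (simp add: psat_def)

lemma Dom_tp:
  assumes "B \<subseteq> univ C" shows "Dom (tp \<tau> C c B) = B"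
proof
  show "Dom (tp \<tau> C c B) \<subseteq> B" by (auto simp: Dom_def tp_def pfm_in_def)
  show "B \<subseteq> Dom (tp \<tau> C c B)"
  proof
    fix b assume "b \<in> B"
    \<comment> \<open>\<open>Dom\<close> collects listed parameters whether or not the formula
      mentions them, so a trivially true formula suffices.\<close>
    then have "(Eq 0 0, [b]) \<in> tp \<tau> C c B" by (simp add: tp_def pfm_in_def psat_def)
    then show "b \<in> Dom (tp \<tau> C c B)" by (force simp: Dom_def)
  qed
qed

lemma realizations_tp:
  assumes c: "c \<in> tuples C m" and c': "c' \<in> tuples C m" and B: "B \<subseteq> univ C"
    and r: "\<And>f. f \<in> tp \<tau> C c B \<Longrightarrow> psat C c' f"
  shows "elem \<tau> C C (set (zip c c') \<union> Id_on B)"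
proof -
  have len: "length c = length c'" using tuplesD[OF c] tuplesD[OF c'] by simp
  have "psat C c (\<phi>, d) \<longleftrightarrow> psat C c' (\<phi>, d)" if f: "pfm_in \<tau> B (length c) (\<phi>, d)" for \<phi> d
  proof -
    have "pfm_in \<tau> B (length c) (Neg \<phi>, d)" using f by (simp add: pfm_in_def)
    then show ?thesis using f r[of "(\<phi>, d)"] r[of "(Neg \<phi>, d)"] by (auto simp: tp_def psat_Neg)
  qed
  then have "tp \<tau> C c B = tp \<tau> C c' B" using len by (auto simp: tp_def)
  then show ?thesis using tp_eq_iff[OF len] tuplesD[OF c] tuplesD[OF c'] B by blast
qed

lemma elem_psat:
  assumes E: "elem \<tau> C C (set (zip c c') \<union> Id_on b)" and len: "length c = length c'"
    and f: "pfm_in \<tau> b (length c) f"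
  shows "psat C c f \<longleftrightarrow> psat C c' f"
proof -
  obtain \<phi> d where fd: "f = (\<phi>, d)" by force
  have "sat C (c @ d) \<phi> \<longleftrightarrow> sat C (c' @ d) \<phi>"
    by (rule elem_sat_zip[OF E]) (use f fd len in \<open>auto simp: pfm_in_def set_zip_same\<close>)
  then show ?thesis by (simp add: fd psat_def)
qed

text \<open>If a type \<open>p\<close> is a counterexample, so is the type over \<open>Dom p\<close>
  of a realization \<open>c\<close> of it. Saturation makes each forking cover depend on a finite
  \<open>b\<close>, and closing off under the choice of \<open>b\<close> yields a countable
  \<open>B\<close>. Conversely the type of \<open>c\<close> over a countable \<open>B\<close> is
  itself a counterexample, countable sets being small.\<close>

lemma strongly_dependent_iff:
  fixes \<kappa> :: "'k rel" and C :: "('s, 'a) struc"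
  assumes l: "l \<in> {1, 2, 3}" and \<kappa>: "natLeq <o \<kappa>" "Card_order \<kappa>" and sat: "saturated \<tau> \<kappa> C"
  shows "strongly_dependent l \<tau> \<kappa> C \<longleftrightarrow> \<not> nonsd l \<tau> C"
proof -
  have C: "fsat \<tau> C" by (rule fsat_if_saturated[OF sat \<kappa>(1)])
  have "natLeq \<le>o |Field \<kappa>|"
    using ordLeq_ordIso_trans[OF ordLess_imp_ordLeq[OF \<kappa>(1)] ordIso_symmetric[OF card_of_Field_ordIso[OF \<kappa>(2)]]] .
  then have infF: "infinite (Field \<kappa>)" using infinite_iff_natLeq_ordLeq by blast
  have ns: "nonsd l \<tau> C" if nsd: "is_type \<tau> C m p" "|Dom p| <o \<kappa>"
    and fk: "\<And>n A. finite A \<Longrightarrow> A \<subseteq> Dom p \<Longrightarrow> ict_forks l \<tau> \<kappa> C n m p A" for m p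
  proof -
    let ?B = "Dom p"
    have pU: "pfm_in \<tau> (univ C) m f" if "f \<in> p" for f using nsd(1) that by (simp add: is_type_def)
    have pB: "pfm_in \<tau> ?B m f" if "f \<in> p" for f
      using pU[OF that] that by (force simp: pfm_in_def Dom_def split: prod.splits)
    have BU: "?B \<subseteq> univ C"
    proof
      fix x assume "x \<in> ?B"
      then obtain f where "f \<in> p" "x \<in> set (snd f)" by (auto simp: Dom_def)
      with pU[of f] show "x \<in> univ C" by (auto simp: pfm_in_def split: prod.splits)
    qed
    obtain c where "c \<in> realizations C m p" using sat nsd by (auto simp: saturated_def)
    then have c: "c \<in> tuples C m" "\<And>f. f \<in> p \<Longrightarrow> psat C c f" by (auto simp: realizations_def)
    have lc: "length c = m" using tuplesD[OF c(1)] by simp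
    have ex: "\<exists>b. finite b \<and> b \<subseteq> ?B \<and> (\<exists>F. finite F \<and>
        (\<forall>f\<in>F. pfm_in \<tau> (univ C) m f \<and> ndiv l \<tau> C n m f A) \<and>
        (\<forall>c'\<in>tuples C m. elem \<tau> C C (set (zip c c') \<union> Id_on b) \<longrightarrow> (\<exists>f\<in>F. psat C c' f)))"
      if A: "finite A" "A \<subseteq> ?B" for n A
    proof -
      have AU: "A \<subseteq> univ C" using A BU by blast
      obtain F where F: "finite F"
        "\<And>f. f \<in> F \<Longrightarrow> pfm_in \<tau> (univ C) m f \<and> ict_divides l \<tau> \<kappa> C n m {f} A"
        "\<And>c. c \<in> realizations C m p \<Longrightarrow> \<exists>f\<in>F. psat C c f"
        using fk[OF A, of n] unfolding ict_forks_def by blast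
      define neg :: "('s, 'a) pfm \<Rightarrow> ('s, 'a) pfm" where "neg = (\<lambda>(\<phi>, d). (Neg \<phi>, d))"
      have neg: "psat C c (neg f) \<longleftrightarrow> \<not> psat C c f" for c f
        by (cases f) (simp add: neg_def psat_def)
      \<comment> \<open>A realization of \<open>q\<close> would realize \<open>p\<close> and avoid
        the cover \<open>F\<close>. As the domain of \<open>q\<close> is still small, saturation
        shows that \<open>q\<close> is not finitely satisfiable.\<close>
      define q where "q = tp \<tau> C c ?B \<union> neg ` F"
      have qU: "pfm_in \<tau> (univ C) m f" if "f \<in> q" for f
      proof -
        have "pfm_in \<tau> (univ C) m (neg h)" if "h \<in> F" for h
          using F(2)[OF that] by (cases h) (simp add: neg_def pfm_in_def)
        moreover have "pfm_in \<tau> (univ C) m h" if "h \<in> tp \<tau> C c ?B" for h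
          using that pfm_in_mono[OF _ BU, of \<tau> m h] lc by (simp add: tp_def)
        ultimately show ?thesis using \<open>f \<in> q\<close> unfolding q_def by blast
      qed
      have none: "realizations C m q = {}"
      proof -
        have False if r: "c' \<in> realizations C m q" for c'
        proof -
          have c': "c' \<in> tuples C m" "\<And>f. f \<in> q \<Longrightarrow> psat C c' f"
            using r by (auto simp: realizations_def)
          have "psat C c' f" if "f \<in> p" for f
            using c'(2)[of f] pB[OF that] c(2)[OF that] lc by (simp add: q_def tp_def)
          then have "c' \<in> realizations C m p" using c'(1) by (simp add: realizations_def)
          from F(3)[OF this] obtain f where f: "f \<in> F" "psat C c' f" by blast
          have "psat C c' (neg f)" using c'(2)[of "neg f"] f(1) by (simp add: q_def)
          with f(2) neg show False by blast
        qed
        then show ?thesis by blast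
      qed
      have "Dom q = ?B \<union> Dom (neg ` F)" using Dom_tp[OF BU, of \<tau> c] by (auto simp: q_def Dom_def)
      moreover have "finite (Dom (neg ` F))" using F(1) by (auto simp: Dom_def)
      then have "|?B \<union> Dom (neg ` F)| <o \<kappa>"
        by (intro card_of_Un_ordLess_infinite_Field[OF infF \<kappa>(2) nsd(2)]
            countable_ordLess[OF _ \<kappa>(1)] countable_finite)
      ultimately have "|Dom q| <o \<kappa>" by simp
      then have "\<not> is_type \<tau> C m q" using sat none by (auto simp: saturated_def)
      then obtain q0 where q0: "finite q0" "q0 \<subseteq> q" "realizations C m q0 = {}"
        using qU unfolding is_type_def by blast
      define b where "b = Dom (q0 \<inter> tp \<tau> C c ?B)"
      have "finite b" using q0(1) by (auto simp: b_def Dom_def)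
      moreover have "b \<subseteq> ?B" using Dom_tp[OF BU, of \<tau> c] by (auto simp: b_def Dom_def)
      moreover have "\<exists>f\<in>F. psat C c' f"
        if c': "c' \<in> tuples C m" and E: "elem \<tau> C C (set (zip c c') \<union> Id_on b)" for c'
      proof (rule ccontr)
        assume no: "\<not> (\<exists>f\<in>F. psat C c' f)"
        have "psat C c' f" if "f \<in> q0" for f
        proof (cases "f \<in> tp \<tau> C c ?B")
          case True
          then have P: "pfm_in \<tau> b (length c) f"
            using that by (force simp: b_def Dom_def tp_def pfm_in_def split: prod.splits)
          show ?thesis
            using elem_psat[OF E _ P] True tuplesD[OF c'] lc by (simp add: tp_def)
        next
          case False
          then obtain h where "h \<in> F" "f = neg h"
            using \<open>f \<in> q0\<close> q0(2) unfolding q_def by blast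
          then show ?thesis using no neg by simp
        qed
        then have "c' \<in> realizations C m q0" using c' by (simp add: realizations_def)
        then show False using q0(3) by blast
      qed
      moreover have "pfm_in \<tau> (univ C) m f \<and> ndiv l \<tau> C n m f A" if "f \<in> F" for f
        using F(2)[OF that] ict_divides_ndiv[OF l \<kappa>(1) C A(1) AU] by blast
      ultimately show ?thesis using F(1) by (intro exI[of _ b] conjI exI[of _ F]) blast+
    qed
    define Q where "Q = (\<lambda>n A b. finite b \<and> b \<subseteq> ?B \<and> (\<exists>F. finite F \<and>
        (\<forall>f\<in>F. pfm_in \<tau> (univ C) m f \<and> ndiv l \<tau> C n m f A) \<and>
        (\<forall>c'\<in>tuples C m. elem \<tau> C C (set (zip c c') \<union> Id_on b) \<longrightarrow> (\<exists>f\<in>F. psat C c' f))))"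
    \<comment> \<open>A choice of \<open>b\<close> for every \<open>n\<close> and \<open>A\<close>;
      these are the operations for the closing-off.\<close>
    define g where "g = (\<lambda>n A. SOME b. Q n A b)"
    have g: "Q n A (g n A)" if "finite A" "A \<subseteq> ?B" for n A
      unfolding g_def by (rule someI_ex) (use ex[OF that] in \<open>simp only: Q_def\<close>)
    then have g': "finite (g n A) \<and> g n A \<subseteq> ?B" if "finite A" "A \<subseteq> ?B" for n A
      using that unfolding Q_def by blast
    obtain B where B: "countable B" "B \<subseteq> ?B" "\<And>n A. finite A \<Longrightarrow> A \<subseteq> B \<Longrightarrow> g n A \<subseteq> B"
      by (rule countable_closure[of ?B g]) (simp_all add: g')
    have "nfork l \<tau> C n m c B A" if A: "finite A" "A \<subseteq> B" for n A
    proof -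
      have A': "A \<subseteq> ?B" using A B(2) by blast
      show ?thesis
        using g[OF A(1) A', of n] B(3)[OF A, of n] unfolding Q_def nfork_def
        by (intro exI[of _ "g n A"]) (simp only: simp_thms ex_simps)
    qed
    then show ?thesis
      using c(1) B(1,2) BU unfolding nonsd_def
      by (intro exI[of _ m] exI[of _ c] exI[of _ B]) simp
  qed
  have "\<not> strongly_dependent l \<tau> \<kappa> C" if ns: "nonsd l \<tau> C"
  proof -
    from ns obtain m c B where mcB: "c \<in> tuples C m \<and> countable B \<and> B \<subseteq> univ C \<and>
       (\<forall>n A. finite A \<and> A \<subseteq> B \<longrightarrow> nfork l \<tau> C n m c B A)"
      unfolding nonsd_def by (elim exE)
    then have c: "c \<in> tuples C m" and B: "countable B" "B \<subseteq> univ C" by simp_all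
    have fk: "nfork l \<tau> C n m c B A" if "finite A" "A \<subseteq> B" for n A
      using mcB that by (elim conjE) simp
    let ?p = "tp \<tau> C c B"
    have lc: "length c = m" using tuplesD[OF c] by simp
    have cp: "c \<in> realizations C m ?p" using c by (auto simp: realizations_def tp_def)
    have "is_type \<tau> C m ?p"
      unfolding is_type_def
    proof (intro conjI ballI allI impI)
      fix f assume "f \<in> ?p"
      then show "pfm_in \<tau> (univ C) m f" using pfm_in_mono[OF _ B(2), of \<tau> m f] lc by (simp add: tp_def)
    next
      fix q assume "finite q \<and> q \<subseteq> ?p"
      then have "c \<in> realizations C m q" using cp by (auto simp: realizations_def)
      then show "realizations C m q \<noteq> {}" by blast
    qed
    moreover have "|Dom ?p| <o \<kappa>" unfolding Dom_tp[OF B(2)] by (rule countable_ordLess[OF B(1) \<kappa>(1)])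
    moreover have "ict_forks l \<tau> \<kappa> C n m ?p A" if A: "finite A \<and> A \<subseteq> Dom ?p" for n A
    proof -
      have A': "finite A" "A \<subseteq> B" using A by (auto simp: Dom_tp[OF B(2)])
      have AU: "A \<subseteq> univ C" using A' B by blast
      obtain b F where bF: "finite b" "b \<subseteq> B" "finite F"
        "\<And>f. f \<in> F \<Longrightarrow> pfm_in \<tau> (univ C) m f \<and> ndiv l \<tau> C n m f A"
        "\<And>c'. c' \<in> tuples C m \<Longrightarrow> elem \<tau> C C (set (zip c c') \<union> Id_on b) \<Longrightarrow> \<exists>f\<in>F. psat C c' f"
        using fk[OF A', of n] unfolding nfork_def by blast
      have "\<exists>f\<in>F. psat C c' f" if "c' \<in> realizations C m ?p" for c'
      proof (rule bF(5))
        show c': "c' \<in> tuples C m" using that by (simp add: realizations_def)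
        have "elem \<tau> C C (set (zip c c') \<union> Id_on B)"
          by (rule realizations_tp[OF c c' B(2)]) (use that in \<open>simp add: realizations_def\<close>)
        then show "elem \<tau> C C (set (zip c c') \<union> Id_on b)" by (rule elem_mono) (use bF(2) in blast)
      qed
      moreover have "pfm_in \<tau> (univ C) m f \<and> ict_divides l \<tau> \<kappa> C n m {f} A" if "f \<in> F" for f
        using bF(4)[OF that] ict_divides_ndiv[OF l \<kappa>(1) C A'(1) AU] by blast
      ultimately show ?thesis unfolding ict_forks_def using bF(3) by (intro exI[of _ F]) blast
    qed
    ultimately show ?thesis unfolding strongly_dependent_def by blast
  qed
  moreover have "nonsd l \<tau> C" if not_sd: "\<not> strongly_dependent l \<tau> \<kappa> C"
  proof -
    from not_sd obtain m p where mp: "is_type \<tau> C m p \<and> |Dom p| <o \<kappa> \<and>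
        (\<forall>n A. finite A \<and> A \<subseteq> Dom p \<longrightarrow> ict_forks l \<tau> \<kappa> C n m p A)"
      unfolding strongly_dependent_def not_not by (elim exE)
    show ?thesis by (rule ns[of m p]) (use mp in simp_all)
  qed
  ultimately show ?thesis by blast
qed

section \<open>Sums of structures\<close>

text \<open>Quantifiers are relativized to \<open>P\<close>. An atom without arguments does not show
  in which summand it is evaluated, so its truth value in the summand is inserted as a constant,
  read off from \<open>Z\<close>.\<close>

primrec relat :: "'s sum_sym \<Rightarrow> 's set \<Rightarrow> 's fm \<Rightarrow> 's sum_sym fm" where
  "relat P Z (Eq i j) = Eq i j"
| "relat P Z (Rel S is) =
    (if is = [] then (if S \<in> Z then conjs [] else Neg (conjs [])) else Rel (Old S) is)"
| "relat P Z (Neg \<phi>) = Neg (relat P Z \<phi>)"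
| "relat P Z (Conj \<phi> \<psi>) = Conj (relat P Z \<phi>) (relat P Z \<psi>)"
| "relat P Z (Ex \<phi>) = Ex (Conj (Rel P [0]) (relat P Z \<phi>))"

lemma fm_in_part [simp]:
  "P \<in> {LSym, RSym} \<Longrightarrow> fm_in (sum_vocab \<tau>) n (Rel P [i]) \<longleftrightarrow> i < n"
  by (auto simp: sum_vocab_def)

lemma fm_in_relat:
  "P \<in> {LSym, RSym} \<Longrightarrow> fm_in \<tau> n \<phi> \<Longrightarrow> fm_in (sum_vocab \<tau>) n (relat P Z \<phi>)"
proof (induction \<phi> arbitrary: n)
  case (Rel S "is")
  then show ?case by (simp add: sum_vocab_def)
qed (auto simp del: fm_in.simps(2))

text \<open>Stated for an injection \<open>j\<close> in order to cover both the internal parts of a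
  model, with \<open>id\<close>, and the summands of \<open>M1 \<oplus>\<^sub>s M2\<close>, with
  \<open>Inl\<close> and \<open>Inr\<close>.\<close>

lemma sat_relat:
  assumes inj: "inj_on j (univ M)" and P: "\<And>x. x \<in> univ C \<Longrightarrow> [x] \<in> rel C P \<longleftrightarrow> x \<in> j ` univ M"
    and j: "j ` univ M \<subseteq> univ C"
    and rel: "\<And>S xs. S \<in> syms \<tau> \<Longrightarrow> xs \<noteq> [] \<Longrightarrow> set xs \<subseteq> univ M \<Longrightarrow>
      map j xs \<in> rel C (Old S) \<longleftrightarrow> xs \<in> rel M S"
    and Z: "\<And>S. S \<in> syms \<tau> \<Longrightarrow> S \<in> Z \<longleftrightarrow> [] \<in> rel M S"
  shows "fm_in \<tau> (length e) \<phi> \<Longrightarrow> set e \<subseteq> univ M \<Longrightarrow>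
    sat C (map j e) (relat P Z \<phi>) \<longleftrightarrow> sat M e \<phi>"
proof (induction \<phi> arbitrary: e)
  case (Eq i k)
  then have "e ! i \<in> univ M" "e ! k \<in> univ M" by auto
  with Eq inj show ?case by (simp add: inj_on_eq_iff)
next
  case (Rel S "is")
  show ?case
  proof (cases "is = []")
    case True
    then show ?thesis using Rel Z by simp
  next
    case False
    have "map (\<lambda>i. map j e ! i) is = map j (map (\<lambda>i. e ! i) is)" using Rel by simp
    moreover have "set (map (\<lambda>i. e ! i) is) \<subseteq> univ M" using Rel by (auto simp: subset_iff)
    ultimately show ?thesis using rel[of S "map (\<lambda>i. e ! i) is"] False Rel(1)
      by (simp only: relat.simps if_False sat.simps fm_in.simps) simp
  qed
next
  case (Ex \<phi>)
  have "sat C (map j e) (relat P Z (Ex \<phi>)) \<longleftrightarrow> (\<exists>x\<in>univ C. [x] \<in> rel C P \<and> sat C (x # map j e) (relat P Z \<phi>))"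
    by simp
  also have "\<dots> \<longleftrightarrow> (\<exists>y\<in>univ M. sat C (map j (y # e)) (relat P Z \<phi>))"
    using P j by auto
  also have "\<dots> \<longleftrightarrow> (\<exists>y\<in>univ M. sat M (y # e) \<phi>)"
    using Ex by (intro bex_cong refl Ex.IH) auto
  finally show ?case by simp
qed auto

section \<open>Internal sums and the decomposition of formulas into boxes\<close>

lemma nth_filter_take:
  assumes "i < length e" "P (e ! i)"
  shows "length (filter P (take i e)) < length (filter P e)"
    and "filter P e ! length (filter P (take i e)) = e ! i"
proof -
  have "filter P e = filter P (take i e @ e ! i # drop (Suc i) e)"
    by (subst id_take_nth_drop[OF assms(1)]) simp
  then have *: "filter P e = filter P (take i e) @ e ! i # filter P (drop (Suc i) e)"
    using assms(2) by simp
  show "length (filter P (take i e)) < length (filter P e)" unfolding * by simp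
  show "filter P e ! length (filter P (take i e)) = e ! i" unfolding * by simp
qed

lemma length_filter_map: "length (filter Q (map f xs)) = length (filter (Q \<circ> f) xs)"
  by (simp add: filter_map)

lemma set_zip_filter:
  assumes "length xs = length ys" "\<And>x y. (x, y) \<in> set (zip xs ys) \<Longrightarrow> P x \<longleftrightarrow> Q y"
  shows "length (filter P xs) = length (filter Q ys) \<and>
    set (zip (filter P xs) (filter Q ys)) = {(x, y) \<in> set (zip xs ys). P x}"
  using assms
proof (induction xs ys rule: list_induct2)
  case (Cons x xs y ys)
  then have "P x \<longleftrightarrow> Q y" by simp
  moreover have "length (filter P xs) = length (filter Q ys) \<and>
      set (zip (filter P xs) (filter Q ys)) = {(x, y) \<in> set (zip xs ys). P x}"
    by (rule Cons.IH) (use Cons.prems in auto)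
  ultimately show ?case by auto
qed simp

text \<open>A sum in internal form, because a model of the theory of a sum is not literally of the
  form \<open>M \<oplus>\<^sub>s N\<close>. Which of the two predicates marks the first part is left
  open, so \<open>swap\<close> turns every fact about \<open>CL\<close> into one about
  \<open>CR\<close>.\<close>

locale sum_parts =
  fixes \<tau> :: "'s vocab" and C :: "('s sum_sym, 'a) struc" and CL CR :: "('s, 'a) struc"
    and sL sR :: "'s sum_sym"
  assumes strL: "is_structure \<tau> CL" and strR: "is_structure \<tau> CR"
    and univ_C: "univ C = univ CL \<union> univ CR" and disj: "univ CL \<inter> univ CR = {}"
    and parts: "{sL, sR} = {LSym, RSym}"
    and rel_sL: "rel C sL = {[a] | a. a \<in> univ CL}"
    and rel_sR: "rel C sR = {[a] | a. a \<in> univ CR}"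
    and rel_Old: "\<And>S. S \<in> syms \<tau> \<Longrightarrow> rel C (Old S) = rel CL S \<union> rel CR S"
begin

abbreviation "\<tau>' \<equiv> sum_vocab \<tau>"
abbreviation "inL x \<equiv> x \<in> univ CL"
abbreviation "inR x \<equiv> x \<in> univ CR"
abbreviation "LL e \<equiv> filter inL e"
abbreviation "RR e \<equiv> filter inR e"

lemma swap: "sum_parts \<tau> C CR CL sR sL"
  by unfold_locales
    (use strL strR univ_C disj parts rel_sL rel_sR rel_Old in \<open>auto simp: insert_commute\<close>)

lemma sL_cases: "sL \<in> {LSym, RSym}" using parts by auto

lemma sR_cases: "sR \<in> {LSym, RSym}" using parts by auto

lemma inR_iff: "x \<in> univ C \<Longrightarrow> inR x \<longleftrightarrow> \<not> inL x"
  using univ_C disj by blast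

lemma rel_CL: "S \<in> syms \<tau> \<Longrightarrow> xs \<in> rel CL S \<Longrightarrow> set xs \<subseteq> univ CL"
  using strL by (auto simp: is_structure_def)

lemma rel_CR: "S \<in> syms \<tau> \<Longrightarrow> xs \<in> rel CR S \<Longrightarrow> set xs \<subseteq> univ CR"
  using strR by (auto simp: is_structure_def)

definition "relL = relat sL {S. [] \<in> rel CL S}"

lemma fm_in_relL: "fm_in \<tau> n \<phi> \<Longrightarrow> fm_in \<tau>' n (relL \<phi>)"
  unfolding relL_def by (rule fm_in_relat[OF sL_cases])

lemma sat_relL:
  assumes "fm_in \<tau> (length e) \<phi>" "set e \<subseteq> univ CL"
  shows "sat C e (relL \<phi>) \<longleftrightarrow> sat CL e \<phi>"
proof -
  have "sat C (map id e) (relat sL {S. [] \<in> rel CL S} \<phi>) \<longleftrightarrow> sat CL e \<phi>"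
  proof (rule sat_relat[OF _ _ _ _ _ assms])
    fix S and xs :: "'a list" assume S: "S \<in> syms \<tau>" and xs: "xs \<noteq> []" "set xs \<subseteq> univ CL"
    then obtain x where "x \<in> set xs" "inL x" by (cases xs) auto
    then have "xs \<notin> rel CR S" using rel_CR[OF S] disj by blast
    then show "map id xs \<in> rel C (Old S) \<longleftrightarrow> xs \<in> rel CL S" using rel_Old[OF S] by simp
  qed (use univ_C rel_sL in auto)
  then show ?thesis by (simp add: relL_def)
qed

lemma elem_inL:
  assumes "elem \<tau>' C C P" "(x, y) \<in> P" shows "inL x \<longleftrightarrow> inL y"
proof -
  have "sat C [x] (Rel sL [0]) \<longleftrightarrow> sat C [y] (Rel sL [0])"
    using elem_sat[OF assms(1), of "[(x, y)]" "Rel sL [0]"] assms(2) fm_in_part[OF sL_cases, of \<tau> 1 0]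
    by (simp del: fm_in.simps)
  then show ?thesis by (simp add: rel_sL)
qed

text \<open>Truth in the part is expressed within the sum by relativized formulas.\<close>

lemma elem_L:
  assumes "elem \<tau>' C C P" shows "elem \<tau> CL CL (P \<inter> univ CL \<times> univ CL)"
  unfolding elem_def
proof (intro conjI allI impI)
  fix ps \<phi> assume A: "set ps \<subseteq> P \<inter> univ CL \<times> univ CL \<and> fm_in \<tau> (length ps) \<phi>"
  then have "set (map fst ps) \<subseteq> univ CL" "set (map snd ps) \<subseteq> univ CL" by auto
  moreover have "sat C (map fst ps) (relL \<phi>) \<longleftrightarrow> sat C (map snd ps) (relL \<phi>)"
    by (rule elem_sat[OF assms]) (use A fm_in_relL in auto)
  ultimately show "sat CL (map fst ps) \<phi> \<longleftrightarrow> sat CL (map snd ps) \<phi>"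
    using A sat_relL[of "map fst ps" \<phi>] sat_relL[of "map snd ps" \<phi>] by simp
qed auto

text \<open>\<open>\<sigma>\<close> fixes for every variable the part in which its value lies. Only
  after this split does a formula become a finite union of products of a left and a right condition,
  each in its own variables.\<close>

definition box_list :: "bool list \<Rightarrow> ('a list \<Rightarrow> bool) \<Rightarrow> ('s fm \<times> 's fm) list \<Rightarrow> bool" where
  "box_list \<sigma> Q ps \<longleftrightarrow> (\<forall>p\<in>set ps. fm_in \<tau> (length (filter (\<lambda>b. b) \<sigma>)) (fst p) \<and>
        fm_in \<tau> (length (filter Not \<sigma>)) (snd p)) \<and>
     (\<forall>e. set e \<subseteq> univ C \<and> map inL e = \<sigma> \<longrightarrow>
        (Q e \<longleftrightarrow> (\<exists>p\<in>set ps. sat CL (LL e) (fst p) \<and> sat CR (RR e) (snd p))))"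

definition boxes :: "bool list \<Rightarrow> ('a list \<Rightarrow> bool) \<Rightarrow> bool" where
  "boxes \<sigma> Q \<longleftrightarrow> (\<exists>ps. box_list \<sigma> Q ps)"

lemma boxesI:
  assumes "\<And>p. p \<in> set ps \<Longrightarrow> fm_in \<tau> (length (filter (\<lambda>b. b) \<sigma>)) (fst p) \<and>
        fm_in \<tau> (length (filter Not \<sigma>)) (snd p)"
    and "\<And>e. set e \<subseteq> univ C \<Longrightarrow> map inL e = \<sigma> \<Longrightarrow>
        (Q e \<longleftrightarrow> (\<exists>p\<in>set ps. sat CL (LL e) (fst p) \<and> sat CR (RR e) (snd p)))"
  shows "boxes \<sigma> Q"
  unfolding boxes_def box_list_def by (rule exI[of _ ps]) (use assms in simp)

lemma box_listD:
  assumes "box_list \<sigma> Q ps"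
  shows "\<And>p. p \<in> set ps \<Longrightarrow> fm_in \<tau> (length (filter (\<lambda>b. b) \<sigma>)) (fst p) \<and>
        fm_in \<tau> (length (filter Not \<sigma>)) (snd p)"
    and "\<And>e. set e \<subseteq> univ C \<Longrightarrow> map inL e = \<sigma> \<Longrightarrow>
        (Q e \<longleftrightarrow> (\<exists>p\<in>set ps. sat CL (LL e) (fst p) \<and> sat CR (RR e) (snd p)))"
  using assms unfolding box_list_def by simp_all

lemma boxes_cong:
  assumes "boxes \<sigma> Q" "\<And>e. set e \<subseteq> univ C \<Longrightarrow> map inL e = \<sigma> \<Longrightarrow> Q e \<longleftrightarrow> Q' e"
  shows "boxes \<sigma> Q'"
proof -
  obtain ps where ps0: "box_list \<sigma> Q ps" using assms(1) by (auto simp: boxes_def)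
  note ps = box_listD[OF ps0]
  show ?thesis by (rule boxesI[of ps, OF ps(1)]) (use assms(2) ps(2) in simp_all)
qed

lemma boxes_L: "fm_in \<tau> (length (filter (\<lambda>b. b) \<sigma>)) \<alpha> \<Longrightarrow> boxes \<sigma> (\<lambda>e. sat CL (LL e) \<alpha>)"
  by (rule boxesI[of "[(\<alpha>, conjs [])]"]) auto

lemma boxes_R: "fm_in \<tau> (length (filter Not \<sigma>)) \<alpha> \<Longrightarrow> boxes \<sigma> (\<lambda>e. sat CR (RR e) \<alpha>)"
  by (rule boxesI[of "[(conjs [], \<alpha>)]"]) auto

lemma boxes_const: "boxes \<sigma> (\<lambda>e. b)"
proof (cases b)
  case True
  then show ?thesis by (intro boxesI[of "[(conjs [], conjs [])]"]) auto
next
  case False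
  then show ?thesis by (intro boxesI[of "[]"]) auto
qed

lemma boxes_Or:
  assumes "boxes \<sigma> Q" "boxes \<sigma> Q'" shows "boxes \<sigma> (\<lambda>e. Q e \<or> Q' e)"
proof -
  obtain ps where ps0: "box_list \<sigma> Q ps" using assms(1) by (auto simp: boxes_def)
  note ps = box_listD[OF ps0]
  obtain qs where qs0: "box_list \<sigma> Q' qs" using assms(2) by (auto simp: boxes_def)
  note qs = box_listD[OF qs0]
  show ?thesis
  proof (rule boxesI[of "ps @ qs"])
    fix p assume "p \<in> set (ps @ qs)"
    then show "fm_in \<tau> (length (filter (\<lambda>b. b) \<sigma>)) (fst p) \<and> fm_in \<tau> (length (filter Not \<sigma>)) (snd p)"
      using ps(1)[of p] qs(1)[of p] by auto
  next
    fix e assume "set e \<subseteq> univ C" "map inL e = \<sigma>"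
    from ps(2)[OF this] qs(2)[OF this]
    show "(Q e \<or> Q' e) \<longleftrightarrow> (\<exists>p\<in>set (ps @ qs). sat CL (LL e) (fst p) \<and> sat CR (RR e) (snd p))"
      by auto
  qed
qed

lemma boxes_And:
  assumes "boxes \<sigma> Q" "boxes \<sigma> Q'" shows "boxes \<sigma> (\<lambda>e. Q e \<and> Q' e)"
proof -
  obtain ps where ps0: "box_list \<sigma> Q ps" using assms(1) by (auto simp: boxes_def)
  note ps = box_listD[OF ps0]
  obtain qs where qs0: "box_list \<sigma> Q' qs" using assms(2) by (auto simp: boxes_def)
  note qs = box_listD[OF qs0]
  let ?f = "\<lambda>(p, q). (Conj (fst p) (fst q), Conj (snd p) (snd q))"
  show ?thesis
  proof (rule boxesI[of "map ?f (List.product ps qs)"])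
    fix p assume "p \<in> set (map ?f (List.product ps qs))"
    then obtain p' q where "p' \<in> set ps" "q \<in> set qs" "p = ?f (p', q)" by auto
    then show "fm_in \<tau> (length (filter (\<lambda>b. b) \<sigma>)) (fst p) \<and> fm_in \<tau> (length (filter Not \<sigma>)) (snd p)"
      using ps(1)[of p'] qs(1)[of q] by simp
  next
    fix e assume "set e \<subseteq> univ C" "map inL e = \<sigma>"
    note * = ps(2)[OF this] qs(2)[OF this]
    have "(\<exists>p\<in>set (map ?f (List.product ps qs)). sat CL (LL e) (fst p) \<and> sat CR (RR e) (snd p)) \<longleftrightarrow>
      (\<exists>p\<in>set ps. \<exists>q\<in>set qs. sat CL (LL e) (fst (?f (p, q))) \<and> sat CR (RR e) (snd (?f (p, q))))"
      by (simp add: Bex_def) blast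
    then show "(Q e \<and> Q' e) \<longleftrightarrow>
        (\<exists>p\<in>set (map ?f (List.product ps qs)). sat CL (LL e) (fst p) \<and> sat CR (RR e) (snd p))"
      unfolding * by auto
  qed
qed

text \<open>The complement of a box is the union of two boxes, and finite intersections of unions of
  boxes are again such unions.\<close>

lemma boxes_Not:
  assumes "boxes \<sigma> Q" shows "boxes \<sigma> (\<lambda>e. \<not> Q e)"
proof -
  obtain ps where ps0: "box_list \<sigma> Q ps" using assms(1) by (auto simp: boxes_def)
  note ps = box_listD[OF ps0]
  have "boxes \<sigma> (\<lambda>e. \<not> (\<exists>p\<in>set ps. sat CL (LL e) (fst p) \<and> sat CR (RR e) (snd p)))"
    using ps(1)
  proof (induction ps)
    case Nil
    then show ?case using boxes_const[of \<sigma> True] by simp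
  next
    case (Cons p ps)
    have p: "fm_in \<tau> (length (filter (\<lambda>b. b) \<sigma>)) (Neg (fst p))" "fm_in \<tau> (length (filter Not \<sigma>)) (Neg (snd p))"
      using Cons.prems[of p] by auto
    have IH: "boxes \<sigma> (\<lambda>e. \<not> (\<exists>p\<in>set ps. sat CL (LL e) (fst p) \<and> sat CR (RR e) (snd p)))"
    proof (rule Cons.IH)
      fix q assume "q \<in> set ps"
      then show "fm_in \<tau> (length (filter (\<lambda>b. b) \<sigma>)) (fst q) \<and> fm_in \<tau> (length (filter Not \<sigma>)) (snd q)"
        using Cons.prems[of q] by simp
    qed
    show ?case
    proof (rule boxes_cong[OF boxes_And[OF boxes_Or[OF boxes_L[OF p(1)] boxes_R[OF p(2)]] IH]])
      fix e
      show "((sat CL (LL e) (Neg (fst p)) \<or> sat CR (RR e) (Neg (snd p))) \<and>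
          \<not> (\<exists>p\<in>set ps. sat CL (LL e) (fst p) \<and> sat CR (RR e) (snd p))) \<longleftrightarrow>
          \<not> (\<exists>q\<in>set (p # ps). sat CL (LL e) (fst q) \<and> sat CR (RR e) (snd q))"
        by simp
    qed
  qed
  then show ?thesis
  proof (rule boxes_cong)
    fix e assume e: "set e \<subseteq> univ C" "map inL e = \<sigma>"
    show "\<not> (\<exists>p\<in>set ps. sat CL (LL e) (fst p) \<and> sat CR (RR e) (snd p)) \<longleftrightarrow> \<not> Q e"
      unfolding ps(2)[OF e] ..
  qed
qed

text \<open>The new element lies on one side; the quantifier commutes with the disjunction and
  passes by the factor of the other side, in which the variable does not occur.\<close>

lemma boxes_Ex:
  assumes "boxes (True # \<sigma>) Q" "boxes (False # \<sigma>) Q" shows "boxes \<sigma> (\<lambda>e. \<exists>a\<in>univ C. Q (a # e))"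
proof -
  obtain ps where ps0: "box_list (True # \<sigma>) Q ps" using assms(1) by (auto simp: boxes_def)
  note ps = box_listD[OF ps0]
  obtain qs where qs0: "box_list (False # \<sigma>) Q qs" using assms(2) by (auto simp: boxes_def)
  note qs = box_listD[OF qs0]
  let ?ps = "map (\<lambda>p. (Ex (fst p), snd p)) ps" and ?qs = "map (\<lambda>p. (fst p, Ex (snd p))) qs"
  show ?thesis
  proof (rule boxesI[of "?ps @ ?qs"])
    fix p assume "p \<in> set (?ps @ ?qs)"
    then show "fm_in \<tau> (length (filter (\<lambda>b. b) \<sigma>)) (fst p) \<and> fm_in \<tau> (length (filter Not \<sigma>)) (snd p)"
      using ps(1) qs(1) by auto
  next
    fix e assume e: "set e \<subseteq> univ C" "map inL e = \<sigma>"
    have 1: "Q (a # e) \<longleftrightarrow> (\<exists>p\<in>set ps. sat CL (a # LL e) (fst p) \<and> sat CR (RR e) (snd p))" if "inL a" for a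
      using ps(2)[of "a # e"] that e univ_C inR_iff[of a] by simp
    have 2: "Q (a # e) \<longleftrightarrow> (\<exists>p\<in>set qs. sat CL (LL e) (fst p) \<and> sat CR (a # RR e) (snd p))" if "inR a" for a
      using qs(2)[of "a # e"] that e univ_C inR_iff[of a] by simp
    have "(\<exists>a\<in>univ C. Q (a # e)) \<longleftrightarrow> (\<exists>a\<in>univ CL. Q (a # e)) \<or> (\<exists>a\<in>univ CR. Q (a # e))"
      unfolding univ_C by blast
    also have "\<dots> \<longleftrightarrow> (\<exists>p\<in>set ps. sat CL (LL e) (Ex (fst p)) \<and> sat CR (RR e) (snd p)) \<or>
        (\<exists>p\<in>set qs. sat CL (LL e) (fst p) \<and> sat CR (RR e) (Ex (snd p)))"
      using 1 2 by auto
    also have "\<dots> \<longleftrightarrow> (\<exists>p\<in>set (?ps @ ?qs). sat CL (LL e) (fst p) \<and> sat CR (RR e) (snd p))"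
      by (simp add: bex_Un)
    finally show "(\<exists>a\<in>univ C. Q (a # e)) \<longleftrightarrow>
        (\<exists>p\<in>set (?ps @ ?qs). sat CL (LL e) (fst p) \<and> sat CR (RR e) (snd p))" .
  qed
qed

text \<open>The number that variable \<open>i\<close> receives among the variables of its own
  side.\<close>

definition "posL \<sigma> i = length (filter (\<lambda>b. b) (take i \<sigma>))"
definition "posR \<sigma> i = length (filter Not (take i \<sigma>))"

lemma posL:
  assumes "map inL e = \<sigma>" "i < length \<sigma>" "\<sigma> ! i"
  shows "posL \<sigma> i < length (filter (\<lambda>b. b) \<sigma>)" "LL e ! posL \<sigma> i = e ! i"
proof -
  have *: "length (filter (\<lambda>b. b) (take i \<sigma>)) = length (LL (take i e))" "length (filter (\<lambda>b. b) \<sigma>) = length (LL e)"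
    unfolding assms(1)[symmetric] take_map length_filter_map by (simp_all add: comp_def)
  show "posL \<sigma> i < length (filter (\<lambda>b. b) \<sigma>)" "LL e ! posL \<sigma> i = e ! i"
    unfolding posL_def * using nth_filter_take[of i e inL] assms by auto
qed

lemma posR:
  assumes "map inL e = \<sigma>" "i < length \<sigma>" "\<not> \<sigma> ! i" "set e \<subseteq> univ C"
  shows "posR \<sigma> i < length (filter Not \<sigma>)" "RR e ! posR \<sigma> i = e ! i"
proof -
  have r: "filter inR xs = filter (\<lambda>x. \<not> inL x) xs" if "set xs \<subseteq> univ C" for xs
    by (rule filter_cong[OF refl]) (use that inR_iff in blast)
  have "set (take i e) \<subseteq> univ C" using assms(4) by (auto dest: in_set_takeD)
  note r' = r[OF this] r[OF assms(4)]
  have *: "length (filter Not (take i \<sigma>)) = length (RR (take i e))" "length (filter Not \<sigma>) = length (RR e)"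
    unfolding assms(1)[symmetric] take_map length_filter_map r' by (simp_all add: comp_def)
  have "i < length e" using assms(1,2) by auto
  then have "e ! i \<in> univ C" "\<sigma> ! i \<longleftrightarrow> inL (e ! i)" using assms(1,4) by auto
  then have "inR (e ! i)" using inR_iff assms(3) by simp
  then show "posR \<sigma> i < length (filter Not \<sigma>)" "RR e ! posR \<sigma> i = e ! i"
    unfolding posR_def * using nth_filter_take[of i e inR] assms by auto
qed

lemma part_nth: "map inL e = \<sigma> \<Longrightarrow> i < length \<sigma> \<Longrightarrow> inL (e ! i) \<longleftrightarrow> \<sigma> ! i"
  by auto

text \<open>The Feferman-Vaught decomposition for sums. Atoms are the point: equalities and
  relations that mix the two sides are false, so only one-sided conditions and constants
  remain.\<close>

lemma boxes_sat: "fm_in \<tau>' n \<phi> \<Longrightarrow> length \<sigma> = n \<Longrightarrow> boxes \<sigma> (\<lambda>e. sat C e \<phi>)"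
proof (induction \<phi> arbitrary: n \<sigma>)
  case (Eq i j)
  then have ij: "i < length \<sigma>" "j < length \<sigma>" by auto
  show ?case
  proof (cases "\<sigma> ! i = \<sigma> ! j")
    case False
    have "e ! i \<noteq> e ! j" if "map inL e = \<sigma>" for e
      using False part_nth[OF that ij(1)] part_nth[OF that ij(2)] by metis
    then show ?thesis by (intro boxes_cong[OF boxes_const[of \<sigma> False]]) simp
  next
    case same: True
    show ?thesis
    proof (cases "\<sigma> ! i")
      case True
      then have j: "\<sigma> ! j" using same by simp
      have f: "fm_in \<tau> (length (filter (\<lambda>b. b) \<sigma>)) (Eq (posL \<sigma> i) (posL \<sigma> j))"
        using nth_filter_take(1)[of i \<sigma> "\<lambda>b. b"] nth_filter_take(1)[of j \<sigma> "\<lambda>b. b"] ij True j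
        by (simp add: posL_def)
      show ?thesis
        by (rule boxes_cong[OF boxes_L[OF f]])
          (use posL(2)[OF _ ij(1) True] posL(2)[OF _ ij(2) j] in simp)
    next
      case False
      then have j: "\<not> \<sigma> ! j" using same by simp
      have f: "fm_in \<tau> (length (filter Not \<sigma>)) (Eq (posR \<sigma> i) (posR \<sigma> j))"
        using nth_filter_take(1)[of i \<sigma> Not] nth_filter_take(1)[of j \<sigma> Not] ij False j
        by (simp add: posR_def)
      show ?thesis
        by (rule boxes_cong[OF boxes_R[OF f]])
          (use posR(2)[OF _ ij(1) False] posR(2)[OF _ ij(2) j] in simp)
    qed
  qed
next
  case (Rel S "is")
  then have "S \<in> Old ` syms \<tau> \<union> {sL, sR}" unfolding parts by (simp add: sum_vocab_def)
  then consider (old) S' where "S = Old S'" "S' \<in> syms \<tau>" | (l) "S = sL" | (r) "S = sR" by blast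
  then show ?case
  proof cases
    case old
    have ar: "length is = ar \<tau> S'" and isb: "i < length \<sigma>" if "i \<in> set is" for i
      using Rel old that by (auto simp: sum_vocab_def)
    have ar: "length is = ar \<tau> S'" using Rel old by (simp add: sum_vocab_def)
    \<comment> \<open>An atom without arguments falls under the \<open>True\<close> case here and
      again in \<open>R\<close>; the disjunction taken at the end is then its value in the
      sum.\<close>
    have L: "boxes \<sigma> (\<lambda>e. map ((!) e) is \<in> rel CL S')"
    proof (cases "\<forall>i\<in>set is. \<sigma> ! i")
      case True
      have f: "fm_in \<tau> (length (filter (\<lambda>b. b) \<sigma>)) (Rel S' (map (posL \<sigma>) is))"
        using old ar isb True nth_filter_take(1)[of _ \<sigma> "\<lambda>b. b"] by (auto simp: posL_def)
      have E: "map (\<lambda>i. LL e ! posL \<sigma> i) is = map ((!) e) is" if "map inL e = \<sigma>" for e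
        using posL(2)[OF that] isb True by auto
      show ?thesis
        by (rule boxes_cong[OF boxes_L[OF f]]) (simp only: sat.simps list.map_comp comp_def E)
    next
      case False
      then obtain i where i: "i \<in> set is" "\<not> \<sigma> ! i" by blast
      have "map ((!) e) is \<notin> rel CL S'" if "map inL e = \<sigma>" for e
      proof
        assume "map ((!) e) is \<in> rel CL S'"
        then have "inL (e ! i)" using rel_CL[OF old(2)] i(1) by fastforce
        then show False using i(2) part_nth[OF that isb[OF i(1)]] by simp
      qed
      then show ?thesis by (intro boxes_cong[OF boxes_const[of \<sigma> False]]) simp
    qed
    have R: "boxes \<sigma> (\<lambda>e. map ((!) e) is \<in> rel CR S')"
    proof (cases "\<forall>i\<in>set is. \<not> \<sigma> ! i")
      case True
      have f: "fm_in \<tau> (length (filter Not \<sigma>)) (Rel S' (map (posR \<sigma>) is))"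
        using old ar isb True nth_filter_take(1)[of _ \<sigma> Not] by (auto simp: posR_def)
      have E: "map (\<lambda>i. RR e ! posR \<sigma> i) is = map ((!) e) is" if "map inL e = \<sigma>" "set e \<subseteq> univ C" for e
        using posR(2)[OF that(1) _ _ that(2)] isb True by auto
      show ?thesis
        by (rule boxes_cong[OF boxes_R[OF f]]) (simp only: sat.simps list.map_comp comp_def E)
    next
      case False
      then obtain i where i: "i \<in> set is" "\<sigma> ! i" by blast
      have "map ((!) e) is \<notin> rel CR S'" if "map inL e = \<sigma>" for e
      proof
        assume "map ((!) e) is \<in> rel CR S'"
        then have "inR (e ! i)" using rel_CR[OF old(2)] i(1) by fastforce
        then show False using i(2) part_nth[OF that isb[OF i(1)]] disj by blast
      qed
      then show ?thesis by (intro boxes_cong[OF boxes_const[of \<sigma> False]]) simp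
    qed
    show ?thesis
      by (rule boxes_cong[OF boxes_Or[OF L R]]) (simp add: old(1) rel_Old[OF old(2)])
  next
    case l
    then obtain i where i: "is = [i]" "i < length \<sigma>"
      using Rel sL_cases by (auto simp: sum_vocab_def length_Suc_conv)
    have "sat C e (Rel S is) \<longleftrightarrow> \<sigma> ! i" if "map inL e = \<sigma>" for e
      using part_nth[OF that i(2)] by (simp add: l i(1) rel_sL)
    then show ?thesis by (intro boxes_cong[OF boxes_const[of \<sigma> "\<sigma> ! i"]]) simp
  next
    case r
    then obtain i where i: "is = [i]" "i < length \<sigma>"
      using Rel sR_cases by (auto simp: sum_vocab_def length_Suc_conv)
    have "sat C e (Rel S is) \<longleftrightarrow> \<not> \<sigma> ! i" if "map inL e = \<sigma>" "set e \<subseteq> univ C" for e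
    proof -
      have "i < length e" using i that by auto
      then have "e ! i \<in> univ C" using that(2) by auto
      then show ?thesis using inR_iff part_nth[OF that(1) i(2)] by (simp add: r i(1) rel_sR)
    qed
    then show ?thesis by (intro boxes_cong[OF boxes_const[of \<sigma> "\<not> \<sigma> ! i"]]) simp
  qed
next
  case (Neg \<phi>)
  then show ?case using boxes_Not[OF Neg.IH[of n \<sigma>]] by simp
next
  case (Conj \<phi> \<psi>)
  then show ?case using boxes_And[OF Conj.IH(1)[of n \<sigma>] Conj.IH(2)[of n \<sigma>]] by simp
next
  case (Ex \<phi>)
  then show ?case using boxes_Ex[OF Ex.IH[of "Suc n" "True # \<sigma>"] Ex.IH[of "Suc n" "False # \<sigma>"]] by simp
qed

text \<open>Converse of \<open>elem_L\<close>, and the source of the independence of the two sides: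
  by the decomposition into boxes, a formula of the sum tests left pairs and right pairs
  separately.\<close>

lemma elem_of_parts:
  assumes P: "P \<subseteq> univ CL \<times> univ CL \<union> univ CR \<times> univ CR"
    and L: "elem \<tau> CL CL (P \<inter> univ CL \<times> univ CL)" and R: "elem \<tau> CR CR (P \<inter> univ CR \<times> univ CR)"
  shows "elem \<tau>' C C P"
  unfolding elem_def
proof (intro conjI allI impI)
  show "P \<subseteq> univ C \<times> univ C" using P univ_C by blast
  fix ps \<phi> assume A: "set ps \<subseteq> P \<and> fm_in \<tau>' (length ps) \<phi>"
  let ?e = "map fst ps" and ?e' = "map snd ps" and ?\<sigma> = "map (inL \<circ> fst) ps"
  have same: "inL (fst p) \<longleftrightarrow> inL (snd p)" "inR (fst p) \<longleftrightarrow> inR (snd p)" if "p \<in> set ps" for p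
  proof -
    have "p \<in> univ CL \<times> univ CL \<union> univ CR \<times> univ CR" using A P that by blast
    then show "inL (fst p) \<longleftrightarrow> inL (snd p)" "inR (fst p) \<longleftrightarrow> inR (snd p)" using disj by auto
  qed
  have U: "set ?e \<subseteq> univ C" "set ?e' \<subseteq> univ C" 
  proof -
    have "P \<subseteq> univ C \<times> univ C" using P univ_C by blast
    then have "set ps \<subseteq> univ C \<times> univ C" using A by blast
    then show "set ?e \<subseteq> univ C" "set ?e' \<subseteq> univ C" by auto
  qed
  have \<sigma>: "map inL ?e = ?\<sigma>" "map inL ?e' = ?\<sigma>" using same by auto
  have F: "LL ?e = map fst (filter (inL \<circ> fst) ps)" "LL ?e' = map snd (filter (inL \<circ> fst) ps)"
    "RR ?e = map fst (filter (inR \<circ> fst) ps)" "RR ?e' = map snd (filter (inR \<circ> fst) ps)"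
    using same by (auto simp: filter_map comp_def intro!: arg_cong[where f = "map snd"] filter_cong)
  have len: "length (filter (\<lambda>b. b) ?\<sigma>) = length (filter (inL \<circ> fst) ps)"
    "length (filter Not ?\<sigma>) = length (filter (inR \<circ> fst) ps)"
  proof -
    show "length (filter (\<lambda>b. b) ?\<sigma>) = length (filter (inL \<circ> fst) ps)"
      unfolding length_filter_map by (simp add: comp_def)
    have "filter (Not \<circ> (inL \<circ> fst)) ps = filter (inR \<circ> fst) ps"
      using U(1) inR_iff by (intro filter_cong refl) auto
    then show "length (filter Not ?\<sigma>) = length (filter (inR \<circ> fst) ps)"
      unfolding length_filter_map by simp
  qed
  have "boxes ?\<sigma> (\<lambda>e. sat C e \<phi>)" by (rule boxes_sat[of "length ps"]) (use A in auto)
  then obtain qs where qs0: "box_list ?\<sigma> (\<lambda>e. sat C e \<phi>) qs" by (auto simp: boxes_def)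
  note qs = box_listD[OF qs0]
  have sub: "set (filter (inL \<circ> fst) ps) \<subseteq> P \<inter> univ CL \<times> univ CL"
    "set (filter (inR \<circ> fst) ps) \<subseteq> P \<inter> univ CR \<times> univ CR"
    using A same by (auto simp: subset_iff)
  have "sat CL (LL ?e) (fst q) \<longleftrightarrow> sat CL (LL ?e') (fst q)" if "q \<in> set qs" for q
    unfolding F by (rule elem_sat[OF L sub(1)]) (use qs(1)[OF that] len in simp)
  moreover have "sat CR (RR ?e) (snd q) \<longleftrightarrow> sat CR (RR ?e') (snd q)" if "q \<in> set qs" for q
    unfolding F by (rule elem_sat[OF R sub(2)]) (use qs(1)[OF that] len in simp)
  ultimately show "sat C ?e \<phi> \<longleftrightarrow> sat C ?e' \<phi>"
    unfolding qs(2)[OF U(1) \<sigma>(1)] qs(2)[OF U(2) \<sigma>(2)] by auto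
qed

text \<open>A type over the left part is relativized, and \<open>sL\<close> is demanded of every
  variable.\<close>

lemma fsat_L: assumes C: "fsat \<tau>' C" shows "fsat \<tau> CL"
  unfolding fsat_def
proof (intro allI impI)
  fix m p assume p: "is_type \<tau> CL m p \<and> finite (Dom p)"
  define rl where "rl = (\<lambda>(\<phi>, d :: 'a list). (relL \<phi>, d))"
  define P where "P = rl ` p \<union> (\<lambda>i. (Rel sL [i], [])) ` {..<m}"
  have pf: "pfm_in \<tau> (univ CL) m f" if "f \<in> p" for f using p that by (auto simp: is_type_def)
  have rl: "psat C c (rl f) \<longleftrightarrow> psat CL c f" if "c \<in> tuples CL m" "f \<in> p" for c f
    using pf[OF that(2)] tuplesD[OF that(1)] sat_relL[of "c @ snd f" "fst f"]
    by (cases f) (auto simp: rl_def psat_def pfm_in_def)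
  have part: "(\<forall>i<m. psat C c (Rel sL [i], [])) \<longleftrightarrow> c \<in> tuples CL m" if "c \<in> tuples C m" for c
    using tuplesD[OF that] by (auto simp: psat_def rel_sL tuples_def set_conv_nth subset_iff in_lists_conv_set)
  have "is_type \<tau>' C m P"
    unfolding is_type_def
  proof (intro conjI ballI allI impI)
    fix f assume "f \<in> P"
    then consider g where "g \<in> p" "f = rl g" | i where "i < m" "f = (Rel sL [i], [])"
      by (auto simp: P_def)
    then show "pfm_in \<tau>' (univ C) m f"
    proof cases
      case 1
      then show ?thesis using pf[of g] univ_C fm_in_relL by (cases g) (auto simp: rl_def pfm_in_def)
    next
      case 2
      then show ?thesis using fm_in_part[OF sL_cases, of \<tau> m i] by (simp add: pfm_in_def del: fm_in.simps)
    qed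
  next
    fix q assume q: "finite q \<and> q \<subseteq> P"
    then obtain p0 where p0: "p0 \<subseteq> p" "finite p0" "q \<inter> rl ` p = rl ` p0"
      using finite_subset_image[of "q \<inter> rl ` p" rl p] by auto
    obtain c where c: "c \<in> tuples CL m" "\<And>f. f \<in> p0 \<Longrightarrow> psat CL c f"
      using p p0(1,2) by (auto simp: is_type_def realizations_def)
    have cC: "c \<in> tuples C m" using tuplesD[OF c(1)] univ_C by (intro tuplesI) auto
    have "psat C c f" if "f \<in> q" for f
    proof (cases "f \<in> rl ` p")
      case True
      then obtain g where "g \<in> p0" "f = rl g" using \<open>f \<in> q\<close> p0(3) by blast
      then show ?thesis using rl[OF c(1)] c(2) p0(1) by blast
    next
      case False
      then obtain i where "i < m" "f = (Rel sL [i], [])" using \<open>f \<in> q\<close> q by (auto simp: P_def)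
      then show ?thesis using part[OF cC] c(1) by blast
    qed
    then have "c \<in> realizations C m q" using cC by (simp add: realizations_def)
    then show "realizations C m q \<noteq> {}" by blast
  qed
  moreover have "finite (Dom P)"
  proof -
    have "Dom P \<subseteq> Dom p" by (auto simp: Dom_def P_def rl_def split: prod.splits)
    then show ?thesis using p finite_subset by blast
  qed
  ultimately obtain c where c: "c \<in> tuples C m" "\<And>f. f \<in> P \<Longrightarrow> psat C c f"
    using C unfolding fsat_def realizations_def by blast
  have cL: "c \<in> tuples CL m" using part[OF c(1)] c(2) by (auto simp: P_def)
  have "psat CL c f" if "f \<in> p" for f using rl[OF cL that] c(2)[of "rl f"] that by (auto simp: P_def)
  then have "c \<in> realizations CL m p" using cL by (simp add: realizations_def)
  then show "realizations CL m p \<noteq> {}" by blast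
qed

end

section \<open>Passing between a sum and its left part\<close>

context sum_parts
begin

text \<open>A relation inside the left part leaves only the empty relation to check on the
  right.\<close>

lemma elem_up: assumes "elem \<tau> CL CL P" shows "elem \<tau>' C C P"
proof (rule elem_of_parts)
  have PU: "P \<subseteq> univ CL \<times> univ CL" by (rule elem_univ[OF assms])
  then show "P \<subseteq> univ CL \<times> univ CL \<union> univ CR \<times> univ CR" by blast
  show "elem \<tau> CL CL (P \<inter> univ CL \<times> univ CL)" by (rule elem_mono[OF assms]) blast
  have "P \<inter> univ CR \<times> univ CR = {}" using PU disj by blast
  then show "elem \<tau> CR CR (P \<inter> univ CR \<times> univ CR)" using elem_Id_on[of "{}" CR \<tau>] by simp
qed

text \<open>Elementary relations respect \<open>sL\<close>, so corresponding tuples have their left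
  entries at the same places, and filtering keeps them aligned.\<close>

lemma indisc_L:
  assumes a: "indisc \<tau>' C A n I r a"
  shows "indisc \<tau> CL (A \<inter> univ CL) n I r (\<lambda>u. LL (a u))"
  unfolding indisc_def
proof (intro conjI ballI allI impI)
  fix u assume "u \<in> index_set n I r"
  show "set (LL (a u)) \<subseteq> univ CL" by auto
next
  fix Z assume Z: "Z \<subseteq> index_set n I r \<times> index_set n I r" "same_qftp r r Z"
  note E = indisc_elem[OF a Z]
  have len: "length (a u) = length (a v)" if "(u, v) \<in> Z" for u v
    using conjunct2[OF a[unfolded indisc_def], rule_format, OF Z] that by auto
  have f: "length (LL (a u)) = length (LL (a v)) \<and>
      set (zip (LL (a u)) (LL (a v))) = {(x, y) \<in> set (zip (a u) (a v)). inL x}" if "(u, v) \<in> Z" for u v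
  proof (rule set_zip_filter[OF len[OF that]])
    fix x y assume "(x, y) \<in> set (zip (a u) (a v))"
    then have "(x, y) \<in> Id_on A \<union> pairs a a Z" using pairsI[OF that, of x y a a] by blast
    then show "inL x \<longleftrightarrow> inL y" by (rule elem_inL[OF E])
  qed
  then show "\<And>z. z \<in> Z \<Longrightarrow> case z of (u, v) \<Rightarrow> length (LL (a u)) = length (LL (a v))" by auto
  have "pairs (\<lambda>u. LL (a u)) (\<lambda>u. LL (a u)) Z \<subseteq> (Id_on A \<union> pairs a a Z) \<inter> univ CL \<times> univ CL"
  proof (rule subrelI)
    fix x y assume "(x, y) \<in> pairs (\<lambda>u. LL (a u)) (\<lambda>u. LL (a u)) Z"
    then obtain u v where uv: "(u, v) \<in> Z" "(x, y) \<in> set (zip (LL (a u)) (LL (a v)))"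
      by (auto simp: pairs_def)
    then have "(x, y) \<in> set (zip (a u) (a v))" using f by blast
    then have "(x, y) \<in> pairs a a Z" by (rule pairsI[OF uv(1)])
    moreover have "inL x" "inL y" using set_zip_leftD[OF uv(2)] set_zip_rightD[OF uv(2)] by auto
    ultimately show "(x, y) \<in> (Id_on A \<union> pairs a a Z) \<inter> univ CL \<times> univ CL" by blast
  qed
  then have "Id_on (A \<inter> univ CL) \<union> pairs (\<lambda>u. LL (a u)) (\<lambda>u. LL (a u)) Z \<subseteq>
      (Id_on A \<union> pairs a a Z) \<inter> univ CL \<times> univ CL" by blast
  then show "elem \<tau> CL CL (Id_on (A \<inter> univ CL) \<union> pairs (\<lambda>u. LL (a u)) (\<lambda>u. LL (a u)) Z)"
    by (rule elem_mono[OF elem_L[OF E]])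
qed

lemma indisc_up:
  assumes a: "indisc \<tau> CL A n I r a" shows "indisc \<tau>' C A n I r a"
  using a elem_up univ_C unfolding indisc_def by (simp add: subset_iff)

text \<open>Besides relativizing the formula, forces the \<open>m\<close> free variables into the
  left part, which \<open>relL\<close> alone does not do.\<close>

definition up :: "nat \<Rightarrow> ('s, 'a) pfm \<Rightarrow> ('s sum_sym, 'a) pfm" where
  "up m = (\<lambda>(\<phi>, d). (conjs (relL \<phi> # map (\<lambda>i. Rel sL [i]) [0..<m]), d))"

lemma pfm_in_up:
  assumes "pfm_in \<tau> (univ CL) m f" shows "pfm_in \<tau>' (univ C) m (up m f)"
proof -
  obtain \<phi> d where f: "f = (\<phi>, d)" by force
  have "fm_in \<tau>' (m + length d) (relL \<phi>)" "set d \<subseteq> univ C"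
    using assms fm_in_relL univ_C by (auto simp: f pfm_in_def)
  moreover have "fm_in \<tau>' (m + length d) (Rel sL [i])" if "i < m" for i
    using fm_in_part[OF sL_cases, of \<tau> "m + length d" i] that by (simp del: fm_in.simps)
  ultimately show ?thesis by (simp add: f up_def pfm_in_def del: fm_in.simps)
qed

lemma psat_up:
  assumes f: "pfm_in \<tau> (univ CL) m f" and c: "c \<in> tuples C m"
  shows "psat C c (up m f) \<longleftrightarrow> c \<in> tuples CL m \<and> psat CL c f"
proof -
  obtain \<phi> d where fd: "f = (\<phi>, d)" by force
  have len: "length c = m" using tuplesD[OF c] by simp
  have "psat C c (up m f) \<longleftrightarrow> sat C (c @ d) (relL \<phi>) \<and> (\<forall>i<m. inL (c ! i))"
    by (auto simp: fd up_def psat_def rel_sL nth_append len)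
  also have "(\<forall>i<m. inL (c ! i)) \<longleftrightarrow> c \<in> tuples CL m"
    using len by (simp add: tuples_def in_lists_conv_set all_set_conv_all_nth)
  finally have *: "psat C c (up m f) \<longleftrightarrow> sat C (c @ d) (relL \<phi>) \<and> c \<in> tuples CL m" .
  have "sat C (c @ d) (relL \<phi>) \<longleftrightarrow> psat CL c f" if "c \<in> tuples CL m"
    using sat_relL[of "c @ d" \<phi>] f tuplesD[OF that] by (auto simp: fd pfm_in_def psat_def)
  with * show ?thesis by blast
qed

lemma contrast_subset:
  assumes a: "indisc \<tau>1 D A n UNIV natle a" and il: "interleaved UNIV natle n s t"
    and A: "A \<subseteq> univ D" and i: "i < n"
  shows "contrast l a A s t i \<subseteq> univ D \<times> univ D"
proof -
  have "set (a (Inl k)) \<subseteq> univ D" for k by (rule indisc_univ[OF a]) simp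
  then have "set (zip (a (Inl (s i))) (a (Inl (t i)))) \<subseteq> univ D \<times> univ D"
    by (auto dest: set_zip_leftD set_zip_rightD)
  then show ?thesis
    unfolding contrast_def using A params_subset[OF a il linear_natle i, of l] by blast
qed

text \<open>The same family divides: for realizations in the left part the comparison takes place
  inside \<open>CL\<close>, so \<open>elem_L\<close> brings an agreement of types down.\<close>

lemma ndiv_up:
  assumes nd: "ndiv l \<tau> CL n m f A" and f: "pfm_in \<tau> (univ CL) m f" and A: "A \<subseteq> univ CL"
  shows "ndiv l \<tau>' C n m (up m f) A"
proof -
  obtain a s t where a: "indisc \<tau> CL A n UNIV natle a"
    and nil: "l \<noteq> 3 \<longrightarrow> (\<forall>ts. Inr ts \<in> index_set n UNIV natle \<longrightarrow> a (Inr ts) = [])"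
    and il: "interleaved UNIV natle n s t"
    and con: "\<And>c i. c \<in> tuples CL m \<Longrightarrow> psat CL c f \<Longrightarrow> i < n \<Longrightarrow>
      \<not> elem \<tau> CL CL (Id_on (set c) \<union> contrast l a A s t i)"
    using nd unfolding gdiv_def by blast
  have "\<not> elem \<tau>' C C (Id_on (set c) \<union> contrast l a A s t i)"
    if c: "c \<in> tuples C m" "psat C c (up m f)" and i: "i < n" for c i
  proof
    assume E: "elem \<tau>' C C (Id_on (set c) \<union> contrast l a A s t i)"
    have c': "c \<in> tuples CL m" "psat CL c f" using psat_up[OF f c(1)] c(2) by auto
    have "contrast l a A s t i \<subseteq> univ CL \<times> univ CL" by (rule contrast_subset[OF a il A i])
    then have "elem \<tau> CL CL (Id_on (set c) \<union> contrast l a A s t i)"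
      using tuplesD[OF c'(1)] by (intro elem_mono[OF elem_L[OF E]]) blast
    with con[OF c' i] show False by blast
  qed
  then have "\<forall>c\<in>tuples C m. psat C c (up m f) \<longrightarrow>
      (\<forall>i<n. \<not> elem \<tau>' C C (Id_on (set c) \<union> contrast l a A s t i))" by blast
  with indisc_up[OF a] nil il show ?thesis unfolding gdiv_def by blast
qed

lemma nonsd_up:
  assumes "nonsd l \<tau> CL" shows "nonsd l \<tau>' C"
proof -
  from assms obtain m c B where mcB: "c \<in> tuples CL m \<and> countable B \<and> B \<subseteq> univ CL \<and>
     (\<forall>n A. finite A \<and> A \<subseteq> B \<longrightarrow> nfork l \<tau> CL n m c B A)"
    unfolding nonsd_def by (elim exE)
  then have c: "c \<in> tuples CL m" and B: "countable B" "B \<subseteq> univ CL" by simp_all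
  have fk: "nfork l \<tau> CL n m c B A" if "finite A" "A \<subseteq> B" for n A
    using mcB that by (elim conjE) simp
  have "nfork l \<tau>' C n m c B A" if A: "finite A \<and> A \<subseteq> B" for n A
  proof -
    obtain b F where bF: "finite b" "b \<subseteq> B" "finite F"
      "\<And>f. f \<in> F \<Longrightarrow> pfm_in \<tau> (univ CL) m f \<and> ndiv l \<tau> CL n m f A"
      "\<And>c'. c' \<in> tuples CL m \<Longrightarrow> elem \<tau> CL CL (set (zip c c') \<union> Id_on b) \<Longrightarrow> \<exists>f\<in>F. psat CL c' f"
      using fk[OF conjunct1[OF A] conjunct2[OF A], of n] unfolding nfork_def by blast
    have AU: "A \<subseteq> univ CL" using A B by blast
    have "pfm_in \<tau>' (univ C) m g \<and> ndiv l \<tau>' C n m g A" if "g \<in> up m ` F" for g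
    proof -
      obtain f where f: "f \<in> F" "g = up m f" using \<open>g \<in> up m ` F\<close> by blast
      show ?thesis
        unfolding f(2) using bF(4)[OF f(1)] pfm_in_up ndiv_up[OF _ _ AU] by blast
    qed
    moreover have "\<exists>g\<in>up m ` F. psat C c' g"
      if c': "c' \<in> tuples C m" and E: "elem \<tau>' C C (set (zip c c') \<union> Id_on b)" for c'
    proof -
      have len: "length c = length c'" using tuplesD[OF c] tuplesD[OF c'] by simp
      \<comment> \<open>\<open>c'\<close> has the type of \<open>c\<close> over \<open>b\<close>,
        and this type says that all coordinates lie in the left part.\<close>
      have "set c' \<subseteq> univ CL"
      proof
        fix y assume "y \<in> set c'"
        then obtain x where x: "(x, y) \<in> set (zip c c')" using len
          by (metis in_set_impl_in_set_zip2)
        then have "inL x" using tuplesD[OF c] set_zip_leftD by fastforce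
        then show "inL y" using elem_inL[OF E, of x y] x by blast
      qed
      then have c'L: "c' \<in> tuples CL m" using tuplesD[OF c'] by (intro tuplesI) auto
      have "set (zip c c') \<subseteq> univ CL \<times> univ CL"
        using in_lists_zip[OF len] tuplesD[OF c] tuplesD[OF c'L] by blast
      moreover have "b \<subseteq> univ CL" using bF(2) B(2) by blast
      ultimately have "elem \<tau> CL CL (set (zip c c') \<union> Id_on b)"
        by (intro elem_mono[OF elem_L[OF E]]) blast
      from bF(5)[OF c'L this] obtain f where f: "f \<in> F" "psat CL c' f" by blast
      then have "psat C c' (up m f)" using psat_up[OF _ c'] bF(4) c'L by blast
      then show ?thesis using f(1) by blast
    qed
    ultimately show ?thesis
      unfolding nfork_def using bF(1-3) by (intro exI[of _ b] exI[of _ "up m ` F"]) simp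
  qed
  moreover have "c \<in> tuples C m" using tuplesD[OF c] univ_C by (intro tuplesI) auto
  moreover have "B \<subseteq> univ C" using B(2) univ_C by blast
  ultimately show ?thesis
    unfolding nonsd_def using B(1) by (intro exI[of _ m] exI[of _ c] exI[of _ B]) simp
qed

text \<open>Reassembles a left and a right tuple in the order of sides prescribed by
  \<open>c\<close>. This is how separate witnesses become one.\<close>

lemma merge:
  assumes "set c \<subseteq> univ C" "length cl = length (LL c)" "set cl \<subseteq> univ CL"
    "length cr = length (RR c)" "set cr \<subseteq> univ CR"
  shows "\<exists>c'. length c' = length c \<and> map inL c' = map inL c \<and> LL c' = cl \<and> RR c' = cr \<and>
    set (zip c c') = set (zip (LL c) cl) \<union> set (zip (RR c) cr)"
  using assms
proof (induction c arbitrary: cl cr)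
  case (Cons x c)
  show ?case
  proof (cases "inL x")
    case True
    then have nR: "\<not> inR x" using disj by blast
    then obtain y ys where cl: "cl = y # ys" using Cons.prems True by (cases cl) auto
    have "\<exists>c'. length c' = length c \<and> map inL c' = map inL c \<and> LL c' = ys \<and> RR c' = cr \<and>
      set (zip c c') = set (zip (LL c) ys) \<union> set (zip (RR c) cr)"
      by (rule Cons.IH) (use Cons.prems True nR cl in auto)
    then obtain c' where "length c' = length c" "map inL c' = map inL c" "LL c' = ys" "RR c' = cr"
      "set (zip c c') = set (zip (LL c) ys) \<union> set (zip (RR c) cr)" by blast
    moreover have "inL y" "\<not> inR y" using Cons.prems cl disj by auto
    ultimately show ?thesis using True nR cl by (intro exI[of _ "y # c'"]) simp
  next
    case False
    then have R: "inR x" using Cons.prems(1) univ_C by auto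
    then obtain y ys where cr: "cr = y # ys" using Cons.prems by (cases cr) auto
    have "\<exists>c'. length c' = length c \<and> map inL c' = map inL c \<and> LL c' = cl \<and> RR c' = ys \<and>
      set (zip c c') = set (zip (LL c) cl) \<union> set (zip (RR c) ys)"
      by (rule Cons.IH) (use Cons.prems False R cr in auto)
    then obtain c' where "length c' = length c" "map inL c' = map inL c" "LL c' = cl" "RR c' = ys"
      "set (zip c c') = set (zip (LL c) cl) \<union> set (zip (RR c) ys)" by blast
    moreover have "\<not> inL y" "inR y" using Cons.prems cr disj by auto
    ultimately show ?thesis using False R cr by (intro exI[of _ "y # c'"]) simp
  qed
qed simp

end

section \<open>Dropping stages of a dividing pattern\<close>

text \<open>Replaces the failure of elementarity at one \<open>c\<close> by a formula over the
  finite list \<open>bs\<close> that forces the failure for every tuple satisfying it; this is what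
  makes compactness applicable.\<close>

lemma elem_witness:
  assumes Q: "Q \<subseteq> set bs \<times> set bs" and bs: "set bs \<subseteq> univ C" and c: "c \<in> tuples C m"
    and ne: "\<not> elem \<tau> C C (Id_on (set c) \<union> Q)"
  obtains \<gamma> where "fm_in \<tau> (m + length bs) \<gamma>" "sat C (c @ bs) \<gamma>"
    "\<And>c'. c' \<in> tuples C m \<Longrightarrow> sat C (c' @ bs) \<gamma> \<Longrightarrow> \<not> elem \<tau> C C (Id_on (set c') \<union> Q)"
proof -
  have lc: "length c = m" using tuplesD[OF c] by simp
  have "Id_on (set c) \<union> Q \<subseteq> univ C \<times> univ C" using Q bs tuplesD[OF c] by blast
  then obtain ps \<phi> where ps: "set ps \<subseteq> Id_on (set c) \<union> Q" and \<phi>: "fm_in \<tau> (length ps) \<phi>"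
    and diff: "sat C (map fst ps) \<phi> \<noteq> sat C (map snd ps) \<phi>"
    using ne unfolding elem_def by blast
  \<comment> \<open>Diagonal pairs coming from \<open>c\<close> are recorded by their coordinate, so
    they follow when \<open>c\<close> is replaced; pairs from \<open>Q\<close> are recorded by
    positions in \<open>bs\<close> and stay fixed.\<close>
  have "\<exists>i k. i < m + length bs \<and> k < m + length bs \<and> (c @ bs) ! i = fst p \<and> (c @ bs) ! k = snd p \<and>
      (i = k \<and> i < m \<or> m \<le> i \<and> m \<le> k \<and> p \<in> Q)" if "p \<in> set ps" for p
  proof (cases "p \<in> Q")
    case True
    then have "fst p \<in> set bs" "snd p \<in> set bs" using Q by auto
    then obtain i k where "i < length bs" "bs ! i = fst p" "k < length bs" "bs ! k = snd p"
      by (metis in_set_conv_nth)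
    then show ?thesis using True lc by (intro exI[of _ "m + i"] exI[of _ "m + k"]) (simp add: nth_append)
  next
    case False
    then have "p \<in> Id_on (set c)" using that ps by blast
    then obtain y where "p = (y, y)" "y \<in> set c" by auto
    then obtain i where "i < m" "p = (c ! i, c ! i)" using lc by (metis in_set_conv_nth)
    then show ?thesis using lc by (intro exI[of _ i]) (simp add: nth_append)
  qed
  then obtain g1 g2 where g: "\<And>p. p \<in> set ps \<Longrightarrow> g1 p < m + length bs \<and> g2 p < m + length bs \<and>
      (c @ bs) ! g1 p = fst p \<and> (c @ bs) ! g2 p = snd p \<and>
      (g1 p = g2 p \<and> g1 p < m \<or> m \<le> g1 p \<and> m \<le> g2 p \<and> p \<in> Q)" by metis
  define \<phi>1 where "\<phi>1 = ren (\<lambda>k. g1 (ps ! k)) \<phi>"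
  define \<phi>2 where "\<phi>2 = ren (\<lambda>k. g2 (ps ! k)) \<phi>"
  \<comment> \<open>Exclusive disjunction: the distinguishing formula has different truth values on
    the first and on the second components.\<close>
  define \<gamma> where "\<gamma> = Conj (Neg (Conj \<phi>1 \<phi>2)) (Neg (Conj (Neg \<phi>1) (Neg \<phi>2)))"
  have "fm_in \<tau> (m + length bs) \<phi>1" "fm_in \<tau> (m + length bs) \<phi>2"
    unfolding \<phi>1_def \<phi>2_def by (rule fm_in_ren[OF \<phi>], simp add: g)+
  then have 1: "fm_in \<tau> (m + length bs) \<gamma>" by (simp add: \<gamma>_def)
  have sat: "sat C (c' @ bs) \<gamma> \<longleftrightarrow>
      sat C (map (\<lambda>p. (c' @ bs) ! g1 p) ps) \<phi> \<noteq> sat C (map (\<lambda>p. (c' @ bs) ! g2 p) ps) \<phi>" for c'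
  proof -
    have "sat C (c' @ bs) \<phi>1 \<longleftrightarrow> sat C (map (\<lambda>p. (c' @ bs) ! g1 p) ps) \<phi>"
      unfolding \<phi>1_def by (rule sat_ren[OF \<phi>]) simp
    moreover have "sat C (c' @ bs) \<phi>2 \<longleftrightarrow> sat C (map (\<lambda>p. (c' @ bs) ! g2 p) ps) \<phi>"
      unfolding \<phi>2_def by (rule sat_ren[OF \<phi>]) simp
    ultimately show ?thesis by (auto simp: \<gamma>_def)
  qed
  have E: "map (\<lambda>p. (c @ bs) ! g1 p) ps = map fst ps" "map (\<lambda>p. (c @ bs) ! g2 p) ps = map snd ps"
    using g by auto
  have 2: "sat C (c @ bs) \<gamma>" unfolding sat E by (rule diff)
  have 3: "\<not> elem \<tau> C C (Id_on (set c') \<union> Q)" if c': "c' \<in> tuples C m" and s: "sat C (c' @ bs) \<gamma>" for c'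
  proof
    assume E: "elem \<tau> C C (Id_on (set c') \<union> Q)"
    let ?ps = "map (\<lambda>p. ((c' @ bs) ! g1 p, (c' @ bs) ! g2 p)) ps"
    have lc': "length c' = m" using tuplesD[OF c'] by simp
    have bb: "(c' @ bs) ! i = (c @ bs) ! i" if "m \<le> i" for i using that lc lc' by (simp add: nth_append)
    have "((c' @ bs) ! g1 p, (c' @ bs) ! g2 p) \<in> Id_on (set c') \<union> Q" if "p \<in> set ps" for p
    proof (cases "g1 p = g2 p \<and> g1 p < m")
      case True
      then show ?thesis using lc' by (auto simp: nth_append)
    next
      case False
      then have "m \<le> g1 p" "m \<le> g2 p" "p \<in> Q" "(c @ bs) ! g1 p = fst p" "(c @ bs) ! g2 p = snd p"
        using g[OF that] by auto
      then show ?thesis by (simp add: bb)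
    qed
    then have "set ?ps \<subseteq> Id_on (set c') \<union> Q" by auto
    from elem_sat[OF E this, of \<phi>] \<phi> s show False unfolding sat by (simp add: comp_def)
  qed
  from 1 2 3 show thesis by (rule that)
qed

locale blocks =
  fixes s t x :: "nat \<Rightarrow> nat" and n N W :: nat and \<eta> :: "nat \<Rightarrow> bool"
  assumes s_mono: "\<And>i j. i < j \<Longrightarrow> j < N \<Longrightarrow> s i < s j"
    and s_less_t: "\<And>i. i < N \<Longrightarrow> s i < t i"
    and t_le_s: "\<And>i. Suc i < N \<Longrightarrow> t i \<le> s (Suc i)"
    and x_less: "\<And>j. j < n \<Longrightarrow> x j < N"
    and x_gap: "\<And>i j. i < j \<Longrightarrow> j < n \<Longrightarrow> x i + 2 \<le> x j"
    and s_less_W: "\<And>i. i < N \<Longrightarrow> s i < W" and t_less_W: "\<And>i. i < N \<Longrightarrow> t i < W"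
begin

text \<open>Room for one block: an offset below \<open>W\<close> plus a shift of at most
  \<open>W\<close>.\<close>

definition "V = 2 * W"

definition cnt :: "nat \<Rightarrow> nat" where
  "cnt v = card {j. j < n \<and> s (x j) \<le> v}"

text \<open>Each kept stage opens a gap of \<open>2 * V\<close>: room for the block that starts
  there and for the block of its comparison element.\<close>

definition spread :: "nat \<Rightarrow> nat" where
  "spread v = v + 2 * V * cnt v"

text \<open>Of the stages below \<open>N\<close> only \<open>x 0, x 1, \<dots>\<close> are kept.  Block \<open>q\<close> consists of the positions
  \<open>pos q i\<close> with \<open>V \<le> i\<close>; those with \<open>i < V\<close> are constants common to all blocks.  Block \<open>2 * k\<close> holds
  the spread positions of the stages from \<open>x k\<close> on, and block \<open>2 * k + 1\<close> the later element they are
  compared with, which must sit at the offset of \<open>s (x k)\<close> or of \<open>t (x k)\<close>: hence the shift.\<close>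

definition shift :: "nat \<Rightarrow> nat" where
  "shift q = (if odd q \<and> q div 2 < n \<and> \<not> \<eta> (q div 2) then t (x (q div 2)) - s (x (q div 2)) else 0)"

definition pos :: "nat \<Rightarrow> nat \<Rightarrow> nat" where
  "pos q i = (if i < V then i else V * (q + 1) + i + shift q)"

text \<open>The place of the position \<open>s k\<close> inside its block; positions before the
  first kept stage belong to the constants.\<close>

definition offset :: "nat \<Rightarrow> nat" where
  "offset k = (if cnt (s k) = 0 then s k else V + s k)"

text \<open>A sequence of blocks becomes a sequence of positions running through all stages before
  the next kept one, since omitted stages count as parameters too. If \<open>cnt (s k) = 0\<close>,
  the truncated difference \<open>cnt (s k) - 1\<close> is harmless: the offset then names a
  constant, common to all blocks.\<close>

definition flat :: "nat list \<Rightarrow> nat list" where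
  "flat ts = map (\<lambda>k. pos (ts ! (cnt (s k) - 1)) (offset k)) [0..<x (length ts)]"

definition expand :: "nat + nat list \<Rightarrow> (nat + nat list) list" where
  "expand u = (case u of Inl q \<Rightarrow> map (\<lambda>i. Inl (pos q i)) [0..<V + W] | Inr ts \<Rightarrow> [Inr (flat ts)])"

lemma s_le_iff: "i < N \<Longrightarrow> k < N \<Longrightarrow> s i \<le> s k \<longleftrightarrow> i \<le> k"
  using s_mono[of i k] s_mono[of k i] by (metis le_less_linear less_imp_le linorder_neqE_nat not_le order_refl)

lemma x_mono: "i < j \<Longrightarrow> j < n \<Longrightarrow> x i < x j"
  using x_gap[of i j] by simp

lemma cnt_mono: "v \<le> w \<Longrightarrow> cnt v \<le> cnt w"
  unfolding cnt_def by (rule card_mono) auto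

text \<open>The kept stages increase, so those starting at or before \<open>v\<close> form an
  initial segment.\<close>

lemma cnt_stage:
  assumes "k < n" "s (x k) \<le> v" "Suc k < n \<Longrightarrow> v < s (x (Suc k))"
  shows "cnt v = Suc k"
proof -
  have le: "s (x i) \<le> s (x j)" if "i \<le> j" "j < n" for i j
    using that x_mono[of i j] s_mono[of "x i" "x j"] x_less[of j] by (cases "i = j") auto
  have "{j. j < n \<and> s (x j) \<le> v} = {..k}"
  proof (intro set_eqI iffI)
    fix j assume "j \<in> {j. j < n \<and> s (x j) \<le> v}"
    then have j: "j < n" "s (x j) \<le> v" by auto
    show "j \<in> {..k}"
    proof (rule ccontr)
      assume "j \<notin> {..k}"
      then have "Suc k \<le> j" by simp
      then have "s (x (Suc k)) \<le> s (x j)" "Suc k < n" using j le by auto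
      with assms(3) j(2) show False by simp
    qed
  next
    fix j assume "j \<in> {..k}"
    then show "j \<in> {j. j < n \<and> s (x j) \<le> v}" using le[of j k] assms(1,2) by auto
  qed
  then show ?thesis by (simp add: cnt_def)
qed

text \<open>Here the gap of 2 is used: the omitted stage in between absorbs a possible equality
  \<open>t i = s (Suc i)\<close>.\<close>

lemma t_less_s: "k < n \<Longrightarrow> Suc k < n \<Longrightarrow> t (x k) < s (x (Suc k))"
proof -
  assume k: "k < n" "Suc k < n"
  have gap: "Suc (x k) < x (Suc k)" using x_gap[of k "Suc k"] k by simp
  have xN: "x (Suc k) < N" by (rule x_less[OF k(2)])
  have "t (x k) \<le> s (Suc (x k))" using t_le_s gap xN by simp
  also have "\<dots> < s (x (Suc k))" by (rule s_mono[OF gap xN])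
  finally show ?thesis .
qed

lemma cnt_s: "k < n \<Longrightarrow> cnt (s (x k)) = Suc k"
  by (rule cnt_stage) (use x_mono x_less s_mono in auto)

lemma cnt_t: "k < n \<Longrightarrow> cnt (t (x k)) = Suc k"
  by (rule cnt_stage) (use less_imp_le[OF s_less_t[OF x_less]] t_less_s in auto)

lemma cnt_le:
  assumes "k < n" "i < x k" shows "cnt (s i) \<le> k"
proof -
  have "{j. j < n \<and> s (x j) \<le> s i} \<subseteq> {..<k}"
  proof
    fix j assume "j \<in> {j. j < n \<and> s (x j) \<le> s i}"
    then have j: "j < n" "x j \<le> i" using s_le_iff[of "x j" i] x_less x_less[OF assms(1)] assms(2) by auto
    show "j \<in> {..<k}"
    proof (rule ccontr)
      assume "j \<notin> {..<k}"
      then have "x k \<le> x j" using x_mono[of k j] j(1) by (cases "k = j") auto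
      with j(2) assms(2) show False by simp
    qed
  qed
  then have "cnt (s i) \<le> card {..<k}" unfolding cnt_def by (intro card_mono) auto
  then show ?thesis by simp
qed

lemma shift_less: "shift q \<le> W"
  using t_less_W[OF x_less, of "q div 2"] by (auto simp: shift_def)

text \<open>Block \<open>q\<close> occupies positions from \<open>V * (q + 2)\<close> to below
  \<open>V * (q + 3)\<close>, so blocks are disjoint and ordered by their numbers, after all
  constants.\<close>

lemma pos_less:
  assumes "i < V + W" "k < V + W"
  shows "pos q i < pos p k \<longleftrightarrow> (if i < V then k < V \<longrightarrow> i < k else V \<le> k \<and> (q < p \<or> q = p \<and> i < k))"
proof -
  have big: "V * (q' + 1) + i' + shift q' < V * (p' + 1) + k' + shift p'"
    if "q' < p'" "V \<le> k'" "i' < V + W" for q' p' i' k'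
  proof -
    have "V * (q' + 1) + i' + shift q' < V * (q' + 2) + V"
      using that(3) shift_less[of q'] by (simp add: V_def)
    also have "\<dots> \<le> V * (p' + 1) + k'"
      by (rule add_mono[OF mult_le_mono2 that(2)]) (use that(1) in simp)
    finally show ?thesis by simp
  qed
  show ?thesis
  proof (cases "i < V")
    case True
    then show ?thesis by (auto simp: pos_def)
  next
    case i: False
    show ?thesis
    proof (cases "k < V")
      case True
      then show ?thesis using i by (auto simp: pos_def)
    next
      case False
      then show ?thesis
        using i big[of q p k i] big[of p q i k] assms
        by (cases q p rule: linorder_cases) (auto simp: pos_def)
    qed
  qed
qed

lemma pos_eq:
  assumes "i < V + W" "k < V + W"
  shows "pos q i = pos p k \<longleftrightarrow> i = k \<and> (i < V \<or> q = p)"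
  using pos_less[OF assms, of q p] pos_less[OF assms(2,1), of p q]
  by (auto split: if_splits)

lemma s_less_V: "i < N \<Longrightarrow> s i < V"
  using s_less_W[of i] by (simp add: V_def)

lemma offset_less: "i < N \<Longrightarrow> offset i < V + W"
  using s_less_W[of i] by (simp add: offset_def V_def)

lemma offset_V: "i < N \<Longrightarrow> offset i < V \<longleftrightarrow> cnt (s i) = 0"
  using s_less_V[of i] by (simp add: offset_def)

lemma pos_spread:
  assumes "k < n" "v < W" "cnt v = Suc k" shows "pos (2 * k) (V + v) = spread v"
  using assms by (simp add: pos_def spread_def shift_def algebra_simps)

lemma pos_odd:
  assumes "k < n"
  shows "pos (2 * k + 1) (V + (if \<eta> k then t (x k) else s (x k))) = V * (2 * k + 3) + t (x k)"
  using assms s_less_t[OF x_less[OF assms]] by (auto simp: pos_def shift_def algebra_simps)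

lemma spread_mono: "v < w \<Longrightarrow> spread v < spread w"
  using cnt_mono[of v w] by (simp add: spread_def add_less_le_mono)

text \<open>Identifies the tuple attached to the sequence of blocks \<open>0, 2, ...\<close> with
  the one attached to the original sequence of stages; needed for \<open>l = 3\<close>.\<close>

lemma flat_stages:
  assumes k: "k < n" shows "flat (map (\<lambda>j. 2 * j) [0..<k]) = map spread (map s [0..<x k])"
  unfolding flat_def
proof (simp, intro ballI)
  fix i assume "i \<in> {0..<x k}"
  then have i: "i < x k" by simp
  have iN: "i < N" using i x_less[OF k] by simp
  note c = cnt_le[OF k i]
  show "pos (map (\<lambda>j. 2 * j) [0..<k] ! (cnt (s i) - Suc 0)) (offset i) = spread (s i)"
  proof (cases "cnt (s i)")
    case 0
    then show ?thesis using s_less_V[OF iN] by (simp add: pos_def offset_def spread_def)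
  next
    case (Suc j)
    then have "j < k" using c by simp
    then show ?thesis using Suc pos_spread[of j "s i"] s_less_W[OF iN] k by (simp add: offset_def)
  qed
qed

lemma length_flat: "length (flat ts) = x (length ts)"
  by (simp add: flat_def)

lemma flat_nth: "k < x (length ts) \<Longrightarrow> flat ts ! k = pos (ts ! (cnt (s k) - 1)) (offset k)"
  by (simp add: flat_def)

lemma flat_mem:
  assumes "Inr ts \<in> index_set n UNIV natle" shows "Inr (flat ts) \<in> index_set N UNIV natle"
proof -
  have ts: "length ts < n" "\<And>i j. i < j \<Longrightarrow> j < length ts \<Longrightarrow> ts ! i < ts ! j"
    using assms by (auto simp: sorted_wrt_iff_nth_less)
  have "flat ts ! i < flat ts ! k" if "i < k" "k < x (length ts)" for i k
  proof -
    have ik: "i < N" "k < N" "i < x (length ts)" using that x_less[OF ts(1)] by auto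
    have s: "s i < s k" by (rule s_mono[OF that(1) ik(2)])
    have cc: "cnt (s i) \<le> cnt (s k)" by (rule cnt_mono) (use s in simp)
    have ck: "cnt (s k) \<le> length ts" by (rule cnt_le[OF ts(1) that(2)])
    show ?thesis
      unfolding flat_nth[OF ik(3)] flat_nth[OF that(2)] pos_less[OF offset_less[OF ik(1)] offset_less[OF ik(2)]]
        offset_V[OF ik(1)] offset_V[OF ik(2)]
    proof (cases "cnt (s i) = 0")
      case True
      then show "if cnt (s i) = 0 then cnt (s k) = 0 \<longrightarrow> offset i < offset k
        else V \<le> offset k \<and> (ts ! (cnt (s i) - 1) < ts ! (cnt (s k) - 1) \<or>
          ts ! (cnt (s i) - 1) = ts ! (cnt (s k) - 1) \<and> offset i < offset k)"
        using s by (simp add: offset_def)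
    next
      case False
      then have k0: "cnt (s k) \<noteq> 0" using cc by simp
      have "ts ! (cnt (s i) - 1) < ts ! (cnt (s k) - 1) \<or>
          ts ! (cnt (s i) - 1) = ts ! (cnt (s k) - 1) \<and> offset i < offset k"
      proof (cases "cnt (s i) = cnt (s k)")
        case True
        then show ?thesis using s False k0 by (simp add: offset_def)
      next
        case ne: False
        then have "ts ! (cnt (s i) - 1) < ts ! (cnt (s k) - 1)"
          by (intro ts(2)) (use cc ck False in auto)
        then show ?thesis ..
      qed
      then show "if cnt (s i) = 0 then cnt (s k) = 0 \<longrightarrow> offset i < offset k
        else V \<le> offset k \<and> (ts ! (cnt (s i) - 1) < ts ! (cnt (s k) - 1) \<or>
          ts ! (cnt (s i) - 1) = ts ! (cnt (s k) - 1) \<and> offset i < offset k)"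
        using False k0 by (simp add: offset_def)
    qed
  qed
  then show ?thesis
    using x_less[OF ts(1)] by (simp add: sorted_wrt_iff_nth_less length_flat)
qed

lemma expand_mem: "u \<in> index_set n UNIV natle \<Longrightarrow> set (expand u) \<subseteq> index_set N UNIV natle"
  using flat_mem by (cases u) (auto simp: expand_def simp del: Inr_index_set)

text \<open>Entry number \<open>x j\<close> of \<open>flat ts\<close> lies in the block
  \<open>ts ! j\<close>, so \<open>ts\<close> can be read off.\<close>

lemma flat_eq_iff:
  assumes ts: "length ts < n" and us: "length us < n"
  shows "flat ts = flat us \<longleftrightarrow> ts = us"
proof
  assume eq: "flat ts = flat us"
  have "x (length ts) = x (length us)" using arg_cong[OF eq, of length] by (simp add: length_flat)
  then have len: "length ts = length us"
    using x_mono[of "length ts" "length us"] x_mono[of "length us" "length ts"] ts us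
    by (metis less_irrefl linorder_neqE_nat)
  show "ts = us"
  proof (rule nth_equalityI[OF len])
    fix j assume j: "j < length ts"
    then have jn: "j < n" using ts by simp
    have xj: "x j < x (length ts)" "x j < x (length us)" using x_mono[OF j ts] len by auto
    have "pos (ts ! j) (offset (x j)) = pos (us ! j) (offset (x j))"
      using arg_cong[OF eq, of "\<lambda>l. l ! x j"] flat_nth[OF xj(1)] flat_nth[OF xj(2)] cnt_s[OF jn] by simp
    then show "ts ! j = us ! j"
      using pos_eq[OF offset_less[OF x_less[OF jn]] offset_less[OF x_less[OF jn]]]
        offset_V[OF x_less[OF jn]] cnt_s[OF jn] by simp
  qed
qed simp

lemma pattern_Inl_Inl:
  "pattern natle (Inl q) (Inl p) = pattern natle (Inl q') (Inl p') \<longleftrightarrow> (q = p \<longleftrightarrow> q' = p') \<and> (q < p \<longleftrightarrow> q' < p')"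
  by (auto simp: pattern_def seq_length_def idx_less_def entries_def)

text \<open>Offsets are the same on both sides, so by \<open>pos_less\<close> and
  \<open>pos_eq\<close> every comparison of positions reduces to one of block numbers. Between a
  sequence and an element only equality with an entry matters, and this reduces to equality of a
  block number with an entry of the short sequence.\<close>

lemma expand_pattern:
  assumes Z: "Z \<subseteq> index_set n UNIV natle \<times> index_set n UNIV natle" "same_qftp natle natle Z"
  shows "same_qftp natle natle (pairs expand expand Z)"
proof (rule same_qftpI)
  have form: "(\<exists>q q' i. (Inl q, Inl q') \<in> Z \<and> i < V + W \<and> y = Inl (pos q i) \<and> y' = Inl (pos q' i)) \<or>
      (\<exists>ts ts'. (Inr ts, Inr ts') \<in> Z \<and> length ts < n \<and> length ts' = length ts \<and>
        y = Inr (flat ts) \<and> y' = Inr (flat ts'))"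
    if "(y, y') \<in> pairs expand expand Z" for y y'
  proof -
    obtain u v where uv: "(u, v) \<in> Z" "(y, y') \<in> set (zip (expand u) (expand v))"
      using \<open>(y, y') \<in> _\<close> by (auto simp: pairs_def)
    have l: "seq_length u = seq_length v" by (rule same_qftp_seq_length[OF Z(2) uv(1)])
    show ?thesis
    proof (cases u)
      case (Inl q)
      then obtain q' where v: "v = Inl q'" using l by (cases v) (auto simp: seq_length_def)
      obtain i where "i < V + W" "y = Inl (pos q i)" "y' = Inl (pos q' i)"
        using uv(2) Inl v by (auto simp: expand_def in_set_zip)
      then show ?thesis using uv(1) Inl v by blast
    next
      case (Inr ts)
      then obtain ts' where v: "v = Inr ts'" "length ts' = length ts" using l by (cases v) (auto simp: seq_length_def)
      have "length ts < n" using Z(1) uv(1) Inr by auto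
      then show ?thesis using uv Inr v by (auto simp: expand_def)
    qed
  qed
  fix y y' z z' assume yz: "(y, y') \<in> pairs expand expand Z" "(z, z') \<in> pairs expand expand Z"
  from form[OF yz(1)] form[OF yz(2)]
  consider
    (ll) q q' i p p' k where "(Inl q, Inl q') \<in> Z" "i < V + W" "y = Inl (pos q i)" "y' = Inl (pos q' i)"
      "(Inl p, Inl p') \<in> Z" "k < V + W" "z = Inl (pos p k)" "z' = Inl (pos p' k)"
  | (lr) q q' i us us' where "y = Inl (pos q i)" "y' = Inl (pos q' i)" "z = Inr (flat us)" "z' = Inr (flat us')"
  | (rl) ts ts' p p' k where "(Inr ts, Inr ts') \<in> Z" "length ts < n" "length ts' = length ts"
      "y = Inr (flat ts)" "y' = Inr (flat ts')"
      "(Inl p, Inl p') \<in> Z" "k < V + W" "z = Inl (pos p k)" "z' = Inl (pos p' k)"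
  | (rr) ts ts' us us' where "(Inr ts, Inr ts') \<in> Z" "length ts < n" "length ts' = length ts"
      "y = Inr (flat ts)" "y' = Inr (flat ts')"
      "(Inr us, Inr us') \<in> Z" "length us < n" "length us' = length us"
      "z = Inr (flat us)" "z' = Inr (flat us')"
    by blast
  then show "pattern natle y z = pattern natle y' z'"
  proof cases
    case ll
    have "(q = p \<longleftrightarrow> q' = p') \<and> (q < p \<longleftrightarrow> q' < p')"
      using same_qftpD[OF Z(2) ll(1) ll(5)] unfolding pattern_Inl_Inl .
    then show ?thesis
      unfolding ll(3,4,7,8) pattern_Inl_Inl pos_eq[OF ll(2,6)] pos_less[OF ll(2,6)] by simp
  next
    case lr
    then show ?thesis by (simp add: pattern_def seq_length_def idx_less_def entries_def)
  next
    case rl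
    have ent: "{k. k < length ts \<and> ts ! k = p} = {k. k < length ts' \<and> ts' ! k = p'}"
      using same_qftpD[OF Z(2) rl(1) rl(6)] by (simp add: pattern_def entries_def)
    have "flat ts ! i = pos p k \<longleftrightarrow> flat ts' ! i = pos p' k" if i: "i < x (length ts)" for i
    proof -
      have i': "i < x (length ts')" using i rl(3) by simp
      have iN: "i < N" using i x_less[OF rl(2)] by simp
      have c: "cnt (s i) \<le> length ts" by (rule cnt_le[OF rl(2) i])
      have "ts ! (cnt (s i) - 1) = p \<longleftrightarrow> ts' ! (cnt (s i) - 1) = p'" if "cnt (s i) \<noteq> 0"
      proof -
        have "cnt (s i) - 1 < length ts" using c that by simp
        then show ?thesis using ent rl(3) by auto
      qed
      then show ?thesis
        unfolding flat_nth[OF i] flat_nth[OF i'] pos_eq[OF offset_less[OF iN] rl(7)] offset_V[OF iN] by blast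
    qed
    then have "{i. i < x (length ts) \<and> flat ts ! i = pos p k} = {i. i < x (length ts') \<and> flat ts' ! i = pos p' k}"
      using rl(3) by auto
    then show ?thesis
      unfolding rl(4,5,8,9) using rl(3)
      by (simp add: pattern_def seq_length_def idx_less_def entries_def length_flat)
  next
    case rr
    have "ts = us \<longleftrightarrow> ts' = us'"
      using same_qftpD[OF Z(2) rr(1) rr(6)] by (simp add: pattern_def)
    then have "flat ts = flat us \<longleftrightarrow> flat ts' = flat us'"
      using flat_eq_iff rr(2,3,7,8) by simp
    then show ?thesis
      unfolding rr(4,5,9,10) using rr(3)
      by (simp add: pattern_def seq_length_def idx_less_def entries_def length_flat)
  qed
qed

end

section \<open>Forking from a large set of dividing stages\<close>

lemma sparse_selection:
  fixes X :: "nat set"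
  assumes X: "finite X" "2 * n \<le> card X"
  obtains x where "\<And>j. j < n \<Longrightarrow> x j \<in> X" "\<And>i j. i < j \<Longrightarrow> j < n \<Longrightarrow> x i + 2 \<le> x j"
proof -
  define xs where "xs = sorted_list_of_set X"
  have xs: "sorted_wrt (<) xs" "set xs = X" "length xs = card X"
    using X(1) by (auto simp: xs_def)
  have mono: "xs ! i < xs ! j" if "i < j" "j < card X" for i j
    using xs(1,3) that by (simp add: sorted_wrt_iff_nth_less)
  show thesis
  proof (rule that[of "\<lambda>j. xs ! (2 * j)"])
    fix j assume "j < n"
    then have "2 * j < length xs" using X(2) xs(3) by simp
    then show "xs ! (2 * j) \<in> X" using xs(2) by auto
  next
    fix i j assume "i < j" "j < n"
    then have "xs ! (2 * i) < xs ! (2 * i + 1)" "xs ! (2 * i + 1) < xs ! (2 * j)"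
      using X(2) by (auto intro!: mono)
    then show "xs ! (2 * i) + 2 \<le> xs ! (2 * j)" by simp
  qed
qed

lemma set_zip_subset: "set xs \<subseteq> A \<Longrightarrow> set ys \<subseteq> B \<Longrightarrow> set (zip xs ys) \<subseteq> A \<times> B"
  using set_zip_leftD set_zip_rightD by fast

lemma emb_strict_mono:
  fixes h :: "nat \<Rightarrow> nat"
  assumes "\<And>v w. v < w \<Longrightarrow> h v < h w" shows "emb natle natle h S"
proof -
  have "h v < h w \<longleftrightarrow> v < w" for v w using assms[of v w] assms[of w v] by (metis less_asym linorder_neqE_nat less_irrefl)
  moreover have "inj_on h S" using assms by (metis inj_onI linorder_neqE_nat less_irrefl)
  ultimately show ?thesis by (simp add: emb_def)
qed

text \<open>Pulls the first \<open>W\<close> positions apart along \<open>h\<close>, which makes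
  room for further members of the family in between.\<close>

lemma respace:
  fixes h :: "nat \<Rightarrow> nat"
  assumes a: "indisc \<tau> C A n UNIV natle a" and C: "fsat \<tau> C" and A: "finite A" "A \<subseteq> univ C"
    and h: "\<And>v w. v < w \<Longrightarrow> h v < h w"
  obtains e where "indisc \<tau> C A n UNIV natle e"
    "\<And>u. u \<in> index_set n {..<W} natle \<Longrightarrow> e (index_map h u) = a u"
    "\<And>u. length (e u) = length (a u)"
proof -
  let ?S = "index_set n {..<W} natle"
  have emb: "emb natle natle h S" for S by (rule emb_strict_mono[OF h])
  have inj: "inj h" using emb[of UNIV] by (simp add: emb_def)
  have hh: "index_map (inv h) (index_map h u) = u" for u
    using inj by (cases u) (simp_all add: comp_def)
  define b where "b = (\<lambda>u. a (index_map (inv h) u))"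
  have SJ: "?S \<subseteq> index_set n UNIV natle" by (rule index_set_mono) simp
  have hJ: "index_map h u \<in> index_set n UNIV natle" if "u \<in> ?S" for u
    by (rule index_map_mem[OF emb _ that]) simp
  let ?Z = "(graph (index_map h) ?S)\<inverse>"
  have Z: "?Z \<subseteq> index_set n UNIV natle \<times> index_set n UNIV natle" using SJ hJ by auto
  have sZ: "same_qftp natle natle ?Z" by (rule same_qftp_converse[OF same_qftp_emb[OF emb]])
  have "?Z = (\<lambda>u. (index_map h u, u)) ` ?S" by auto
  then have "pairs a b (Id_on (index_map h ` ?S)) = pairs a a ?Z"
    by (simp add: pairs_def Id_on_def b_def hh)
  then have el: "elem \<tau> C C (Id_on A \<union> pairs a b (Id_on (index_map h ` ?S)))"
    using indisc_elem[OF a Z sZ] by simp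
  have len: "length (a v) = length (b v)" if v: "v \<in> index_map h ` ?S" for v
  proof -
    obtain u where u: "u \<in> ?S" "v = index_map h u" using v by blast
    have "(index_map h u, u) \<in> ?Z" using u(1) by blast
    then have "same_qftp natle natle {(index_map h u, u)}" by (intro same_qftp_mono[OF sZ]) blast
    from indisc_length[OF a hJ[OF u(1)] subsetD[OF SJ u(1)] this]
    show ?thesis by (simp add: u(2) b_def hh)
  qed
  have U: "finite (index_map h ` ?S)" "index_map h ` ?S \<subseteq> index_set n UNIV natle"
    using hJ by (auto simp: finite_index_set)
  obtain e where e: "indisc \<tau> C A n UNIV natle e" "\<And>u. u \<in> index_map h ` ?S \<Longrightarrow> e u = b u"
    "\<And>u. length (e u) = length (a u)"
    using relocate[OF a C A U el len] by auto
  have "e (index_map h u) = a u" if "u \<in> ?S" for u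
    using e(2)[of "index_map h u"] that by (simp add: b_def hh)
  then show thesis by (rule that[OF e(1) _ e(3)])
qed

text \<open>For a realization \<open>c\<close> of \<open>f\<close> and a chosen stage \<open>k\<close>, one of \<open>s (x k)\<close> and \<open>t (x k)\<close> has over
  \<open>c\<close> another type than the fixed later element of block \<open>2 * k + 1\<close>.  Recording for each stage
  which one it is (\<open>\<eta>\<close>) leaves finitely many formulas by compactness, and each of them divides
  along the sequence of blocks.  Since block \<open>2 * k\<close> contains all parameters of the stages between
  \<open>x k\<close> and \<open>x (Suc k)\<close>, the omitted stages cost nothing.\<close>

lemma fork_of_many:
  assumes C: "fsat \<tau> C" and A: "finite A" "A \<subseteq> univ C" and f: "pfm_in \<tau> (univ C) m f"
    and a: "indisc \<tau> C A N UNIV natle a"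
    and nil: "\<And>ts. l \<noteq> 3 \<Longrightarrow> Inr ts \<in> index_set N UNIV natle \<Longrightarrow> a (Inr ts) = []"
    and il: "interleaved UNIV natle N s t"
    and X: "X \<subseteq> {..<N}" "2 * n \<le> card X"
    and con: "\<And>c i. c \<in> tuples C m \<Longrightarrow> psat C c f \<Longrightarrow> i \<in> X \<Longrightarrow>
      \<not> elem \<tau> C C (Id_on (set c) \<union> contrast l a A s t i)"
  obtains F where "finite F" "\<And>g. g \<in> F \<Longrightarrow> pfm_in \<tau> (univ C) m g \<and> ndiv l \<tau> C n m g A"
    "\<And>c. c \<in> tuples C m \<Longrightarrow> psat C c f \<Longrightarrow> \<exists>g\<in>F. psat C c g"
proof -
  have "finite X" using X(1) by (rule finite_subset) simp
  then obtain x where x: "\<And>j. j < n \<Longrightarrow> x j \<in> X" "\<And>i j. i < j \<Longrightarrow> j < n \<Longrightarrow> x i + 2 \<le> x j"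
    using sparse_selection[OF _ X(2)] by blast
  have xN: "x j < N" if "j < n" for j using x(1)[OF that] X(1) by auto
  define W where "W = Suc (\<Sum>i<N. s i + t i)"
  have W: "s i < W" "t i < W" if "i < N" for i
    using member_le_sum[of i "{..<N}" "\<lambda>i. s i + t i"] that by (auto simp: W_def)
  have bl: "blocks s t x n N W"
  proof
    show "s i < s j" if "i < j" "j < N" for i j
      using interleaved_less(1)[OF il linear_natle that] by simp
    show "s i < t i" if "i < N" for i using il that by (simp add: interleaved_def)
    show "t i \<le> s (Suc i)" if "Suc i < N" for i using il that by (simp add: interleaved_def natle_def)
  qed (use xN x(2) W in auto)
  let ?h = "blocks.spread s x n W"
  \<comment> \<open>The comparison element of stage \<open>x k\<close> sits inside block
    \<open>2 * k + 1\<close>, after all of block \<open>2 * k\<close>. Neither it nor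
    \<open>?h\<close> involves \<open>\<eta>\<close>, so one re-spaced family serves all
    choices.\<close>
  let ?w = "\<lambda>k. blocks.V W * (2 * k + 3) + t (x k)"
  obtain e where e: "indisc \<tau> C A N UNIV natle e"
    and ea: "\<And>u. u \<in> index_set N {..<W} natle \<Longrightarrow> e (index_map ?h u) = a u"
    and le: "\<And>u. length (e u) = length (a u)"
    using respace[OF a C A, of ?h W] blocks.spread_mono[OF bl] by blast
  have eI: "e (Inl (?h v)) = a (Inl v)" if "v < W" for v
    using ea[of "Inl v"] that by simp
  have leq: "length (e (Inl v)) = length (e (Inl w))" for v w
    by (rule indisc_Inl_length[OF e]) simp_all
  have eU: "set (e u) \<subseteq> univ C" if "u \<in> index_set N UNIV natle" for u by (rule indisc_univ[OF e that])
  \<comment> \<open>The test at stage \<open>x k\<close> against the comparison element, over the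
    parameters of the original stage; \<open>\<eta> k\<close> selects
    \<open>t (x k)\<close>.\<close>
  define Q where "Q = (\<lambda>(\<eta> :: nat \<Rightarrow> bool) k. Id_on (A \<union> params l a s (x k)) \<union>
    set (zip (e (Inl (?h (if \<eta> k then t (x k) else s (x k))))) (e (Inl (?w k)))))"
  define B0 where "B0 = A \<union> set (snd f) \<union> (\<Union>k<n. params l a s (x k) \<union>
    set (e (Inl (?h (s (x k))))) \<union> set (e (Inl (?h (t (x k))))) \<union> set (e (Inl (?w k))))"
  have fin_par: "finite (params l a s i)" for i by (simp add: params_def)
  have B0: "finite B0" unfolding B0_def using A(1) fin_par by simp
  have parU: "params l a s (x k) \<subseteq> univ C" if "k < n" for k
    by (rule params_subset[OF a il linear_natle xN[OF that]])
  have B0U: "B0 \<subseteq> univ C"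
  proof -
    have "set (snd f) \<subseteq> univ C" using f by (auto simp: pfm_in_def split: prod.splits)
    moreover have "set (e (Inl v)) \<subseteq> univ C" for v by (rule eU) simp
    ultimately show ?thesis unfolding B0_def using A(2) parU by blast
  qed
  have QB: "Q \<eta> k \<subseteq> B0 \<times> B0" if k: "k < n" for \<eta> k
  proof -
    have "A \<union> params l a s (x k) \<subseteq> B0" using k unfolding B0_def by blast
    moreover have "set (e (Inl (?h (if \<eta> k then t (x k) else s (x k))))) \<subseteq> B0" "set (e (Inl (?w k))) \<subseteq> B0"
      using k unfolding B0_def by auto
    ultimately show ?thesis unfolding Q_def by (intro Un_least set_zip_subset) blast+
  qed
  have choice: "\<exists>b. \<not> elem \<tau> C C (Id_on (set c) \<union> Q (\<lambda>_. b) k)"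
    if c: "c \<in> tuples C m" "psat C c f" and k: "k < n" for c k
  proof (rule ccontr)
    assume "\<nexists>b. \<not> elem \<tau> C C (Id_on (set c) \<union> Q (\<lambda>_. b) k)"
    then have E: "elem \<tau> C C (Id_on (set c) \<union> Q (\<lambda>_. False) k)" "elem \<tau> C C (Id_on (set c) \<union> Q (\<lambda>_. True) k)"
      by auto
    \<comment> \<open>If both tuples agreed with the comparison element, composing the two relations
      would make them agree with each other.\<close>
    let ?P = "(Id_on (set c) \<union> Q (\<lambda>_. False) k) O (Id_on (set c) \<union> Q (\<lambda>_. True) k)\<inverse>"
    have "elem \<tau> C C ?P" by (intro elem_comp[OF E(1)] elem_converse E(2))
    moreover have "Id_on (set c) \<union> contrast l a A s t (x k) \<subseteq> ?P"
    proof (rule Un_least)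
      show "Id_on (set c) \<subseteq> ?P" by blast
      have "Id_on (A \<union> params l a s (x k)) \<subseteq> ?P" unfolding Q_def by blast
      moreover have "set (zip (a (Inl (s (x k)))) (a (Inl (t (x k))))) \<subseteq> ?P"
      proof (rule subrelI)
        let ?es = "e (Inl (?h (s (x k))))" and ?et = "e (Inl (?h (t (x k))))" and ?ew = "e (Inl (?w k))"
        fix y z assume "(y, z) \<in> set (zip (a (Inl (s (x k)))) (a (Inl (t (x k)))))"
        then have "(y, z) \<in> set (zip ?es ?et)" using eI W[OF xN[OF k]] by simp
        then obtain i where i: "i < length ?es" "y = ?es ! i" "z = ?et ! i" by (auto simp: in_set_zip)
        then have "(y, ?ew ! i) \<in> set (zip ?es ?ew)" "(z, ?ew ! i) \<in> set (zip ?et ?ew)"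
          using leq[of "?h (s (x k))" "?w k"] leq[of "?h (s (x k))" "?h (t (x k))"]
          by (auto simp: in_set_zip)
        then have "(y, ?ew ! i) \<in> Q (\<lambda>_. False) k" "(z, ?ew ! i) \<in> Q (\<lambda>_. True) k" by (auto simp: Q_def)
        then show "(y, z) \<in> ?P" by blast
      qed
      ultimately show "contrast l a A s t (x k) \<subseteq> ?P" unfolding contrast_def by (rule Un_least)
    qed
    ultimately have "elem \<tau> C C (Id_on (set c) \<union> contrast l a A s t (x k))" by (rule elem_mono)
    with con[OF c x(1)[OF k]] show False by blast
  qed
  have div: "ndiv l \<tau> C n m g A"
    if g: "\<And>c k. c \<in> tuples C m \<Longrightarrow> psat C c g \<Longrightarrow> k < n \<Longrightarrow> \<not> elem \<tau> C C (Id_on (set c) \<union> Q \<eta> k)" for g \<eta>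
  proof -
    interpret blocks s t x n N W \<eta> by (rule bl)
    let ?s = "\<lambda>k. 2 * k" and ?t = "\<lambda>k. 2 * k + 1"
    define b where "b = (\<lambda>u. concat (map e (expand u)))"
    have ib: "indisc \<tau> C A n UNIV natle b"
      unfolding b_def
    proof (rule indisc_pullback[OF e])
      show "length (expand u) = length (expand v)" if "seq_length u = seq_length v" for u v
        using that by (cases u; cases v) (auto simp: expand_def seq_length_def)
    qed (use expand_mem expand_pattern in auto)
    have il': "interleaved UNIV natle n ?s ?t" by (simp add: interleaved_def natle_iff)
    have nil': "b (Inr ts) = []" if "l \<noteq> 3" "Inr ts \<in> index_set n UNIV natle" for ts
      using nil[OF that(1) flat_mem[OF that(2)]] le[of "Inr (flat ts)"] by (simp add: b_def expand_def)
    have zipb: "set (zip (e (Inl (pos q i))) (e (Inl (pos p i)))) \<subseteq> set (zip (b (Inl q)) (b (Inl p)))"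
      if i: "i < V + W" for q p i
    proof -
      have len: "length (expand (Inl q)) = length (expand (Inl p))" by (simp add: expand_def)
      have "set (zip (b (Inl q)) (b (Inl p))) = pairs e e (set (zip (expand (Inl q)) (expand (Inl p))))"
        unfolding b_def
      proof (rule conjunct1[OF set_zip_concat[OF len]])
        show "\<forall>(u, v)\<in>set (zip (expand (Inl q)) (expand (Inl p))). length (e u) = length (e v)"
          by (auto simp: expand_def in_set_zip leq)
      qed
      moreover have "(Inl (pos q i), Inl (pos p i)) \<in> set (zip (expand (Inl q)) (expand (Inl p)))"
        unfolding expand_def in_set_zip using i by (intro exI[of _ i]) simp
      ultimately show ?thesis unfolding pairs_def by blast
    qed
    have setb: "set (e (Inl (pos q i))) \<subseteq> set (b (Inl q))" if "i < V + W" for q i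
      using that by (auto simp: b_def expand_def)
    have sub: "Q \<eta> k \<subseteq> contrast l b A ?s ?t k" if k: "k < n" for k
    proof -
      have kN: "x k < N" by (rule xN[OF k])
      have par: "Id_on (params l a s (x k)) \<subseteq> contrast l b A ?s ?t k"
      proof (cases "l = 2")
        case True
        \<comment> \<open>Parameters before the first kept stage are constants of the blocks: they
          occur at the same place in both zipped tuples, which puts them on the diagonal. The others
          lie in an earlier even block.\<close>
        have "Id_on (set (a (Inl (s j)))) \<subseteq> contrast l b A ?s ?t k" if j: "j < x k" for j
        proof -
          have jN: "j < N" using j kN by simp
          have aj: "a (Inl (s j)) = e (Inl (spread (s j)))" using eI[of "s j"] W(1)[OF jN] by simp
          show ?thesis
          proof (cases "cnt (s j)")
            case 0
            then have p: "spread (s j) = pos q (s j)" for q using s_less_V[OF jN] by (simp add: spread_def pos_def)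
            have "s j < V + W" using s_less_V[OF jN] by simp
            from zipb[OF this, of "2 * k" "2 * k + 1"] show ?thesis
              unfolding aj p[of "2 * k", symmetric] p[of "2 * k + 1", symmetric] contrast_def set_zip_same by blast
          next
            case (Suc j')
            then have j': "j' < k" using cnt_le[OF k j] by simp
            have p: "spread (s j) = pos (2 * j') (V + s j)"
              using pos_spread[of j' "s j"] j' k W(1)[OF jN] Suc by simp
            have "set (a (Inl (s j))) \<subseteq> set (b (Inl (?s j')))"
              unfolding aj p by (rule setb) (use W(1)[OF jN] in simp)
            also have "\<dots> \<subseteq> params l b ?s k" using j' True by (auto simp: params_def)
            finally show ?thesis unfolding contrast_def by blast
          qed
        qed
        then show ?thesis using True unfolding params_def by (simp add: Id_on_def) blast
      next
        case False
        have "params l a s (x k) = params l b ?s k"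
        proof (cases "l = 3")
          case True
          have "Inr (map s [0..<x k]) \<in> index_set N {..<W} natle"
            using map_sorted_Inr[OF il linear_natle kN] W(1) kN by auto
          from ea[OF this] have "a (Inr (map s [0..<x k])) = e (Inr (map spread (map s [0..<x k])))" by simp
          also have "\<dots> = b (Inr (map ?s [0..<k]))"
            unfolding flat_stages[OF k, symmetric] by (simp add: b_def expand_def)
          finally show ?thesis using True by (simp add: params_def)
        qed (use False in \<open>simp add: params_def\<close>)
        then show ?thesis unfolding contrast_def by blast
      qed
      let ?v = "if \<eta> k then t (x k) else s (x k)"
      have v: "?v < W" "cnt ?v = Suc k" using W[OF kN] cnt_s[OF k] cnt_t[OF k] by auto
      have "set (zip (e (Inl (pos (2 * k) (V + ?v)))) (e (Inl (pos (2 * k + 1) (V + ?v))))) \<subseteq>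
          set (zip (b (Inl (2 * k))) (b (Inl (2 * k + 1))))"
        by (rule zipb) (use v(1) in simp)
      then have "set (zip (e (Inl (spread ?v))) (e (Inl (?w k)))) \<subseteq> contrast l b A ?s ?t k"
        unfolding pos_spread[OF k v] pos_odd[OF k] contrast_def by blast
      moreover have "Id_on A \<subseteq> contrast l b A ?s ?t k" unfolding contrast_def by blast
      ultimately show ?thesis unfolding Q_def using par by blast
    qed
    have "\<not> elem \<tau> C C (Id_on (set c) \<union> contrast l b A ?s ?t k)"
      if c: "c \<in> tuples C m" "psat C c g" and k: "k < n" for c k
    proof
      assume "elem \<tau> C C (Id_on (set c) \<union> contrast l b A ?s ?t k)"
      then have "elem \<tau> C C (Id_on (set c) \<union> Q \<eta> k)" by (rule elem_mono) (use sub[OF k] in blast)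
      with g[OF c k] show False by blast
    qed
    with ib nil' il' show ?thesis unfolding gdiv_def by blast
  qed
  \<comment> \<open>All parameters are kept in the one finite set \<open>B0\<close>, whatever
    \<open>\<eta>\<close> is, as the finite subcover requires.\<close>
  define \<Phi> where "\<Phi> = {g. pfm_in \<tau> B0 m g \<and> ndiv l \<tau> C n m g A}"
  obtain bs where bs: "set bs = B0" using finite_list[OF B0] by blast
  have cover: "\<exists>g\<in>\<Phi>. psat C c g" if c: "c \<in> tuples C m" "psat C c f" for c
  proof -
    obtain \<eta> where \<eta>: "\<And>k. k < n \<Longrightarrow> \<not> elem \<tau> C C (Id_on (set c) \<union> Q (\<lambda>_. \<eta> k) k)"
      using choice[OF c] by metis
    have Q\<eta>: "Q (\<lambda>_. \<eta> k) k = Q \<eta> k" for k by (simp add: Q_def)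
    have "\<exists>\<gamma>. fm_in \<tau> (m + length bs) \<gamma> \<and> sat C (c @ bs) \<gamma> \<and>
        (\<forall>c'. c' \<in> tuples C m \<longrightarrow> sat C (c' @ bs) \<gamma> \<longrightarrow> \<not> elem \<tau> C C (Id_on (set c') \<union> Q \<eta> k))"
      if k: "k < n" for k
      using elem_witness[of "Q \<eta> k" bs C c m \<tau>] QB[OF k, of \<eta>] bs B0U c(1) \<eta>[OF k] unfolding Q\<eta> by metis
    then obtain \<gamma> where \<gamma>: "\<And>k. k < n \<Longrightarrow> fm_in \<tau> (m + length bs) (\<gamma> k) \<and> sat C (c @ bs) (\<gamma> k) \<and>
        (\<forall>c'. c' \<in> tuples C m \<longrightarrow> sat C (c' @ bs) (\<gamma> k) \<longrightarrow> \<not> elem \<tau> C C (Id_on (set c') \<union> Q \<eta> k))"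
      by metis
    \<comment> \<open>The conjunction excludes agreement at all kept stages for one fixed
      \<open>\<eta>\<close>, which is what \<open>div\<close> asks for.\<close>
    define g where "g = (conjs (map \<gamma> [0..<n]), bs)"
    have "pfm_in \<tau> B0 m g" using \<gamma> bs by (simp add: g_def pfm_in_def)
    moreover have "psat C c g" using \<gamma> by (simp add: g_def psat_def)
    moreover have "ndiv l \<tau> C n m g A"
      by (rule div[of g \<eta>]) (use \<gamma> in \<open>simp add: g_def psat_def\<close>)
    ultimately show ?thesis unfolding \<Phi>_def by blast
  qed
  have fB: "pfm_in \<tau> B0 m f" using f by (auto simp: pfm_in_def B0_def split: prod.splits)
  obtain F where F: "finite F" "F \<subseteq> \<Phi>" "\<And>c. c \<in> tuples C m \<Longrightarrow> psat C c f \<Longrightarrow> \<exists>g\<in>F. psat C c g"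
    by (rule finite_subcover[OF C B0 B0U fB _ cover]) (auto simp: \<Phi>_def)
  have "pfm_in \<tau> (univ C) m g \<and> ndiv l \<tau> C n m g A" if "g \<in> F" for g
    using F(2) that pfm_in_mono[OF _ B0U] unfolding \<Phi>_def by blast
  with F(1,3) show thesis by (intro that[of F])
qed

section \<open>Splitting forking formulas of a sum\<close>

definition formula_forks :: "nat \<Rightarrow> 's vocab \<Rightarrow> ('s, 'a) struc \<Rightarrow> nat \<Rightarrow> nat \<Rightarrow> ('s, 'a) pfm \<Rightarrow> 'a set \<Rightarrow>
    ('s, 'a) pfm set \<Rightarrow> bool" where
  "formula_forks l \<tau> D n m f A F \<longleftrightarrow> finite F \<and> (\<forall>g\<in>F. pfm_in \<tau> (univ D) m g \<and> ndiv l \<tau> D n m g A) \<and>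
     (\<forall>c\<in>tuples D m. psat D c f \<longrightarrow> (\<exists>g\<in>F. psat D c g))"

context sum_parts
begin

text \<open>Corresponding entries lie on the same side, so filtering both tuples keeps exactly the
  left pairs; parameters are filtered likewise.\<close>

lemma contrast_LL:
  assumes a: "indisc \<tau>' C A n I r a" and st: "s i \<in> I" "t i \<in> I"
  shows "contrast l a A s t i \<inter> univ CL \<times> univ CL \<subseteq> contrast l (\<lambda>u. LL (a u)) (A \<inter> univ CL) s t i"
    and "(y, z) \<in> set (zip (a (Inl (s i))) (a (Inl (t i)))) \<Longrightarrow> inL y \<longleftrightarrow> inL z"
proof -
  let ?Z = "{(Inl (s i) :: 'b + 'b list, Inl (t i) :: 'b + 'b list)}"
  have Z: "?Z \<subseteq> index_set n I r \<times> index_set n I r" "same_qftp r r ?Z"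
    using st by (auto simp: same_qftp_def pattern_def seq_length_def idx_less_def entries_def lt_def)
  note E = indisc_elem[OF a Z]
  show same: "inL y \<longleftrightarrow> inL z" if "(y, z) \<in> set (zip (a (Inl (s i))) (a (Inl (t i))))" for y z
    by (rule elem_inL[OF E]) (use that in \<open>auto simp: pairs_def\<close>)
  have zip: "set (zip (a (Inl (s i))) (a (Inl (t i)))) \<inter> univ CL \<times> univ CL \<subseteq>
      set (zip (LL (a (Inl (s i)))) (LL (a (Inl (t i)))))"
    using set_zip_filter[OF indisc_Inl_length[OF a st], of inL inL] same by auto
  have par: "params l a s i \<inter> univ CL \<subseteq> params l (\<lambda>u. LL (a u)) s i"
    by (auto simp: params_def)
  show "contrast l a A s t i \<inter> univ CL \<times> univ CL \<subseteq> contrast l (\<lambda>u. LL (a u)) (A \<inter> univ CL) s t i"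
    unfolding contrast_def using zip par by blast
qed

text \<open>Applies \<open>fork_of_many\<close> to the left halves of the tuples, at the stages
  where no realization of the left condition sees agreement.\<close>

lemma part_forks:
  assumes C: "fsat \<tau>' C" and A: "finite A" "A \<subseteq> univ C"
    and a: "indisc \<tau>' C A N UNIV natle a"
    and nil: "\<And>ts. l \<noteq> 3 \<Longrightarrow> Inr ts \<in> index_set N UNIV natle \<Longrightarrow> a (Inr ts) = []"
    and il: "interleaved UNIV natle N s t"
    and f: "pfm_in \<tau> (univ CL) m f"
    and X: "X = {i. i < N \<and> (\<forall>c\<in>tuples CL m. psat CL c f \<longrightarrow>
      \<not> elem \<tau> CL CL (Id_on (set c) \<union> contrast l (\<lambda>u. LL (a u)) (A \<inter> univ CL) s t i))}"
    and card: "2 * n \<le> card X"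
  shows "\<exists>F. formula_forks l \<tau> CL n m f (A \<inter> univ CL) F"
proof -
  have fin: "finite (A \<inter> univ CL)" using A(1) by simp
  have XN: "X \<subseteq> {..<N}" by (auto simp: X)
  have nil': "LL (a (Inr ts)) = []" if "l \<noteq> 3" "Inr ts \<in> index_set N UNIV natle" for ts
    using nil[OF that] by simp
  have con: "\<not> elem \<tau> CL CL (Id_on (set c) \<union> contrast l (\<lambda>u. LL (a u)) (A \<inter> univ CL) s t i)"
    if "c \<in> tuples CL m" "psat CL c f" "i \<in> X" for c i
    using that by (simp add: X)
  obtain F where "finite F" "\<And>g. g \<in> F \<Longrightarrow> pfm_in \<tau> (univ CL) m g \<and> ndiv l \<tau> CL n m g (A \<inter> univ CL)"
    "\<And>c. c \<in> tuples CL m \<Longrightarrow> psat CL c f \<Longrightarrow> \<exists>g\<in>F. psat CL c g"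
    using fork_of_many[where a = "\<lambda>u. LL (a u)", OF fsat_L[OF C] fin Int_lower2 f indisc_L[OF a] nil' il XN card con]
    by auto
  then show ?thesis unfolding formula_forks_def by blast
qed

text \<open>If neither conjunct were responsible for stage \<open>i\<close>, the two witnesses would merge to a
  realization of the conjunction for which the types at stage \<open>i\<close> agree.\<close>

lemma box_forks:
  assumes C: "fsat \<tau>' C" and A: "finite A" "A \<subseteq> univ C"
    and nd: "ndiv l \<tau>' C (2 * n1 + 2 * n2) m f A" and c0: "c0 \<in> tuples C m"
    and \<alpha>: "pfm_in \<tau> (univ CL) (length (LL c0)) \<alpha>" and \<beta>: "pfm_in \<tau> (univ CR) (length (RR c0)) \<beta>"
    and imp: "\<And>c. c \<in> tuples C m \<Longrightarrow> map inL c = map inL c0 \<Longrightarrow> psat CL (LL c) \<alpha> \<Longrightarrow> psat CR (RR c) \<beta> \<Longrightarrow>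
      psat C c f"
  shows "(\<exists>F. formula_forks l \<tau> CL n1 (length (LL c0)) \<alpha> (A \<inter> univ CL) F) \<or>
    (\<exists>F. formula_forks l \<tau> CR n2 (length (RR c0)) \<beta> (A \<inter> univ CR) F)"
proof -
  let ?N = "2 * n1 + 2 * n2"
  let ?mL = "length (LL c0)" and ?mR = "length (RR c0)"
  obtain a s t where a: "indisc \<tau>' C A ?N UNIV natle a"
    and nil: "\<And>ts. l \<noteq> 3 \<Longrightarrow> Inr ts \<in> index_set ?N UNIV natle \<Longrightarrow> a (Inr ts) = []"
    and il: "interleaved UNIV natle ?N s t"
    and con: "\<And>c i. c \<in> tuples C m \<Longrightarrow> psat C c f \<Longrightarrow> i < ?N \<Longrightarrow>
      \<not> elem \<tau>' C C (Id_on (set c) \<union> contrast l a A s t i)"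
    using nd unfolding gdiv_def by blast
  define X where "X = {i. i < ?N \<and> (\<forall>c\<in>tuples CL ?mL. psat CL c \<alpha> \<longrightarrow>
      \<not> elem \<tau> CL CL (Id_on (set c) \<union> contrast l (\<lambda>u. LL (a u)) (A \<inter> univ CL) s t i))}"
  define Y where "Y = {i. i < ?N \<and> (\<forall>c\<in>tuples CR ?mR. psat CR c \<beta> \<longrightarrow>
      \<not> elem \<tau> CR CR (Id_on (set c) \<union> contrast l (\<lambda>u. RR (a u)) (A \<inter> univ CR) s t i))}"
  have "{..<?N} \<subseteq> X \<union> Y"
  proof
    fix i assume "i \<in> {..<?N}"
    then have i: "i < ?N" by simp
    show "i \<in> X \<union> Y"
    proof (rule ccontr)
      assume "i \<notin> X \<union> Y"
      then obtain cl cr where cl: "cl \<in> tuples CL ?mL" "psat CL cl \<alpha>"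
          "elem \<tau> CL CL (Id_on (set cl) \<union> contrast l (\<lambda>u. LL (a u)) (A \<inter> univ CL) s t i)"
        and cr: "cr \<in> tuples CR ?mR" "psat CR cr \<beta>"
          "elem \<tau> CR CR (Id_on (set cr) \<union> contrast l (\<lambda>u. RR (a u)) (A \<inter> univ CR) s t i)"
        using i unfolding X_def Y_def by blast
      obtain c where c: "length c = length c0" "map inL c = map inL c0" "LL c = cl" "RR c = cr"
        "set (zip c0 c) = set (zip (LL c0) cl) \<union> set (zip (RR c0) cr)"
        using merge[of c0 cl cr] tuplesD[OF c0] tuplesD[OF cl(1)] tuplesD[OF cr(1)] by auto
      have cU: "set c \<subseteq> univ C"
      proof
        fix z assume "z \<in> set c"
        then obtain y where y: "(y, z) \<in> set (zip c0 c)" using c(1) by (metis in_set_impl_in_set_zip2)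
        then have "z \<in> set cl \<union> set cr" unfolding c(5) by (auto dest: set_zip_rightD)
        then show "z \<in> univ C" using tuplesD[OF cl(1)] tuplesD[OF cr(1)] univ_C by blast
      qed
      have ct: "c \<in> tuples C m" using cU c(1) tuplesD[OF c0] by (intro tuplesI) auto
      have "psat C c f" by (rule imp[OF ct c(2)]) (simp_all add: c(3,4) cl(2) cr(2))
      from con[OF ct this i] have ne: "\<not> elem \<tau>' C C (Id_on (set c) \<union> contrast l a A s t i)" .
      have CU: "contrast l a A s t i \<subseteq> univ C \<times> univ C" by (rule contrast_subset[OF a il A(2) i])
      have "elem \<tau>' C C (Id_on (set c) \<union> contrast l a A s t i)"
      proof (rule elem_of_parts)
        have "inL y \<longleftrightarrow> inL z" if "(y, z) \<in> contrast l a A s t i" for y z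
          using that contrast_LL(2)[OF a UNIV_I UNIV_I] unfolding contrast_def by blast
        then have "contrast l a A s t i \<subseteq> univ CL \<times> univ CL \<union> univ CR \<times> univ CR"
          using CU inR_iff by blast
        moreover have "Id_on (set c) \<subseteq> univ CL \<times> univ CL \<union> univ CR \<times> univ CR"
          using cU univ_C by blast
        ultimately show "Id_on (set c) \<union> contrast l a A s t i \<subseteq> univ CL \<times> univ CL \<union> univ CR \<times> univ CR"
          by blast
        have "Id_on (set c) \<inter> univ CL \<times> univ CL \<subseteq> Id_on (set cl)" unfolding c(3)[symmetric] by auto
        then show "elem \<tau> CL CL ((Id_on (set c) \<union> contrast l a A s t i) \<inter> univ CL \<times> univ CL)"
          using contrast_LL(1)[OF a UNIV_I UNIV_I, where s = s and t = t and i = i and l = l]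
          by (intro elem_mono[OF cl(3)]) blast
        have "Id_on (set c) \<inter> univ CR \<times> univ CR \<subseteq> Id_on (set cr)" unfolding c(4)[symmetric] by auto
        then show "elem \<tau> CR CR ((Id_on (set c) \<union> contrast l a A s t i) \<inter> univ CR \<times> univ CR)"
          using sum_parts.contrast_LL(1)[OF swap a UNIV_I UNIV_I, where s = s and t = t and i = i and l = l]
          by (intro elem_mono[OF cr(3)]) blast
      qed
      with ne show False by blast
    qed
  qed
  moreover have "finite (X \<union> Y)" by (rule finite_subset[of _ "{..<?N}"]) (auto simp: X_def Y_def)
  ultimately have "card {..<?N} \<le> card (X \<union> Y)" by (intro card_mono)
  then have "?N \<le> card X + card Y" using card_Un_le[of X Y] by simp
  \<comment> \<open>Each stage is in \<open>X\<close> or in \<open>Y\<close>, so one of the two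
    reaches its share; the number of stages was chosen for this.\<close>
  then consider "2 * n1 \<le> card X" | "2 * n2 \<le> card Y" by linarith
  then show ?thesis
  proof cases
    case 1
    then show ?thesis using part_forks[OF C A a nil il \<alpha> X_def] by blast
  next
    case 2
    then show ?thesis using sum_parts.part_forks[OF swap C A a nil il \<beta> Y_def] by blast
  qed
qed

text \<open>Non-forking over \<open>A1\<close> on the left and over \<open>A2\<close> on the right
  contradicts forking over the union: tuples escaping the covers on either side merge to one that
  has the type of \<open>c\<close> over \<open>b\<close>, hence satisfies a forking formula, hence
  one of its boxes, and so falls into one of the covers.\<close>

lemma nonsd_parts:
  assumes C: "fsat \<tau>' C" and ns: "nonsd l \<tau>' C"
  shows "nonsd l \<tau> CL \<or> nonsd l \<tau> CR"
proof (rule ccontr)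
  assume not: "\<not> (nonsd l \<tau> CL \<or> nonsd l \<tau> CR)"
  from ns obtain m c B where mcB: "c \<in> tuples C m \<and> countable B \<and> B \<subseteq> univ C \<and>
     (\<forall>n A. finite A \<and> A \<subseteq> B \<longrightarrow> nfork l \<tau>' C n m c B A)"
    unfolding nonsd_def by (elim exE)
  then have c: "c \<in> tuples C m" and B: "countable B" "B \<subseteq> univ C" by simp_all
  have fk: "nfork l \<tau>' C n m c B A" if "finite A" "A \<subseteq> B" for n A
    using mcB that by (elim conjE) simp
  let ?mL = "length (LL c)" and ?mR = "length (RR c)"
  let ?BL = "B \<inter> univ CL" and ?BR = "B \<inter> univ CR"
  have cL: "LL c \<in> tuples CL ?mL" and cR: "RR c \<in> tuples CR ?mR" by (auto intro!: tuplesI)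
  have "\<not> (\<forall>n A. finite A \<and> A \<subseteq> ?BL \<longrightarrow> nfork l \<tau> CL n ?mL (LL c) ?BL A)"
  proof
    assume "\<forall>n A. finite A \<and> A \<subseteq> ?BL \<longrightarrow> nfork l \<tau> CL n ?mL (LL c) ?BL A"
    then have "nonsd l \<tau> CL" unfolding nonsd_def
      using cL B(1) by (intro exI[of _ ?mL] exI[of _ "LL c"] exI[of _ ?BL]) simp
    with not show False by blast
  qed
  then obtain n1 A1 where A1: "finite A1" "A1 \<subseteq> ?BL" "\<not> nfork l \<tau> CL n1 ?mL (LL c) ?BL A1" by blast
  have "\<not> (\<forall>n A. finite A \<and> A \<subseteq> ?BR \<longrightarrow> nfork l \<tau> CR n ?mR (RR c) ?BR A)"
  proof
    assume "\<forall>n A. finite A \<and> A \<subseteq> ?BR \<longrightarrow> nfork l \<tau> CR n ?mR (RR c) ?BR A"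
    then have "nonsd l \<tau> CR" unfolding nonsd_def
      using cR B(1) by (intro exI[of _ ?mR] exI[of _ "RR c"] exI[of _ ?BR]) simp
    with not show False by blast
  qed
  then obtain n2 A2 where A2: "finite A2" "A2 \<subseteq> ?BR" "\<not> nfork l \<tau> CR n2 ?mR (RR c) ?BR A2" by blast
  \<comment> \<open>Both instances are put into one finite set, from which each is recovered by
    intersecting with its side.\<close>
  define A where "A = A1 \<union> A2"
  have A: "finite A" "A \<subseteq> B" "A \<inter> univ CL = A1" "A \<inter> univ CR = A2"
    using A1(1,2) A2(1,2) disj unfolding A_def by blast+
  have AU: "A \<subseteq> univ C" using A(2) B(2) by blast
  obtain b F where bF: "finite b" "b \<subseteq> B" "finite F"
    "\<And>f. f \<in> F \<Longrightarrow> pfm_in \<tau>' (univ C) m f \<and> ndiv l \<tau>' C (2 * n1 + 2 * n2) m f A"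
    "\<And>c'. c' \<in> tuples C m \<Longrightarrow> elem \<tau>' C C (set (zip c c') \<union> Id_on b) \<Longrightarrow> \<exists>f\<in>F. psat C c' f"
    using fk[OF A(1,2), of "2 * n1 + 2 * n2"] unfolding nfork_def by blast
  have "\<exists>ps. box_list (map inL c @ map inL (snd f)) (\<lambda>e. sat C e (fst f)) ps" if f: "f \<in> F" for f
  proof -
    have "fm_in \<tau>' (m + length (snd f)) (fst f)" using bF(4)[OF f] by (cases f) (simp add: pfm_in_def)
    then have "boxes (map inL c @ map inL (snd f)) (\<lambda>e. sat C e (fst f))"
      by (rule boxes_sat) (use tuplesD[OF c] in simp)
    then show ?thesis by (simp add: boxes_def)
  qed
  then obtain ps where ps: "\<And>f. f \<in> F \<Longrightarrow>
      box_list (map inL c @ map inL (snd f)) (\<lambda>e. sat C e (fst f)) (ps f)" by metis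
  define fL :: "('s sum_sym, 'a) pfm \<times> 's fm \<times> 's fm \<Rightarrow> ('s, 'a) pfm"
    where "fL = (\<lambda>z. (fst (snd z), LL (snd (fst z))))"
  define fR :: "('s sum_sym, 'a) pfm \<times> 's fm \<times> 's fm \<Rightarrow> ('s, 'a) pfm"
    where "fR = (\<lambda>z. (snd (snd z), RR (snd (fst z))))"
  have dU: "set (snd f) \<subseteq> univ C" if "f \<in> F" for f
    using bF(4)[OF that] by (cases f) (simp add: pfm_in_def)
  have RRnot: "RR e = filter (\<lambda>y. \<not> inL y) e" if "set e \<subseteq> univ C" for e
    by (rule filter_cong[OF refl]) (use that inR_iff in blast)
  define K where "K = (SIGMA f:F. set (ps f))"
  have K: "finite K" unfolding K_def using bF(3) by blast
  have sat_box: "sat C (c' @ snd f) (fst f) \<longleftrightarrow>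
      (\<exists>p\<in>set (ps f). psat CL (LL c') (fL (f, p)) \<and> psat CR (RR c') (fR (f, p)))"
    if f: "f \<in> F" and c': "c' \<in> tuples C m" "map inL c' = map inL c" for f c'
  proof -
    have "set (c' @ snd f) \<subseteq> univ C" "map inL (c' @ snd f) = map inL c @ map inL (snd f)"
      using dU[OF f] tuplesD[OF c'(1)] c'(2) by auto
    from box_listD(2)[OF ps[OF f] this] show ?thesis by (simp add: fL_def fR_def psat_def)
  qed
  have "(\<exists>G. formula_forks l \<tau> CL n1 ?mL (fL z) A1 G) \<or> (\<exists>G. formula_forks l \<tau> CR n2 ?mR (fR z) A2 G)"
    if "z \<in> K" for z
  proof -
    obtain f p where z: "z = (f, p)" "f \<in> F" "p \<in> set (ps f)" using \<open>z \<in> K\<close> by (auto simp: K_def)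
    have n: "length (filter (\<lambda>b. b) (map inL c @ map inL (snd f))) = ?mL + length (LL (snd f))"
      "length (filter Not (map inL c @ map inL (snd f))) = ?mR + length (RR (snd f))"
      using RRnot[of c] RRnot[of "snd f"] tuplesD[OF c] dU[OF z(2)]
      by (simp_all add: length_filter_map comp_def)
    have "pfm_in \<tau> (univ CL) ?mL (fL z)" "pfm_in \<tau> (univ CR) ?mR (fR z)"
      using box_listD(1)[OF ps[OF z(2)] z(3)] unfolding n by (auto simp: fL_def fR_def z(1) pfm_in_def)
    moreover have "psat C c' f"
      if "c' \<in> tuples C m" "map inL c' = map inL c" "psat CL (LL c') (fL z)" "psat CR (RR c') (fR z)" for c'
    proof -
      have "sat C (c' @ snd f) (fst f)"
        using sat_box[OF z(2) that(1,2)] that(3,4) z(3) unfolding z(1) by blast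
      then show ?thesis by (cases f) (simp add: psat_def)
    qed
    ultimately show ?thesis
      using box_forks[OF C A(1) AU conjunct2[OF bF(4)[OF z(2)]] c] unfolding A(3,4) by blast
  qed
  then have "\<exists>G. formula_forks l \<tau> CL n1 ?mL (fL z) A1 (fst G) \<or> formula_forks l \<tau> CR n2 ?mR (fR z) A2 (snd G)"
    if "z \<in> K" for z using that by (metis fst_conv snd_conv)
  then obtain G where G: "\<And>z. z \<in> K \<Longrightarrow>
      formula_forks l \<tau> CL n1 ?mL (fL z) A1 (fst (G z)) \<or> formula_forks l \<tau> CR n2 ?mR (fR z) A2 (snd (G z))"
    by metis
  \<comment> \<open>A box is charged to a side on which its condition forks; uniting over the
    finitely many boxes gives one cover per side.\<close>
  define GL where "GL = (\<Union>z\<in>{z \<in> K. formula_forks l \<tau> CL n1 ?mL (fL z) A1 (fst (G z))}. fst (G z))"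
  define GR where "GR = (\<Union>z\<in>{z \<in> K. formula_forks l \<tau> CR n2 ?mR (fR z) A2 (snd (G z))}. snd (G z))"
  have GL: "finite GL" "\<forall>g\<in>GL. pfm_in \<tau> (univ CL) ?mL g \<and> ndiv l \<tau> CL n1 ?mL g A1"
    unfolding GL_def using K by (auto simp: formula_forks_def)
  have GR: "finite GR" "\<forall>g\<in>GR. pfm_in \<tau> (univ CR) ?mR g \<and> ndiv l \<tau> CR n2 ?mR g A2"
    unfolding GR_def using K by (auto simp: formula_forks_def)
  let ?bL = "b \<inter> univ CL" and ?bR = "b \<inter> univ CR"
  have "\<not> (\<forall>c'\<in>tuples CL ?mL. elem \<tau> CL CL (set (zip (LL c) c') \<union> Id_on ?bL) \<longrightarrow> (\<exists>g\<in>GL. psat CL c' g))"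
    using A1(3) GL bF(1,2) unfolding nfork_def by blast
  then obtain cl where cl: "cl \<in> tuples CL ?mL" "elem \<tau> CL CL (set (zip (LL c) cl) \<union> Id_on ?bL)"
    "\<And>g. g \<in> GL \<Longrightarrow> \<not> psat CL cl g" by blast
  have "\<not> (\<forall>c'\<in>tuples CR ?mR. elem \<tau> CR CR (set (zip (RR c) c') \<union> Id_on ?bR) \<longrightarrow> (\<exists>g\<in>GR. psat CR c' g))"
    using A2(3) GR bF(1,2) unfolding nfork_def by blast
  then obtain cr where cr: "cr \<in> tuples CR ?mR" "elem \<tau> CR CR (set (zip (RR c) cr) \<union> Id_on ?bR)"
    "\<And>g. g \<in> GR \<Longrightarrow> \<not> psat CR cr g" by blast
  obtain c' where c': "length c' = length c" "map inL c' = map inL c" "LL c' = cl" "RR c' = cr"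
    "set (zip c c') = set (zip (LL c) cl) \<union> set (zip (RR c) cr)"
    using merge[of c cl cr] tuplesD[OF c] tuplesD[OF cl(1)] tuplesD[OF cr(1)] by auto
  have zL: "set (zip (LL c) cl) \<subseteq> univ CL \<times> univ CL"
    using tuplesD[OF cL] tuplesD[OF cl(1)] by (intro set_zip_subset) auto
  have zR: "set (zip (RR c) cr) \<subseteq> univ CR \<times> univ CR"
    using tuplesD[OF cR] tuplesD[OF cr(1)] by (intro set_zip_subset) auto
  have E: "elem \<tau>' C C (set (zip c c') \<union> Id_on b)"
  proof (rule elem_of_parts)
    have bU: "b \<subseteq> univ CL \<union> univ CR" using bF(2) B(2) univ_C by blast
    then show "set (zip c c') \<union> Id_on b \<subseteq> univ CL \<times> univ CL \<union> univ CR \<times> univ CR"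
      unfolding c'(5) using zL zR by blast
    show "elem \<tau> CL CL ((set (zip c c') \<union> Id_on b) \<inter> univ CL \<times> univ CL)"
      unfolding c'(5) by (rule elem_mono[OF cl(2)]) (use zR disj in blast)
    show "elem \<tau> CR CR ((set (zip c c') \<union> Id_on b) \<inter> univ CR \<times> univ CR)"
      unfolding c'(5) by (rule elem_mono[OF cr(2)]) (use zL disj in blast)
  qed
  have "set c' \<subseteq> univ C"
  proof
    fix z assume "z \<in> set c'"
    then obtain y where y: "(y, z) \<in> set (zip c c')" using c'(1) by (metis in_set_impl_in_set_zip2)
    then show "z \<in> univ C" using elem_univ[OF E] by blast
  qed
  then have c't: "c' \<in> tuples C m" using c'(1) tuplesD[OF c] by (intro tuplesI) auto
  obtain f where f: "f \<in> F" "psat C c' f" using bF(5)[OF c't E] by blast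
  then have "sat C (c' @ snd f) (fst f)" by (cases f) (simp add: psat_def)
  then obtain p where p: "p \<in> set (ps f)" "psat CL cl (fL (f, p))" "psat CR cr (fR (f, p))"
    using sat_box[OF f(1) c't c'(2)] unfolding c'(3,4) by blast
  have zK: "(f, p) \<in> K" using f(1) p(1) by (simp add: K_def)
  from G[OF zK] show False
  proof
    assume L: "formula_forks l \<tau> CL n1 ?mL (fL (f, p)) A1 (fst (G (f, p)))"
    then obtain g where g: "g \<in> fst (G (f, p))" "psat CL cl g"
      using cl(1) p(2) unfolding formula_forks_def by blast
    then have "g \<in> GL" unfolding GL_def using L zK by blast
    then show False using cl(3) g(2) by blast
  next
    assume R: "formula_forks l \<tau> CR n2 ?mR (fR (f, p)) A2 (snd (G (f, p)))"
    then obtain g where g: "g \<in> snd (G (f, p))" "psat CR cr g"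
      using cr(1) p(3) unfolding formula_forks_def by blast
    then have "g \<in> GR" unfolding GR_def using R zK by blast
    then show False using cr(3) g(2) by blast
  qed
qed

lemma nonsd_iff: "fsat \<tau>' C \<Longrightarrow> nonsd l \<tau>' C \<longleftrightarrow> nonsd l \<tau> CL \<or> nonsd l \<tau> CR"
  using nonsd_parts[of l] nonsd_up[of l] sum_parts.nonsd_up[OF swap, of l] by (intro iffI) auto

end

section \<open>The parts of a monster model of the sum\<close>

lemma sat_Ex_funpow:
  "sat M e ((Ex ^^ k) \<phi>) \<longleftrightarrow> (\<exists>xs. length xs = k \<and> set xs \<subseteq> univ M \<and> sat M (xs @ e) \<phi>)"
proof (induction k arbitrary: e)
  case (Suc k)
  have "sat M e ((Ex ^^ Suc k) \<phi>) \<longleftrightarrow>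
      (\<exists>y\<in>univ M. \<exists>xs. length xs = k \<and> set xs \<subseteq> univ M \<and> sat M (xs @ y # e) \<phi>)"
    using Suc by simp
  also have "\<dots> \<longleftrightarrow> (\<exists>xs. length xs = Suc k \<and> set xs \<subseteq> univ M \<and> sat M (xs @ e) \<phi>)"
  proof
    assume "\<exists>y\<in>univ M. \<exists>xs. length xs = k \<and> set xs \<subseteq> univ M \<and> sat M (xs @ y # e) \<phi>"
    then obtain y xs where "y \<in> univ M" "length xs = k" "set xs \<subseteq> univ M" "sat M (xs @ y # e) \<phi>" by blast
    then show "\<exists>xs. length xs = Suc k \<and> set xs \<subseteq> univ M \<and> sat M (xs @ e) \<phi>"
      by (intro exI[of _ "xs @ [y]"]) simp
  next
    assume "\<exists>xs. length xs = Suc k \<and> set xs \<subseteq> univ M \<and> sat M (xs @ e) \<phi>"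
    then obtain zs where zs: "length zs = Suc k" "set zs \<subseteq> univ M" "sat M (zs @ e) \<phi>" by blast
    then obtain xs y where "zs = xs @ [y]" by (cases zs rule: rev_cases) auto
    with zs show "\<exists>y\<in>univ M. \<exists>xs. length xs = k \<and> set xs \<subseteq> univ M \<and> sat M (xs @ y # e) \<phi>" by auto
  qed
  finally show ?case .
qed simp

lemma fm_in_Ex_funpow: "fm_in \<tau> n ((Ex ^^ k) \<phi>) \<longleftrightarrow> fm_in \<tau> (n + k) \<phi>"
  by (induction k arbitrary: n) auto

lemma sat_Th_iff:
  assumes "\<forall>\<phi>\<in>Th \<tau> M. sat D [] \<phi>" "fm_in \<tau> 0 \<phi>" shows "sat D [] \<phi> \<longleftrightarrow> sat M [] \<phi>"
  using assms(1)[rule_format, of \<phi>] assms(1)[rule_format, of "Neg \<phi>"] assms(2) by (auto simp: Th_def)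

lemma univ_sum_struc: "univ (M \<oplus>\<^sub>s N) = Inl ` univ M \<union> Inr ` univ N"
  by (simp add: sum_struc_def)

lemma rel_sum_struc:
  "rel (M \<oplus>\<^sub>s N) LSym = {[Inl a] | a. a \<in> univ M}"
  "rel (M \<oplus>\<^sub>s N) RSym = {[Inr b] | b. b \<in> univ N}"
  "rel (M \<oplus>\<^sub>s N) (Old S) = map Inl ` rel M S \<union> map Inr ` rel N S"
  by (simp_all add: sum_struc_def)

lemma map_image_iff:
  assumes "inj j" shows "map j xs \<in> map j ` R \<longleftrightarrow> xs \<in> R"
  using assms by (simp add: inj_image_mem_iff)

definition part ::
    "'s vocab \<Rightarrow> ('s sum_sym, 'm) struc \<Rightarrow> 's sum_sym \<Rightarrow> ('s, 'a) struc \<Rightarrow> ('s, 'm) struc" where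
  "part \<tau> C P M = \<lparr> univ = {x \<in> univ C. [x] \<in> rel C P},
     rel = (\<lambda>S. if ar \<tau> S = 0 then {[]} \<inter> {xs. [] \<in> rel M S}
       else {xs \<in> rel C (Old S). \<forall>x\<in>set xs. [x] \<in> rel C P}) \<rparr>"

text \<open>A nullary symbol is true in a sum iff it is true in one of the summands, so its value in a
  summand is not determined by the sum and has to be taken from the original structure.\<close>

lemma monster_sum_parts:
  fixes M1 :: "('s, 'a) struc" and M2 :: "('s, 'b) struc" and C :: "('s sum_sym, 'm) struc"
  assumes M1: "is_structure \<tau> M1" and M2: "is_structure \<tau> M2"
    and C: "is_structure (sum_vocab \<tau>) C"
    and Th: "\<forall>\<phi>\<in>Th (sum_vocab \<tau>) (M1 \<oplus>\<^sub>s M2). sat C [] \<phi>"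
  shows "sum_parts \<tau> C (part \<tau> C LSym M1) (part \<tau> C RSym M2) LSym RSym"
    and "fm_in \<tau> 0 \<phi> \<Longrightarrow> sat (part \<tau> C LSym M1) [] \<phi> \<longleftrightarrow> sat M1 [] \<phi>"
    and "fm_in \<tau> 0 \<phi> \<Longrightarrow> sat (part \<tau> C RSym M2) [] \<phi> \<longleftrightarrow> sat M2 [] \<phi>"
proof -
  let ?\<tau> = "sum_vocab \<tau>" and ?M = "M1 \<oplus>\<^sub>s M2"
  let ?CL = "part \<tau> C LSym M1" and ?CR = "part \<tau> C RSym M2"
  note rM = rel_sum_struc[of M1 M2] and uM = univ_sum_struc[of M1 M2]
  have Th_iff: "sat C [] \<phi> \<longleftrightarrow> sat ?M [] \<phi>" if "fm_in ?\<tau> 0 \<phi>" for \<phi>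
    by (rule sat_Th_iff[OF Th that])
  have relC: "set xs \<subseteq> univ C \<and> length xs = ar ?\<tau> S" if "xs \<in> rel C S" "S \<in> syms ?\<tau>" for S xs
  proof -
    have "xs \<in> lists (univ C) \<and> length xs = ar ?\<tau> S" using C that unfolding is_structure_def by blast
    then show ?thesis by auto
  qed
  have [simp]: "S \<in> syms ?\<tau> \<longleftrightarrow> (case S of Old S' \<Rightarrow> S' \<in> syms \<tau> | _ \<Rightarrow> True)" for S
    by (cases S) (auto simp: sum_vocab_def)
  have [simp]: "ar ?\<tau> (Old S) = ar \<tau> S" "ar ?\<tau> LSym = 1" "ar ?\<tau> RSym = 1" for S
    by (simp_all add: sum_vocab_def)
  have rel1: "length xs = ar \<tau> S \<and> set xs \<subseteq> univ M1" if "xs \<in> rel M1 S" "S \<in> syms \<tau>" for xs S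
  proof -
    have "xs \<in> lists (univ M1) \<and> length xs = ar \<tau> S" using M1 that unfolding is_structure_def by blast
    then show ?thesis by auto
  qed
  have rel2: "length xs = ar \<tau> S \<and> set xs \<subseteq> univ M2" if "xs \<in> rel M2 S" "S \<in> syms \<tau>" for xs S
  proof -
    have "xs \<in> lists (univ M2) \<and> length xs = ar \<tau> S" using M2 that unfolding is_structure_def by blast
    then show ?thesis by auto
  qed
  \<comment> \<open>Being a sum is visible to sentences: the facts from here to
    \<open>nullary\<close> are first-order and hold in \<open>M1 \<oplus>\<^sub>s M2\<close>, hence
    in \<open>C\<close>.\<close>
  have cover: "[y] \<in> rel C LSym \<or> [y] \<in> rel C RSym" if "y \<in> univ C" for y
    using Th_iff[of "Neg (Ex (Conj (Neg (Rel LSym [0])) (Neg (Rel RSym [0]))))"] that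
    by (auto simp: rM uM)
  have disj: "\<not> ([y] \<in> rel C LSym \<and> [y] \<in> rel C RSym)" if "y \<in> univ C" for y
    using Th_iff[of "Neg (Ex (Conj (Rel LSym [0]) (Rel RSym [0])))"] that
    by (auto simp: rM uM)
  have ex: "\<exists>y\<in>univ C. [y] \<in> rel C LSym" "\<exists>y\<in>univ C. [y] \<in> rel C RSym"
  proof -
    have "univ M1 \<noteq> {}" "univ M2 \<noteq> {}" using M1 M2 unfolding is_structure_def by simp_all
    then show "\<exists>y\<in>univ C. [y] \<in> rel C LSym" "\<exists>y\<in>univ C. [y] \<in> rel C RSym"
      using Th_iff[of "Ex (Rel LSym [0])"] Th_iff[of "Ex (Rel RSym [0])"] by (auto simp: rM uM)
  qed
  have mixed: "[xs ! j] \<in> rel C LSym"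
    if xs: "xs \<in> rel C (Old S)" and S: "S \<in> syms \<tau>" and ij: "i < ar \<tau> S" "j < ar \<tau> S"
      and i: "[xs ! i] \<in> rel C LSym" for xs S i j
  proof -
    let ?k = "ar \<tau> S"
    \<comment> \<open>Under the \<open>?k\<close> quantifiers of \<open>Ex ^^ ?k\<close> the
      variables below \<open>?k\<close> are the components of one tuple. The sentence to be refuted
      says that some related tuple has its \<open>i\<close>-th entry in the left part and its
      \<open>j\<close>-th outside.\<close>
    let ?\<psi> = "Conj (Rel (Old S) [0..<?k]) (Conj (Rel LSym [i]) (Neg (Rel LSym [j])))"
    have xl: "length xs = ?k" "set xs \<subseteq> univ C" using relC[OF xs] S by auto
    have "\<not> sat ?M [] ((Ex ^^ ?k) ?\<psi>)"
    proof
      assume "sat ?M [] ((Ex ^^ ?k) ?\<psi>)"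
      then obtain ys where ys: "length ys = ?k" "sat ?M (ys @ []) ?\<psi>" unfolding sat_Ex_funpow by blast
      have "map (\<lambda>i. ys ! i) [0..<?k] = ys" using ys(1) map_nth[of ys] by simp
      with ys have "ys \<in> map Inl ` rel M1 S \<union> map Inr ` rel M2 S" by (simp add: rM)
      then show False
      proof
        assume "ys \<in> map Inl ` rel M1 S"
        then obtain zs where zs: "zs \<in> rel M1 S" "ys = map Inl zs" by blast
        then have "zs ! j \<in> univ M1" using rel1[OF zs(1) S] ij by auto
        then show False using ys(2) zs(2) rel1[OF zs(1) S] ij by (auto simp: rM)
      next
        assume "ys \<in> map Inr ` rel M2 S"
        then obtain zs where zs: "zs \<in> rel M2 S" "ys = map Inr zs" by blast
        then show False using ys(2) rel2[OF zs(1) S] ij by (auto simp: rM)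
      qed
    qed
    moreover have "fm_in ?\<tau> 0 ((Ex ^^ ?k) ?\<psi>)" unfolding fm_in_Ex_funpow using S ij by simp
    ultimately have no: "\<not> sat C [] ((Ex ^^ ?k) ?\<psi>)" using Th_iff by blast
    have xx: "map (\<lambda>i. xs ! i) [0..<?k] = xs" using xl(1) map_nth[of xs] by simp
    show ?thesis
    proof (rule ccontr)
      assume "[xs ! j] \<notin> rel C LSym"
      then have "sat C (xs @ []) ?\<psi>" using xs i xx by simp
      with no xl show False unfolding sat_Ex_funpow by blast
    qed
  qed
  have nullary: "[] \<in> rel C (Old S) \<longleftrightarrow> [] \<in> rel M1 S \<or> [] \<in> rel M2 S" if "S \<in> syms \<tau>" "ar \<tau> S = 0" for S
    using Th_iff[of "Rel (Old S) []"] that by (auto simp: rM)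
  have uL: "univ ?CL = {y \<in> univ C. [y] \<in> rel C LSym}" and uR: "univ ?CR = {y \<in> univ C. [y] \<in> rel C RSym}"
    by (simp_all add: part_def)
  have rel_part: "rel C P = {[y] | y. y \<in> univ C \<and> [y] \<in> rel C P}" if "P \<in> {LSym, RSym}" for P
  proof -
    have "length xs = 1 \<and> set xs \<subseteq> univ C" if "xs \<in> rel C P" for xs
      using relC[OF that] \<open>P \<in> _\<close> by auto
    then show ?thesis by (fastforce simp: length_Suc_conv)
  qed
  have sub: "set xs \<subseteq> univ C" if "xs \<in> rel C (Old S)" "S \<in> syms \<tau>" for xs S
    using relC[OF that(1)] that(2) by simp
  have len: "length xs = ar \<tau> S" if "xs \<in> rel C (Old S)" "S \<in> syms \<tau>" for xs S
    using relC[OF that(1)] that(2) by simp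
  show parts: "sum_parts \<tau> C ?CL ?CR LSym RSym"
  proof
    show "is_structure \<tau> ?CL" "is_structure \<tau> ?CR"
      using ex sub len by (auto simp: is_structure_def part_def subset_iff in_lists_conv_set)
    show "univ C = univ ?CL \<union> univ ?CR" using cover by (auto simp: uL uR)
    show "univ ?CL \<inter> univ ?CR = {}" using disj by (auto simp: uL uR)
    show "rel C LSym = {[a] |a. a \<in> univ ?CL}" "rel C RSym = {[a] |a. a \<in> univ ?CR}"
      using rel_part by (simp_all add: uL uR)
    fix S assume S: "S \<in> syms \<tau>"
    show "rel C (Old S) = rel ?CL S \<union> rel ?CR S"
    proof (cases "ar \<tau> S = 0")
      case True
      have "rel C (Old S) \<subseteq> {[]}" using len[OF _ S] True by auto
      then show ?thesis using nullary[OF S True] True by (auto simp: part_def)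
    next
      case False
      have "(\<forall>y\<in>set xs. [y] \<in> rel C LSym) \<or> (\<forall>y\<in>set xs. [y] \<in> rel C RSym)"
        if xs: "xs \<in> rel C (Old S)" for xs
      proof (cases "[xs ! 0] \<in> rel C LSym")
        case True
        have "[xs ! j] \<in> rel C LSym" if "j < length xs" for j
          using mixed[OF xs S _ _ True, of j] that len[OF xs S] False by simp
        then show ?thesis by (auto simp: in_set_conv_nth)
      next
        case no: False
        have "[xs ! j] \<notin> rel C LSym" if "j < length xs" for j
          using mixed[OF xs S _ _, of j 0] that len[OF xs S] False no by auto
        then have "[y] \<notin> rel C LSym" if "y \<in> set xs" for y
          using that by (auto simp: in_set_conv_nth)
        then have "[y] \<in> rel C RSym" if "y \<in> set xs" for y
          using cover[of y] sub[OF xs S] that by blast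
        then show ?thesis by blast
      qed
      then show ?thesis using False by (auto simp: part_def)
    qed
  qed simp
  interpret sum_parts \<tau> C ?CL ?CR LSym RSym by (rule parts)
  have Zl: "[] \<in> rel ?CL S \<longleftrightarrow> [] \<in> rel M1 S" if "S \<in> syms \<tau>" for S
    using rel1[of "[]" S] relC[of "[]" "Old S"] that by (auto simp: part_def)
  have Zr: "[] \<in> rel ?CR S \<longleftrightarrow> [] \<in> rel M2 S" if "S \<in> syms \<tau>" for S
    using rel2[of "[]" S] relC[of "[]" "Old S"] that by (auto simp: part_def)
  show "sat ?CL [] \<phi> \<longleftrightarrow> sat M1 [] \<phi>" if \<phi>: "fm_in \<tau> 0 \<phi>"
  proof -
    \<comment> \<open>One relativized sentence is evaluated twice: in \<open>C\<close> it speaks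
      about \<open>?CL\<close>, in the original sum about \<open>M1\<close>.\<close>
    have "sat ?M (map Inl []) (relat LSym {S. [] \<in> rel ?CL S} \<phi>) \<longleftrightarrow> sat M1 [] \<phi>"
    proof (rule sat_relat[where \<tau> = \<tau>])
      fix S and xs :: "'a list" assume S: "S \<in> syms \<tau>" and xs: "xs \<noteq> []"
      have "map Inl xs \<notin> map Inr ` rel M2 S" using xs by (cases xs) auto
      then show "map Inl xs \<in> rel ?M (Old S) \<longleftrightarrow> xs \<in> rel M1 S"
        by (simp add: rM map_image_iff inj_Inl)
    qed (use \<phi> Zl in \<open>auto simp: rM uM\<close>)
    moreover have "sat ?CL [] \<phi> \<longleftrightarrow> sat C [] (relL \<phi>)" using sat_relL[of "[]" \<phi>] \<phi> by simp
    moreover have "sat C [] (relL \<phi>) \<longleftrightarrow> sat ?M [] (relL \<phi>)" by (rule Th_iff[OF fm_in_relL[OF \<phi>]])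
    ultimately show ?thesis unfolding relL_def by simp
  qed
  interpret R: sum_parts \<tau> C ?CR ?CL RSym LSym by (rule swap)
  show "sat ?CR [] \<phi> \<longleftrightarrow> sat M2 [] \<phi>" if \<phi>: "fm_in \<tau> 0 \<phi>"
  proof -
    have "sat ?M (map Inr []) (relat RSym {S. [] \<in> rel ?CR S} \<phi>) \<longleftrightarrow> sat M2 [] \<phi>"
    proof (rule sat_relat[where \<tau> = \<tau>])
      fix S and xs :: "'b list" assume S: "S \<in> syms \<tau>" and xs: "xs \<noteq> []"
      have "map Inr xs \<notin> map Inl ` rel M1 S" using xs by (cases xs) auto
      then show "map Inr xs \<in> rel ?M (Old S) \<longleftrightarrow> xs \<in> rel M2 S"
        by (simp add: rM map_image_iff inj_Inr)
    qed (use \<phi> Zr in \<open>auto simp: rM uM\<close>)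
    moreover have "sat ?CR [] \<phi> \<longleftrightarrow> sat C [] (R.relL \<phi>)" using R.sat_relL[of "[]" \<phi>] \<phi> by simp
    moreover have "sat C [] (R.relL \<phi>) \<longleftrightarrow> sat ?M [] (R.relL \<phi>)" by (rule Th_iff[OF R.fm_in_relL[OF \<phi>]])
    ultimately show ?thesis unfolding R.relL_def by simp
  qed
qed

lemma nonsd_cong:
  assumes "fsat \<tau> C" "fsat \<tau> D" "\<And>\<phi>. fm_in \<tau> 0 \<phi> \<Longrightarrow> sat C [] \<phi> \<longleftrightarrow> sat D [] \<phi>"
  shows "nonsd l \<tau> C \<longleftrightarrow> nonsd l \<tau> D"
proof -
  have "elem \<tau> C D {}" "elem \<tau> D C {}" using assms(3) by (auto simp: elem_empty)
  then show ?thesis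
    using nonsd_transfer[OF _ assms(1,2)] nonsd_transfer[OF _ assms(2,1)] by (intro iffI)
qed

theorem theorem4p5:
  fixes l :: nat
    and \<tau> :: "'s vocab"
    and M1 :: "('s, 'a) struc" and M2 :: "('s, 'b) struc"
    and C :: "('s sum_sym, 'm) struc" and C1 :: "('s, 'm1) struc" and C2 :: "('s, 'm2) struc"
    and \<kappa> :: "'k rel" and \<kappa>1 :: "'k1 rel" and \<kappa>2 :: "'k2 rel"
  assumes "l \<in> {1, 2, 3}"
    and "is_structure \<tau> M1" and "is_structure \<tau> M2"
    and "monster_model (sum_vocab \<tau>) (Th (sum_vocab \<tau>) (M1 \<oplus>\<^sub>s M2)) \<kappa> C"
    and "monster_model \<tau> (Th \<tau> M1) \<kappa>1 C1"
    and "monster_model \<tau> (Th \<tau> M2) \<kappa>2 C2"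
  shows "strongly_dependent l (sum_vocab \<tau>) \<kappa> C \<longleftrightarrow>
         strongly_dependent l \<tau> \<kappa>1 C1 \<and> strongly_dependent l \<tau> \<kappa>2 C2"
proof -
  note C = assms(4)[unfolded monster_model_def] and C1 = assms(5)[unfolded monster_model_def]
    and C2 = assms(6)[unfolded monster_model_def]
  have fC: "fsat (sum_vocab \<tau>) C" and fC1: "fsat \<tau> C1" and fC2: "fsat \<tau> C2"
    using C C1 C2 fsat_if_saturated by blast+
  let ?CL = "part \<tau> C LSym M1" and ?CR = "part \<tau> C RSym M2"
  have "is_structure (sum_vocab \<tau>) C" "\<forall>\<phi>\<in>Th (sum_vocab \<tau>) (M1 \<oplus>\<^sub>s M2). sat C [] \<phi>" using C by simp_all
  note P = monster_sum_parts[OF assms(2,3) this]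
  interpret sum_parts \<tau> C ?CL ?CR LSym RSym by (rule P(1))
  \<comment> \<open>\<open>?CL\<close> and \<open>C1\<close> are both omega-saturated models of the
    theory of \<open>M1\<close>, although they live on different types.\<close>
  have "nonsd l \<tau> ?CL \<longleftrightarrow> nonsd l \<tau> C1"
    by (rule nonsd_cong[OF fsat_L[OF fC] fC1]) (use P(2) sat_Th_iff[of \<tau> M1 C1] C1 in simp)
  moreover have "nonsd l \<tau> ?CR \<longleftrightarrow> nonsd l \<tau> C2"
    by (rule nonsd_cong[OF sum_parts.fsat_L[OF swap fC] fC2]) (use P(3) sat_Th_iff[of \<tau> M2 C2] C2 in simp)
  moreover have "strongly_dependent l (sum_vocab \<tau>) \<kappa> C \<longleftrightarrow> \<not> nonsd l (sum_vocab \<tau>) C"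
    by (rule strongly_dependent_iff[OF assms(1)]) (use C in simp_all)
  moreover have "strongly_dependent l \<tau> \<kappa>1 C1 \<longleftrightarrow> \<not> nonsd l \<tau> C1"
    by (rule strongly_dependent_iff[OF assms(1)]) (use C1 in simp_all)
  moreover have "strongly_dependent l \<tau> \<kappa>2 C2 \<longleftrightarrow> \<not> nonsd l \<tau> C2"
    by (rule strongly_dependent_iff[OF assms(1)]) (use C2 in simp_all)
  ultimately show ?thesis using nonsd_iff[OF fC, of l] by simp
qed

end
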